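(* Let $f$ be a real vector field on $\mathbb{R}^d$ and let $\mathcal{S}_h^{[2]}$ be a time-symmetric 2nd-order method for $x'=f(x)$. Let $\alpha_1,\dots,\alpha_s\in\mathbb{C}$ satisfy $\alpha_{s+1-j}=\bar\alpha_j$ for $j=1,\dots,s$, and suppose that the symmetric-conjugate composition $$\psi_h^{[r]}=\mathcal{S}^{[2]}_{\alpha_s h}\circ\mathcal{S}^{[2]}_{\alpha_{s-1}h}\circ\cdots\circ\mathcal{S}^{[2]}_{\alpha_2 h}\circ\mathcal{S}^{[2]}_{\alpha_1 h}=\mathcal{S}^{[2]}_{\bar\alpha_1 h}\circ\mathcal{S}^{[2]}_{\bar\alpha_2 h}\circ\cdots\circ\mathcal{S}^{[2]}_{\alpha_2 h}\circ\mathcal{S}^{[2]}_{\alpha_1 h}$$ is of order $r\ge 3$. Consider its real part $$\hat R_h^{[2n]}=\tfrac12\left(\psi_h^{[r]}+\overline{\psi}_h^{[r]}\right),$$ where $n\ge2$ is the integer determined by $r=2n-1$ if $r$ is odd and $r=2n$ if $r$ is even. Then: (a) If $\psi_h^{[r]}$ is of odd order $r=2n-1$, $n=2,3,\ldots$, then $\hat R_h^{[2n]}$ is a method of order $2n$ and is pseudo-symmetric of order $q=4n-1$. If in addition $f$ is a (real) Hamiltonian vector field and $\mathcal{S}_h^{[2]}$ is a symplectic integrator, then $\hat R_h^{[2n]}$ is pseudo-symplectic of order $p=4n-1$. (b) If $\psi_h^{[r]}$ is of even order $r=2n$, $n=2,3,\ldots$, then $\hat R_h^{[2n]}$ is a method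 of order $2n$ and is pseudo-symmetric of order $q=4n+3$. If in addition $f$ is a (real) Hamiltonian vector field and $\mathcal{S}_h^{[2]}$ is a symplectic integrator, then $\hat R_h^{[2n]}$ is pseudo-symplectic of order $p=4n+3$.
   Context: Consider the initial value problem $x'=f(x)$, $x(t_0)=x_0\in\mathbb{R}^d$, with exact flow $\varphi_t$. An integrator (one-step map) $\psi_h$ is of order $r$ if $\psi_h(x)=\varphi_h(x)+\mathcal{O}(h^{r+1})$ as $h\to0$; it is consistent if it is of order at least 1. A time-symmetric 2nd-order method $\mathcal{S}_h^{[2]}$ satisfies $\mathcal{S}_h^{[2]}(x)=\varphi_h(x)+\mathcal{O}(h^3)$ and $\mathcal{S}_h^{[2]}\circ\mathcal{S}_{-h}^{[2]}=\mathrm{id}$. The adjoint of an integrator $\psi_h$ is $\psi_h^*:=\psi_{-h}^{-1}$. Lie-series convention: with $F=\sum_i f_i(x)\,\partial/\partial x_i$ one has $g(\varphi_h(x))=\exp(hF)[g](x)$ as an expansion in powers of $h$ for smooth $g$, and $g(\mathcal{S}_h^{[2]}(x))=\Phi^{[2]}(h)[g](x)$ with $\Phi^{[2]}(h)=\exp(hF+h^3Y_3+h^5Y_5+\cdots)$, where the $Y_{2k+1}$ are differential operators (vector fields) depending on the method. Since $f$ is real, the basic method $\mathcal{S}_h^{[2]}$ is real, i.e. it maps real points to real points for real $h$ and the $Y_{2k+1}$ are real. The map $f$ and the basic method are assumed regular enough (e.g. real analytic) that $\mathcal{S}_{\alpha h}^{[2]}$ makes sense for complex $\alpha$ and small real $h$,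 with the series $\Phi^{[2]}(\alpha h)$. $\overline{\psi}_h^{[r]}$ denotes the complex conjugate method, i.e. the composition with each coefficient $\alpha_j$ replaced by $\bar\alpha_j$; so for real $x$ and real $h$, $\hat R_h^{[2n]}(x)=\Re(\psi_h^{[r]}(x))$. Definitions. Let $\psi_h$ be a smooth and consistent integrator. (1) $\psi_h$ is pseudo-symmetric of (pseudo-symmetry) order $q$ if for all sufficiently small $h$, $\psi_h^*=\psi_h+\mathcal{O}(h^{q+1})$, where the constant in the $\mathcal{O}$-term depends on bounds of derivatives of $\psi_h$. (2) $\psi_h$ is pseudo-symplectic of (pseudo-symplecticity) order $p$ if for all sufficiently small $h$, when it is applied to a Hamiltonian system, $(\psi_h')^TJ\,\psi_h'=J+\mathcal{O}(h^{p+1})$, where $\psi_h'$ is the Jacobian matrix with respect to $x$, $J$ is the canonical symplectic matrix, and the constant in the $\mathcal{O}$-term depends on bounds of derivatives of $\psi_h$. *)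

theory Defs
  imports "HOL-Analysis.Analysis" "HOL-Library.Landau_Symbols"
begin

text \<open>For open \<open>U\<close> in a Euclidean space, \<open>Ck_on k U g\<close> is the usual class \<open>C\<^sup>k\<close>: all iterated
  directional derivatives up to order \<open>k\<close> exist and are continuous on \<open>U\<close>.\<close>

primrec Ck_on :: "nat \<Rightarrow> 'a::real_normed_vector set \<Rightarrow> ('a \<Rightarrow> 'b::real_normed_vector) \<Rightarrow> bool" where
  "Ck_on 0 U g \<longleftrightarrow> continuous_on U g"
| "Ck_on (Suc k) U g \<longleftrightarrow>
     (\<forall>z\<in>U. g differentiable (at z)) \<and> (\<forall>v. Ck_on k U (\<lambda>z. frechet_derivative g (at z) v))"

definition smooth_on :: "'a::real_normed_vector set \<Rightarrow> ('a \<Rightarrow> 'b::real_normed_vector) \<Rightarrow> bool" where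
  "smooth_on U g \<longleftrightarrow> (\<forall>k. Ck_on k U g)"

definition holomorphic_map ::
    "(complex \<times> (complex^'d)) set \<Rightarrow> (complex \<times> (complex^'d) \<Rightarrow> complex^'d) \<Rightarrow> bool" where
  "holomorphic_map W G \<longleftrightarrow>
     (\<forall>p\<in>W. \<exists>D. (G has_derivative D) (at p) \<and> (\<forall>c a v. D (c * a, c *s v) = c *s D (a, v)))"

definition cvec :: "real^'d \<Rightarrow> complex^'d" where
  "cvec x = (\<chi> i. complex_of_real (x $ i))"

definition vec_Re :: "complex^'d \<Rightarrow> real^'d" where
  "vec_Re z = (\<chi> i. Re (z $ i))"

text \<open>A one-step map need only make sense for step sizes that are small locally uniformly in the
  initial value, so a one-step map is a total function of which only the germ along
  \<open>{0} \<times> \<real>\<^sup>d\<close> matters. Such a map \<open>S\<close> is real analytic iff it admits an extension \<open>Sc\<close> as below;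
  the germ of \<open>Sc\<close> along \<open>{0} \<times> \<real>\<^sup>d\<close> is then determined by \<open>S\<close>, and it is what gives meaning to
  complex step sizes.\<close>

definition complex_extension ::
    "(real \<Rightarrow> real^'d \<Rightarrow> real^'d) \<Rightarrow> (complex \<Rightarrow> complex^'d \<Rightarrow> complex^'d) \<Rightarrow> bool" where
  "complex_extension S Sc \<longleftrightarrow>
     (\<exists>W. open W \<and> (\<forall>x. (0, cvec x) \<in> W) \<and> holomorphic_map W (\<lambda>(h, z). Sc h z) \<and>
          (\<forall>h x. (complex_of_real h, cvec x) \<in> W \<longrightarrow>
             Sc (complex_of_real h) (cvec x) = cvec (S h x)))"

definition smooth_integrator :: "(real \<Rightarrow> real^'d \<Rightarrow> real^'d) \<Rightarrow> bool" where
  "smooth_integrator \<psi> \<longleftrightarrow>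
     (\<forall>x0. \<exists>U. open U \<and> (0, x0) \<in> U \<and> smooth_on U (\<lambda>(h, x). \<psi> h x))"

definition exact_flow ::
    "('a::real_normed_vector \<Rightarrow> 'a) \<Rightarrow> (real \<Rightarrow> 'a \<Rightarrow> 'a) \<Rightarrow> bool" where
  "exact_flow f \<phi> \<longleftrightarrow>
     (\<forall>x. \<phi> 0 x = x) \<and>
     (\<forall>x0. \<forall>\<^sub>F (t, x) in nhds 0 \<times>\<^sub>F nhds x0.
        ((\<lambda>s. \<phi> s x) has_vector_derivative f (\<phi> t x)) (at t))"

text \<open>\<open>E h x = O(h\<^sup>k)\<close> as \<open>h \<rightarrow> 0\<close> (from both sides), uniformly for \<open>x\<close> near \<open>x0\<close>.\<close>

definition bigO_step ::
    "'a::topological_space \<Rightarrow> nat \<Rightarrow> (real \<Rightarrow> 'a \<Rightarrow> 'b::real_normed_vector) \<Rightarrow> bool" where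
  "bigO_step x0 k E \<longleftrightarrow>
     (\<lambda>(h, x). norm (E h x)) \<in> O[at 0 \<times>\<^sub>F nhds x0](\<lambda>(h, x). h ^ k)"

text \<open>The codomain is left general so that a composition with complex coefficients, started at
  real points, can be compared with the embedded real flow.\<close>

definition has_order ::
    "(real \<Rightarrow> 'a::topological_space \<Rightarrow> 'b::real_normed_vector) \<Rightarrow> nat \<Rightarrow> (real \<Rightarrow> 'a \<Rightarrow> 'b) \<Rightarrow> bool" where
  "has_order \<phi> r \<psi> \<longleftrightarrow> (\<forall>x0. bigO_step x0 (r + 1) (\<lambda>h x. \<psi> h x - \<phi> h x))"

definition time_symmetric :: "(real \<Rightarrow> 'a::topological_space \<Rightarrow> 'a) \<Rightarrow> bool" where
  "time_symmetric S \<longleftrightarrow> (\<forall>x0. \<forall>\<^sub>F (h, x) in nhds 0 \<times>\<^sub>F nhds x0. S h (S (- h) x) = x)"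

text \<open>The adjoint \<open>(\<psi>\<^bsub>-h\<^esub>)\<^sup>-\<^sup>1\<close>, as the inverse of the local diffeomorphism \<open>\<psi>\<^bsub>-h\<^esub>\<close> restricted
  to \<open>U\<close>.\<close>

definition adjoint_on :: "'a set \<Rightarrow> (real \<Rightarrow> 'a \<Rightarrow> 'a) \<Rightarrow> real \<Rightarrow> 'a \<Rightarrow> 'a" where
  "adjoint_on U \<psi> h = inv_into U (\<psi> (- h))"

definition pseudo_symmetric ::
    "(real \<Rightarrow> real^'d \<Rightarrow> real^'d) \<Rightarrow> nat \<Rightarrow> (real \<Rightarrow> real^'d \<Rightarrow> real^'d) \<Rightarrow> bool" where
  "pseudo_symmetric \<phi> q \<psi> \<longleftrightarrow>
     smooth_integrator \<psi> \<and> has_order \<phi> 1 \<psi> \<and>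
     (\<forall>x0. \<exists>U. open U \<and> x0 \<in> U \<and>
        (\<forall>\<^sub>F (h, x) in at 0 \<times>\<^sub>F nhds x0. inj_on (\<psi> (- h)) U \<and> x \<in> \<psi> (- h) ` U) \<and>
        bigO_step x0 (q + 1) (\<lambda>h x. adjoint_on U \<psi> h x - \<psi> h x))"

text \<open>The index type carries no ordering, so the canonical matrix is taken relative to an
  enumeration \<open>e 0, \<dots>, e (2m-1)\<close> of the coordinates \<open>q\<^sub>1, \<dots>, q\<^sub>m, p\<^sub>1, \<dots>, p\<^sub>m\<close>; in that ordering
  it has the blocks \<open>0, I, -I, 0\<close>.\<close>

definition canonical_J :: "nat \<Rightarrow> (nat \<Rightarrow> 'd::finite) \<Rightarrow> real^'d^'d" where
  "canonical_J m e = (\<chi> k l. if \<exists>i<m. k = e i \<and> l = e (m + i) then 1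
                             else if \<exists>i<m. k = e (m + i) \<and> l = e i then - 1 else 0)"

definition hamiltonian_field :: "real^'d^'d \<Rightarrow> (real^'d \<Rightarrow> real^'d) \<Rightarrow> bool" where
  "hamiltonian_field J f \<longleftrightarrow> (\<exists>H. \<forall>x. \<exists>g. GDERIV H x :> g \<and> f x = J *v g)"

definition symplectic_defect ::
    "real^'d^'d \<Rightarrow> (real \<Rightarrow> real^'d \<Rightarrow> real^'d) \<Rightarrow> real \<Rightarrow> real^'d \<Rightarrow> real^'d^'d" where
  "symplectic_defect J \<psi> h x =
     transpose (jacobian (\<psi> h) (at x)) ** J ** jacobian (\<psi> h) (at x) - J"

definition symplectic_integrator :: "real^'d^'d \<Rightarrow> (real \<Rightarrow> real^'d \<Rightarrow> real^'d) \<Rightarrow> bool" where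
  "symplectic_integrator J \<psi> \<longleftrightarrow>
     (\<forall>x0. \<forall>\<^sub>F (h, x) in nhds 0 \<times>\<^sub>F nhds x0.
        \<psi> h differentiable (at x) \<and> symplectic_defect J \<psi> h x = 0)"

definition pseudo_symplectic ::
    "real^'d^'d \<Rightarrow> (real \<Rightarrow> real^'d \<Rightarrow> real^'d) \<Rightarrow> nat \<Rightarrow> (real \<Rightarrow> real^'d \<Rightarrow> real^'d) \<Rightarrow> bool" where
  "pseudo_symplectic J \<phi> p \<psi> \<longleftrightarrow>
     smooth_integrator \<psi> \<and> has_order \<phi> 1 \<psi> \<and>
     (\<forall>x0. bigO_step x0 (p + 1) (symplectic_defect J \<psi>))"

primrec composition ::
    "(complex \<Rightarrow> 'z \<Rightarrow> 'z) \<Rightarrow> (nat \<Rightarrow> complex) \<Rightarrow> nat \<Rightarrow> real \<Rightarrow> 'z \<Rightarrow> 'z" where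
  "composition Sc \<alpha> 0 h = id"
| "composition Sc \<alpha> (Suc k) h = Sc (\<alpha> (Suc k) * complex_of_real h) \<circ> composition Sc \<alpha> k h"

text \<open>Half the sum of the composition and its complex conjugate method, as a map on \<open>\<real>\<^sup>d\<close>. For a
  basic method that is real, this half sum is itself real at real points and small \<open>h\<close>, so that
  \<open>vec_Re\<close> only changes the type there.\<close>

definition real_part_method ::
    "(complex \<Rightarrow> complex^'d \<Rightarrow> complex^'d) \<Rightarrow> (nat \<Rightarrow> complex) \<Rightarrow> nat \<Rightarrow> real \<Rightarrow> real^'d \<Rightarrow> real^'d" where
  "real_part_method Sc \<alpha> s h x =
     vec_Re ((1/2) *\<^sub>R (composition Sc \<alpha> s h (cvec x)
                        + composition Sc (\<lambda>j. cnj (\<alpha> j)) s h (cvec x)))"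

end

theory Submission
  imports Defs "HOL-Complex_Analysis.Conformal_Mappings"
begin

text \<open>Write \<open>\<psi>'\<close> for the conjugate of \<open>\<psi> = R + \<i> I\<close>, so \<open>\<psi>' = R - \<i> I\<close>. The basic method satisfies
  \<open>S\<^sub>a \<circ> S\<^sub>-\<^sub>a = id\<close> and commutes with conjugation for complex \<open>a\<close> as well, by the identity theorem;
  hence \<open>\<alpha>\<^sub>s\<^sub>+\<^sub>1\<^sub>-\<^sub>j = cnj \<alpha>\<^sub>j\<close> gives \<open>\<psi>'\<^sub>h \<circ> \<psi>\<^sub>-\<^sub>h = id\<close>. Comparing leading terms in this identity shows that the
  \<open>h\<^sup>r\<^sup>+\<^sup>1\<close> term of the error of \<open>\<psi>\<close> is imaginary for odd \<open>r\<close> and real for even \<open>r\<close>. So \<open>R\<close> has order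
  \<open>2n\<close>, and \<open>I = O(h\<^sup>m)\<close> with \<open>m = 2n\<close> and \<open>m = 2n + 2\<close>, respectively. The real part of
  \<open>\<psi>'\<^sub>h \<circ> \<psi>\<^sub>-\<^sub>h = id\<close> is then \<open>R\<^sub>h \<circ> R\<^sub>-\<^sub>h = id + O(h\<^sup>2\<^sup>m)\<close>, because \<open>I\<close> enters it only quadratically. In the same
  way the real part of \<open>(D\<psi>)\<^sup>T J D\<psi> = J\<close> is \<open>DR\<^sup>T J DR = J + O(h\<^sup>2\<^sup>m)\<close>.\<close>

text \<open>Orders are given at real points only, whereas the factors of the composition act at
  complex points. The passage goes through the Taylor coefficients in the step size: they are
  holomorphic in the initial value and vanish at real points, hence near them. Cauchy's estimate in
  state directions, which leave the step size fixed, then turns \<open>O(h^k)\<close> into a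
  Lipschitz constant \<open>O(h^k)\<close>. This is why orders add when an argument is perturbed,
  and where the exponent \<open>2m\<close> comes from. The second obstacle is the flow:
  \<open>\<phi>\<close> is a real map without a given complex extension, so the leading term of
  \<open>\<psi> - \<phi>\<close> cannot be expanded holomorphically as it stands. The truncated Lie
  series takes its place. Its vector field is read off from the method, as the derivative of
  \<open>Sc\<close> in the step size at zero; the series approximates the flow to any order, and
  with the opposite step it inverts the flow to the same order. Pseudo-symmetry further requires an
  inverse of \<open>R_{-h}\<close> on a neighbourhood independent of \<open>h\<close>. It is
  obtained by a contraction argument, as \<open>R_h - id\<close> has Lipschitz constant
  \<open>O(h)\<close>.\<close>

section \<open>Complex differentiability\<close>

text \<open>Multiplication by complex scalars on \<open>\<complex> \<times> \<complex>\<^sup>d\<close>, which is only a real vector space for the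
  library.\<close>

definition cscale :: "complex \<Rightarrow> complex \<times> (complex^'d) \<Rightarrow> complex \<times> (complex^'d)"
  where "cscale c p = (c * fst p, c *s snd p)"

lemma norm_vector_scalar_mult: "norm (c *s (v :: complex^'d)) = cmod c * norm v"
  by (simp add: norm_vec_def norm_mult L2_set_right_distrib)

lemma norm_cscale: "norm (cscale c p) = cmod c * norm p"
  by (cases p)
    (simp add: cscale_def norm_Pair norm_vector_scalar_mult norm_mult power_mult_distrib
      flip: distrib_left, simp add: real_sqrt_mult)

lemma bounded_linear_cscale_left: "bounded_linear (\<lambda>c. cscale c p)"
  by (rule bounded_linear_intro[where K = "norm p"])
    (auto simp: cscale_def norm_cscale[unfolded cscale_def] algebra_simps vec_eq_iff)

lemma cscale_simps [simp]:
  "cscale 0 p = 0" "cscale 1 p = p" "cscale c 0 = 0" "cscale c (cscale d p) = cscale (c * d) p"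
  "cscale (- c) p = - cscale c p"
  by (auto simp: cscale_def zero_prod_def vec_eq_iff)

lemma cscale_of_real: "cscale (of_real r) p = r *\<^sub>R p"
  by (cases p) (auto simp: cscale_def vec_eq_iff scaleR_conv_of_real[where 'a = complex])

text \<open>Maps into \<open>complex^'d\<close> are treated one coordinate at a time, so that
  restriction to a complex line \<open>p + cscale t w\<close> reduces estimates to functions of one
  complex variable.\<close>

definition cdiff :: "(complex \<times> (complex^'d) \<Rightarrow> complex) \<Rightarrow> complex \<times> (complex^'d) \<Rightarrow> bool"
  where "cdiff g p \<longleftrightarrow> (\<exists>D. (g has_derivative D) (at p) \<and> (\<forall>c w. D (cscale c w) = c * D w))"

abbreviation cD :: "(complex \<times> (complex^'d) \<Rightarrow> complex) \<Rightarrow> complex \<times> (complex^'d) \<Rightarrow> complex \<times> (complex^'d) \<Rightarrow> complex"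
  where "cD g p \<equiv> frechet_derivative g (at p)"

lemma cdiffI: "(g has_derivative D) (at p) \<Longrightarrow> (\<And>c w. D (cscale c w) = c * D w) \<Longrightarrow> cdiff g p"
  unfolding cdiff_def by blast

lemma cdiff_has_derivative: "cdiff g p \<Longrightarrow> (g has_derivative cD g p) (at p)"
  unfolding cdiff_def using frechet_derivative_works differentiable_def by blast

lemma cdiff_cD_cscale: "cdiff g p \<Longrightarrow> cD g p (cscale c w) = c * cD g p w"
  unfolding cdiff_def using frechet_derivative_at by metis

lemma linear_cD: "cdiff g p \<Longrightarrow> linear (cD g p)"
  by (meson cdiff_has_derivative has_derivative_linear)

lemma cdiff_isCont: "cdiff g p \<Longrightarrow> isCont g p"
  by (meson cdiff_has_derivative has_derivative_continuous)

lemma cdiff_line: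
  assumes "cdiff g (p + cscale t w)"
  shows "((\<lambda>t. g (p + cscale t w)) has_field_derivative cD g (p + cscale t w) w) (at t)"
proof -
  have 1: "((\<lambda>t. p + cscale t w) has_derivative (\<lambda>s. cscale s w)) (at t)"
    by (auto intro!: derivative_eq_intros bounded_linear_imp_has_derivative bounded_linear_cscale_left)
  have "((\<lambda>t. g (p + cscale t w)) has_derivative (\<lambda>s. cD g (p + cscale t w) (cscale s w))) (at t)"
    using has_derivative_compose[OF 1 cdiff_has_derivative[OF assms]] .
  moreover have "(\<lambda>s. cD g (p + cscale t w) (cscale s w)) = (*) (cD g (p + cscale t w) w)"
    using cdiff_cD_cscale[OF assms] by (auto simp: mult.commute)
  ultimately show ?thesis
    by (simp add: has_field_derivative_def)
qed

lemma cdiff_line_holomorphic: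
  assumes "\<And>t. t \<in> A \<Longrightarrow> cdiff g (p + cscale t w)"
  shows "(\<lambda>t. g (p + cscale t w)) holomorphic_on A"
  unfolding holomorphic_on_def field_differentiable_def
  using cdiff_line[OF assms] has_field_derivative_at_within by blast

text \<open>The bound \<open>M\<close> is required on a single disc in direction \<open>w\<close>,
  not on a ball. This matters for directions \<open>(0, v)\<close>, along which the step size is
  constant and \<open>M\<close> may depend on it.\<close>

lemma cdiff_Cauchy:
  assumes \<tau>: "0 < \<tau>"
    and "\<And>t. cmod t \<le> \<tau> \<Longrightarrow> cdiff g (p + cscale t w)"
    and "\<And>t. cmod t \<le> \<tau> \<Longrightarrow> cmod (g (p + cscale t w)) \<le> M"
  shows "cmod (cD g p w) \<le> M / \<tau>"
proof -
  let ?u = "\<lambda>t. g (p + cscale t w)"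
  have d: "(?u has_field_derivative cD g (p + cscale t w) w) (at t)" if "cmod t \<le> \<tau>" for t
    by (rule cdiff_line[OF assms(2)[OF that]])
  have "cmod ((deriv ^^ 1) ?u 0) \<le> fact 1 * M / \<tau> ^ 1"
  proof (rule Cauchy_inequality)
    show "?u holomorphic_on ball 0 \<tau>"
      by (rule cdiff_line_holomorphic) (use assms in auto)
    show "continuous_on (cball 0 \<tau>) ?u"
      by (intro continuous_at_imp_continuous_on ballI DERIV_isCont[OF d]) simp
  qed (use assms in auto)
  moreover have "deriv ?u 0 = cD g p w"
    using DERIV_imp_deriv[OF d[of 0]] \<tau> by simp
  ultimately show ?thesis by simp
qed

lemma cdiff_cD_bound:
  assumes "0 < \<rho>"
    and "\<And>q. q \<in> cball p \<rho> \<Longrightarrow> cdiff g q"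
    and "\<And>q. q \<in> cball p \<rho> \<Longrightarrow> cmod (g q) \<le> M"
  shows "cmod (cD g p w) \<le> M / \<rho> * norm w"
proof (cases "w = 0")
  case True
  have "cdiff g p" using assms(1,2) by auto
  then show ?thesis
    using True linear_0[OF linear_cD[OF \<open>cdiff g p\<close>]] assms by simp
next
  case False
  have m: "p + cscale t w \<in> cball p \<rho>" if "cmod t \<le> \<rho> / norm w" for t
    using that False by (simp add: dist_norm norm_cscale field_simps)
  have "cmod (cD g p w) \<le> M / (\<rho> / norm w)"
    by (rule cdiff_Cauchy) (use False assms m in auto)
  then show ?thesis by simp
qed

text \<open>Taylor expansion of \<open>u(t) = g (p + cscale t w)\<close> from \<open>0\<close> to
  \<open>1\<close>. The disc available to \<open>u\<close> has radius
  \<open>R = \<rho> / norm w \<ge> 2\<close>, so discs of radius \<open>R/2\<close> about points of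
  the unit disc fit into it, and Cauchy's inequality bounds \<open>u''\<close> by
  \<open>2 M / (R/2)^2\<close>, whence the factor 8.\<close>

lemma cdiff_Taylor2:
  assumes "0 < \<rho>"
    and cd: "\<And>q. q \<in> cball p \<rho> \<Longrightarrow> cdiff g q"
    and M: "\<And>q. q \<in> cball p \<rho> \<Longrightarrow> cmod (g q) \<le> M"
    and w: "norm w \<le> \<rho> / 2"
  shows "cmod (g (p + w) - g p - cD g p w) \<le> 8 * M / \<rho>\<^sup>2 * (norm w)\<^sup>2"
proof (cases "w = 0")
  case True
  have "cdiff g p" using assms(1,2) by auto
  then show ?thesis
    using True linear_0[OF linear_cD[OF \<open>cdiff g p\<close>]] assms by simp
next
  case False
  let ?u = "\<lambda>t. g (p + cscale t w)"
  define R where "R = \<rho> / norm w"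
  have R: "R \<ge> 2" "R > 0" using w False assms(1) by (auto simp: R_def field_simps)
  have m: "p + cscale t w \<in> cball p \<rho>" if "cmod t \<le> R" for t
    using that False by (simp add: dist_norm norm_cscale field_simps R_def)
  have d: "(?u has_field_derivative cD g (p + cscale t w) w) (at t)" if "cmod t \<le> R" for t
    by (rule cdiff_line[OF cd[OF m[OF that]]])
  have hol: "?u holomorphic_on ball 0 R"
    by (rule cdiff_line_holomorphic, rule cd[OF m]) simp
  have hd: "((deriv ^^ k) ?u has_field_derivative (deriv ^^ Suc k) ?u t) (at t)" if "cmod t < R" for k t
  proof -
    have "(deriv ^^ k) ?u holomorphic_on ball 0 R"
      using holomorphic_higher_deriv[OF hol] by simp
    then show ?thesis
      using that by (auto intro!: holomorphic_derivI[of _ "ball 0 R"])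
  qed
  have d2: "cmod ((deriv ^^ 2) ?u t) \<le> 8 * M / R\<^sup>2" if "cmod t \<le> 1" for t
  proof -
    have sub: "cmod x \<le> R" if "x \<in> cball t (R/2)" for x
    proof -
      have "cmod x \<le> cmod t + dist t x" 
        using norm_triangle_ineq4[of t "t - x"] by (simp add: dist_norm)
      then show ?thesis using that R \<open>cmod t \<le> 1\<close> by auto
    qed
    have subl: "cmod x < R" if "x \<in> ball t (R/2)" for x
    proof -
      have "cmod x \<le> cmod t + dist t x" 
        using norm_triangle_ineq4[of t "t - x"] by (simp add: dist_norm)
      then show ?thesis using that R \<open>cmod t \<le> 1\<close> by auto
    qed
    have "cmod ((deriv ^^ 2) ?u t) \<le> fact 2 * M / (R/2) ^ 2"
    proof (rule Cauchy_inequality)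
      show "?u holomorphic_on ball t (R/2)"
        by (rule holomorphic_on_subset[OF hol]) (use subl in auto)
      show "continuous_on (cball t (R/2)) ?u"
        by (intro continuous_at_imp_continuous_on ballI DERIV_isCont[OF d[OF sub]])
      show "0 < R / 2" using R by simp
      fix x assume "cmod (t - x) = R / 2"
      then have "x \<in> cball t (R/2)" by (simp add: dist_norm)
      then show "cmod (?u x) \<le> M" by (rule M[OF m[OF sub]])
    qed
    then show ?thesis by (simp add: power_divide)
  qed
  have "cmod ((deriv ^^ 0) ?u 1 - (\<Sum>i\<le>1. (deriv ^^ i) ?u 0 * (1 - 0) ^ i / fact i))
      \<le> 8 * M / R\<^sup>2 * cmod (1 - 0) ^ Suc 1 / fact 1"
  proof (rule complex_Taylor[where S = "cball 0 1"])
    fix i and x :: complex assume "x \<in> cball 0 1" "i \<le> (1::nat)"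
    with R have "cmod x < R" by auto
    then show "((deriv ^^ i) ?u has_field_derivative (deriv ^^ Suc i) ?u x) (at x within cball 0 1)"
      using has_field_derivative_at_within[OF hd] by blast
  next
    fix x :: complex assume "x \<in> cball 0 1"
    then show "cmod ((deriv ^^ Suc 1) ?u x) \<le> 8 * M / R\<^sup>2"
      using d2[of x] by (simp add: numeral_2_eq_2)
  qed auto
  moreover have "deriv ?u 0 = cD g p w"
    using DERIV_imp_deriv[OF d[of 0]] R by simp
  ultimately show ?thesis
    by (simp add: R_def power_divide diff_diff_eq)
qed

definition hol_at :: "(complex \<times> (complex^'d) \<Rightarrow> complex) \<Rightarrow> complex \<times> (complex^'d) \<Rightarrow> bool"
  where "hol_at g p \<longleftrightarrow> eventually (cdiff g) (nhds p)"

lemma hol_at_cdiff: "hol_at g p \<Longrightarrow> cdiff g p"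
  unfolding hol_at_def by (rule eventually_nhds_x_imp_x)

lemma hol_at_tendsto: "hol_at g p \<Longrightarrow> (g \<longlongrightarrow> g p) (nhds p)"
  using cdiff_isCont[OF hol_at_cdiff] continuous_at tendsto_nhds_iff isCont_def by metis

lemma hol_at_bounded:
  assumes "hol_at g p"
  obtains \<rho> M where "0 < \<rho>" "0 \<le> M" "\<And>q. q \<in> cball p \<rho> \<Longrightarrow> cdiff g q" "\<And>q. q \<in> cball p \<rho> \<Longrightarrow> cmod (g q) \<le> M"
proof -
  have "((\<lambda>q. cmod (g q)) \<longlongrightarrow> cmod (g p)) (nhds p)"
    by (intro tendsto_norm hol_at_tendsto assms)
  then have "eventually (\<lambda>q. cmod (g q) < cmod (g p) + 1) (nhds p)"
    by (rule order_tendstoD) simp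
  with assms have "eventually (\<lambda>q. cdiff g q \<and> cmod (g q) < cmod (g p) + 1) (nhds p)"
    unfolding hol_at_def by (rule eventually_conj)
  then obtain d where "d > 0" "\<And>q. dist q p < d \<Longrightarrow> cdiff g q \<and> cmod (g q) < cmod (g p) + 1"
    unfolding eventually_nhds_metric by blast
  then show ?thesis
    by (intro that[of "d/2" "cmod (g p) + 1"]) (auto simp: dist_commute intro: less_imp_le)
qed

text \<open>The constants serve all base points \<open>p\<close> near \<open>p0\<close> at once, as
  uniformity in the initial value requires.\<close>

lemma hol_at_Taylor2:
  fixes g :: "complex \<times> (complex^'d) \<Rightarrow> complex"
  assumes "hol_at g p0"
  obtains \<rho> C where "0 < \<rho>" "0 \<le> C" "\<And>q. q \<in> cball p0 (2 * \<rho>) \<Longrightarrow> cdiff g q"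
    "\<And>p w. p \<in> cball p0 \<rho> \<Longrightarrow> norm w \<le> \<rho> \<Longrightarrow> cmod (g (p + w) - g p - cD g p w) \<le> C * (norm w)\<^sup>2"
proof -
  obtain \<sigma> M where \<sigma>: "0 < \<sigma>" "0 \<le> M" "\<And>q. q \<in> cball p0 \<sigma> \<Longrightarrow> cdiff g q" "\<And>q. q \<in> cball p0 \<sigma> \<Longrightarrow> cmod (g q) \<le> M"
    using hol_at_bounded[OF assms] by blast
  \<comment> \<open>A ball of radius \<open>\<sigma>/2\<close> about a point within
    \<open>\<sigma>/4\<close> of \<open>p0\<close> stays in the domain of the bound; on it
    \<open>cdiff_Taylor2\<close> admits increments up to \<open>\<sigma>/4\<close>.\<close>
  have sub: "q \<in> cball p0 \<sigma>" if "p \<in> cball p0 (\<sigma>/4)" "q \<in> cball p (\<sigma>/2)" for p q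
    using that dist_triangle[of p0 q p] \<sigma>(1) by auto
  show ?thesis
  proof (rule that[of "\<sigma>/4" "8 * M / (\<sigma>/2)\<^sup>2"])
    fix p w :: "complex \<times> (complex^'d)" assume "p \<in> cball p0 (\<sigma>/4)" "norm w \<le> \<sigma>/4"
    with sub \<sigma> show "cmod (g (p + w) - g p - cD g p w) \<le> 8 * M / (\<sigma>/2)\<^sup>2 * (norm w)\<^sup>2"
      by (intro cdiff_Taylor2) auto
  qed (use \<sigma> in auto)
qed

text \<open>The directional derivative is a locally uniform limit of difference quotients, and by
  Cauchy's estimate the derivatives of the quotients converge uniformly as well.\<close>

lemma hol_at_cD:
  fixes g :: "complex \<times> (complex^'d) \<Rightarrow> complex"
  assumes "hol_at g p0"
  shows "hol_at (\<lambda>p. cD g p w) p0"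
proof -
  obtain \<rho> C where \<rho>: "0 < \<rho>" "0 \<le> C" "\<And>q. q \<in> cball p0 (2 * \<rho>) \<Longrightarrow> cdiff g q"
    "\<And>p w. p \<in> cball p0 \<rho> \<Longrightarrow> norm w \<le> \<rho> \<Longrightarrow> cmod (g (p + w) - g p - cD g p w) \<le> C * (norm w)\<^sup>2"
    using hol_at_Taylor2[OF assms] by blast
  \<comment> \<open>The shift by \<open>N\<close> makes every increment \<open>w / m n\<close>, from
    \<open>n = 0\<close> on, short enough for the Taylor estimate.\<close>
  obtain N where N: "norm w / \<rho> < real N"
    using reals_Archimedean2 by blast
  define m where "m n = (of_nat (n + N + 1) :: real)" for n
  have m: "m n > 0" "norm w / m n \<le> \<rho>" "m n \<ge> n" for n
  proof -
    show "m n > 0" "m n \<ge> n" by (auto simp: m_def)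
    have "norm w / \<rho> \<le> m n" using N by (simp add: m_def)
    then show "norm w / m n \<le> \<rho>" using \<open>m n > 0\<close> \<rho>(1) by (simp add: field_simps)
  qed
  define q where "q n p = of_real (m n) * (g (p + cscale (of_real (1 / m n)) w) - g p)" for n p
  have small: "norm (cscale (of_real (1 / m n)) w) \<le> \<rho>" for n
    using m(1,2)[of n] by (simp add: norm_cscale norm_divide)
  have q_cdiff: "cdiff (q n) p" if p: "p \<in> cball p0 \<rho>" for n p
  proof -
    let ?w = "cscale (of_real (1 / m n)) w"
    have "dist p0 (p + ?w) \<le> dist p0 p + norm ?w"
      using dist_triangle[of p0 "p + ?w" p] by (simp add: dist_norm)
    then have 1: "cdiff g p" "cdiff g (p + ?w)"
      using p small[of n] \<rho>(1) by (auto intro!: \<rho>(3))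
    have 2: "((\<lambda>p. p + ?w) has_derivative (\<lambda>v. v)) (at p)"
      by (auto intro!: derivative_eq_intros)
    have 3: "((\<lambda>p. g (p + ?w)) has_derivative (\<lambda>v. cD g (p + ?w) v)) (at p)"
      using has_derivative_compose[OF 2 cdiff_has_derivative[OF 1(2)]] .
    have "(q n has_derivative (\<lambda>v. of_real (m n) * (cD g (p + ?w) v - cD g p v))) (at p)"
      unfolding q_def by (intro derivative_intros 3 cdiff_has_derivative 1)
    then show ?thesis
      by (rule cdiffI) (simp only: cdiff_cD_cscale[OF 1(1)] cdiff_cD_cscale[OF 1(2)] right_diff_distrib mult.left_commute)
  qed
  have q_lim: "cmod (q n p - cD g p w) \<le> C * (norm w)\<^sup>2 / m n" if p: "p \<in> cball p0 \<rho>" for n p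
  proof -
    let ?w = "cscale (of_real (1 / m n)) w"
    have "cdiff g p" using p \<rho> by auto
    then have "q n p - cD g p w = of_real (m n) * (g (p + ?w) - g p - cD g p ?w)"
      using m(1)[of n] by (simp add: q_def cdiff_cD_cscale algebra_simps)
    moreover have "cmod (g (p + ?w) - g p - cD g p ?w) \<le> C * (norm ?w)\<^sup>2"
      using \<rho>(4)[OF p small] .
    ultimately have "cmod (q n p - cD g p w) \<le> m n * (C * (norm ?w)\<^sup>2)"
      using m(1)[of n] by (simp add: norm_mult)
    also have "\<dots> = C * (norm w)\<^sup>2 / m n"
      using m(1)[of n] by (simp add: norm_cscale norm_divide power_divide power2_eq_square)
    finally show ?thesis .
  qed
  \<comment> \<open>The difference of \<open>q n\<close> and \<open>q k\<close> is at most
    \<open>C * (norm w)^2 / m n + C * (norm w)^2 / m k\<close>; Cauchy's estimate on balls of radius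
    \<open>\<rho>/2\<close> divides this by \<open>\<rho>/2\<close>.\<close>
  define K where "K = C * (norm w)\<^sup>2 / (\<rho>/2)"
  have K: "K \<ge> 0" using \<rho> by (simp add: K_def)
  have D_diff: "cmod (cD (q n) p h - cD (q k) p h) \<le> (K / m n + K / m k) * norm h"
    if p: "p \<in> ball p0 (\<rho>/2)" for n k p h
  proof -
    have sub: "x \<in> cball p0 \<rho>" if "x \<in> cball p (\<rho>/2)" for x
      using that p dist_triangle[of p0 x p] by auto
    have c: "cdiff (\<lambda>x. q n x - q k x) x" "cD (\<lambda>x. q n x - q k x) x = (\<lambda>h. cD (q n) x h - cD (q k) x h)" if "x \<in> cball p0 \<rho>" for x
    proof -
      have "((\<lambda>x. q n x - q k x) has_derivative (\<lambda>h. cD (q n) x h - cD (q k) x h)) (at x)"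
        by (intro derivative_intros cdiff_has_derivative q_cdiff that)
      then show "cdiff (\<lambda>x. q n x - q k x) x" "cD (\<lambda>x. q n x - q k x) x = (\<lambda>h. cD (q n) x h - cD (q k) x h)"
        by (auto intro!: cdiffI simp: cdiff_cD_cscale[OF q_cdiff[OF that]] right_diff_distrib frechet_derivative_at[symmetric])
    qed
    have "cmod (cD (\<lambda>x. q n x - q k x) p h) \<le> (C * (norm w)\<^sup>2 / m n + C * (norm w)\<^sup>2 / m k) / (\<rho>/2) * norm h"
    proof (rule cdiff_cD_bound)
      fix x assume "x \<in> cball p (\<rho>/2)"
      then have x: "x \<in> cball p0 \<rho>" by (rule sub)
      show "cdiff (\<lambda>x. q n x - q k x) x" by (rule c[OF x])
      have "cmod (q n x - q k x) \<le> cmod (q n x - cD g x w) + cmod (q k x - cD g x w)"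
        using norm_triangle_ineq4[of "q n x - cD g x w" "q k x - cD g x w"] by simp
      then show "cmod (q n x - q k x) \<le> C * (norm w)\<^sup>2 / m n + C * (norm w)\<^sup>2 / m k"
        using q_lim[OF x, of n] q_lim[OF x, of k] by linarith
    qed (use \<rho> in auto)
    moreover have "p \<in> cball p0 \<rho>" using sub[of p] \<rho>(1) by auto
    ultimately show ?thesis
      by (simp add: c K_def add_divide_distrib divide_divide_eq_left mult.commute mult.left_commute)
  qed
  have minv: "(\<lambda>n. c / m n) \<longlonglongrightarrow> 0" for c
  proof (rule real_tendsto_divide_at_top)
    show "filterlim m at_top sequentially"
      by (rule filterlim_at_top_mono[OF filterlim_real_sequentially]) (use m(3) in auto)
  qed auto
  define g' where "g' p h = lim (\<lambda>n. cD (q n) p h)" for p h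
  have conv: "(\<lambda>n. cD (q n) p h) \<longlonglongrightarrow> g' p h" if p: "p \<in> ball p0 (\<rho>/2)" for p h
  proof -
    have "Cauchy (\<lambda>n. cD (q n) p h)"
    proof (rule metric_CauchyI)
      fix e :: real assume "e > 0"
      have "eventually (\<lambda>n. (K * norm h) / m n < e / 2) sequentially"
        by (rule order_tendstoD[OF minv]) (use \<open>e > 0\<close> in simp)
      then obtain M where M: "\<And>n. n \<ge> M \<Longrightarrow> (K * norm h) / m n < e / 2"
        unfolding eventually_sequentially by blast
      have "dist (cD (q n) p h) (cD (q k) p h) < e" if "n \<ge> M" "k \<ge> M" for n k
        unfolding dist_norm
        using D_diff[OF p, of n h k, unfolded distrib_right times_divide_eq_left] M[OF that(1)] M[OF that(2)]
        by linarith
      then show "\<exists>M. \<forall>m\<ge>M. \<forall>n\<ge>M. dist (cD (q m) p h) (cD (q n) p h) < e"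
        by blast
    qed
    then show ?thesis
      unfolding g'_def using Cauchy_convergent convergent_LIMSEQ_iff by blast
  qed
  have conv_rate: "cmod (cD (q n) p h - g' p h) \<le> (K / m n) * norm h" if p: "p \<in> ball p0 (\<rho>/2)" for n p h
  proof (rule tendsto_le[of sequentially])
    show "(\<lambda>k. cmod (cD (q n) p h - cD (q k) p h)) \<longlonglongrightarrow> cmod (cD (q n) p h - g' p h)"
      by (intro tendsto_intros conv p)
    show "(\<lambda>k. (K / m n + K / m k) * norm h) \<longlonglongrightarrow> (K / m n) * norm h"
      using tendsto_mult[OF tendsto_add[OF tendsto_const minv] tendsto_const, of "K / m n" K "norm h"] by simp
    show "\<forall>\<^sub>F x in sequentially. cmod (cD (q n) p h - cD (q x) p h) \<le> (K / m n + K / m x) * norm h"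
      using D_diff[OF p] by simp
  qed simp
  have lim_q: "(\<lambda>n. q n p) \<longlonglongrightarrow> cD g p w" if p: "p \<in> cball p0 \<rho>" for p
    by (rule LIM_zero_cancel, rule Lim_null_comparison[OF _ minv[of "C * (norm w)\<^sup>2"]]) (use q_lim[OF p] in auto)
  have sub: "p \<in> cball p0 \<rho>" if "p \<in> ball p0 (\<rho>/2)" for p
    using that \<rho> by auto
  have "\<exists>G. \<forall>x\<in>ball p0 (\<rho>/2). (\<lambda>n. q n x) \<longlonglongrightarrow> G x \<and> (G has_derivative g' x) (at x within ball p0 (\<rho>/2))"
  proof (rule has_derivative_sequence)
    show "(q n has_derivative cD (q n) x) (at x within ball p0 (\<rho>/2))" if "x \<in> ball p0 (\<rho>/2)" for n x
      by (rule has_derivative_at_withinI[OF cdiff_has_derivative[OF q_cdiff[OF sub[OF that]]]])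
    fix e :: real assume "e > 0"
    have "eventually (\<lambda>n. K / m n < e) sequentially"
      by (rule order_tendstoD[OF minv]) (use \<open>e > 0\<close> in simp)
    then show "\<forall>\<^sub>F n in sequentially. \<forall>x\<in>ball p0 (\<rho>/2). \<forall>h. cmod (cD (q n) x h - g' x h) \<le> e * norm h"
    proof eventually_elim
      case (elim n)
      show ?case
      proof (intro ballI allI)
        fix x h :: "complex \<times> (complex^'d)" assume x: "x \<in> ball p0 (\<rho>/2)"
        have "(K / m n) * norm h \<le> e * norm h"
          using less_imp_le[OF elim] by (rule mult_right_mono) simp
        then show "cmod (cD (q n) x h - g' x h) \<le> e * norm h"
          using conv_rate[OF x, of n h] by linarith
      qed
    qed
  next
    show "p0 \<in> ball p0 (\<rho>/2)" using \<rho> by simp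
    show "(\<lambda>n. q n p0) \<longlonglongrightarrow> cD g p0 w" using lim_q \<rho> by simp
  qed simp
  then obtain G where G: "\<And>x. x \<in> ball p0 (\<rho>/2) \<Longrightarrow> (\<lambda>n. q n x) \<longlonglongrightarrow> G x"
    "\<And>x. x \<in> ball p0 (\<rho>/2) \<Longrightarrow> (G has_derivative g' x) (at x within ball p0 (\<rho>/2))" by blast
  have GD: "G x = cD g x w" if "x \<in> ball p0 (\<rho>/2)" for x
    using LIMSEQ_unique[OF G(1)[OF that] lim_q[OF sub[OF that]]] .
  have "cdiff (\<lambda>p. cD g p w) x" if x: "x \<in> ball p0 (\<rho>/2)" for x
  proof (rule cdiffI)
    have "(G has_derivative g' x) (at x)"
      using G(2)[OF x] by (simp only: at_within_open[OF x open_ball])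
    then show "((\<lambda>p. cD g p w) has_derivative g' x) (at x)"
      using has_derivative_transform_within_open[of G "g' x" x UNIV "ball p0 (\<rho>/2)"] x GD by auto
    \<comment> \<open>Complex linearity survives the pointwise limit of the complex linear maps
      \<open>cD (q n) x\<close>.\<close>
    show "g' x (cscale c v) = c * g' x v" for c v
    proof (rule LIMSEQ_unique[OF conv[OF x]])
      show "(\<lambda>n. cD (q n) x (cscale c v)) \<longlonglongrightarrow> c * g' x v"
        by (simp add: cdiff_cD_cscale q_cdiff[OF sub[OF x]]) (intro tendsto_intros conv x)
    qed
  qed
  then show ?thesis
    unfolding hol_at_def eventually_nhds_metric using \<rho>(1)
    by (intro exI[of _ "\<rho>/2"]) (auto simp: dist_commute)
qed

lemma has_derivative_vec_nthI:
  fixes V :: "'a::real_normed_vector \<Rightarrow> 'b::euclidean_space^'d"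
  assumes "\<And>i. ((\<lambda>p. V p $ i) has_derivative D i) (at p)"
  shows "(V has_derivative (\<lambda>w. \<chi> i. D i w)) (at p)"
  unfolding has_derivative_componentwise_within[of V _ p UNIV]
proof
  fix b :: "'b^'d" assume "b \<in> Basis"
  then obtain i u where b: "b = axis i u" by (auto simp: Basis_vec_def)
  show "((\<lambda>x. V x \<bullet> b) has_derivative (\<lambda>x. (\<chi> i. D i x) \<bullet> b)) (at p)"
    unfolding b by (simp add: inner_axis) (rule has_derivative_inner_left[OF assms])
qed

section \<open>Closure properties of complex differentiability\<close>

lemma cdiff_const [intro]: "cdiff (\<lambda>_. c) p"
  by (rule cdiffI[where D = "\<lambda>_. 0"]) auto

lemma cdiff_fst [intro]: "cdiff fst p"
  by (rule cdiffI[where D = fst]) (auto simp: cscale_def intro!: derivative_eq_intros)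

lemma cdiff_snd_nth [intro]: "cdiff (\<lambda>p. snd p $ i) p"
proof (rule cdiffI)
  show "((\<lambda>p. snd p $ i) has_derivative (\<lambda>p. snd p $ i)) (at p)"
    by (rule bounded_linear_imp_has_derivative)
      (rule bounded_linear_compose[OF bounded_linear_vec_nth bounded_linear_snd])
qed (simp add: cscale_def)

lemma cdiff_add:
  assumes "cdiff g p" "cdiff h p"
  shows "cdiff (\<lambda>p. g p + h p) p" "cD (\<lambda>p. g p + h p) p = (\<lambda>w. cD g p w + cD h p w)"
proof -
  have "((\<lambda>p. g p + h p) has_derivative (\<lambda>w. cD g p w + cD h p w)) (at p)"
    by (intro derivative_intros cdiff_has_derivative assms)
  then show "cdiff (\<lambda>p. g p + h p) p" "cD (\<lambda>p. g p + h p) p = (\<lambda>w. cD g p w + cD h p w)"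
    by (auto intro!: cdiffI simp: frechet_derivative_at[symmetric]
        cdiff_cD_cscale[OF assms(1)] cdiff_cD_cscale[OF assms(2)] distrib_left)
qed

lemma cdiff_mult:
  assumes "cdiff g p" "cdiff h p"
  shows "cdiff (\<lambda>p. g p * h p) p" "cD (\<lambda>p. g p * h p) p = (\<lambda>w. g p * cD h p w + cD g p w * h p)"
proof -
  have "((\<lambda>p. g p * h p) has_derivative (\<lambda>w. g p * cD h p w + cD g p w * h p)) (at p)"
    by (intro has_derivative_mult cdiff_has_derivative assms)
  then show "cdiff (\<lambda>p. g p * h p) p" "cD (\<lambda>p. g p * h p) p = (\<lambda>w. g p * cD h p w + cD g p w * h p)"
    by (auto intro!: cdiffI simp: frechet_derivative_at[symmetric]
        cdiff_cD_cscale[OF assms(1)] cdiff_cD_cscale[OF assms(2)] algebra_simps)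
qed

lemma cD_const: "cD (\<lambda>_. c) p = (\<lambda>_. 0)"
  by (rule frechet_derivative_at[symmetric]) (rule has_derivative_const)

lemma cdiff_cmult:
  assumes "cdiff g p"
  shows "cdiff (\<lambda>p. c * g p) p" "cD (\<lambda>p. c * g p) p = (\<lambda>w. c * cD g p w)"
  using cdiff_mult[OF cdiff_const[of c p] assms] by (auto simp: cD_const)

lemma cdiff_diff:
  assumes "cdiff g p" "cdiff h p"
  shows "cdiff (\<lambda>p. g p - h p) p" "cD (\<lambda>p. g p - h p) p = (\<lambda>w. cD g p w - cD h p w)"
  using cdiff_add[OF assms(1) cdiff_cmult(1)[OF assms(2), of "-1"]] cdiff_cmult(2)[OF assms(2), of "-1"]
  by auto

text \<open>The inner map is split into a step size \<open>a\<close> and a state \<open>V\<close>,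
  the shape in which one method follows another with its own multiple of the step size.\<close>

lemma cdiff_compose:
  assumes g: "cdiff g (a p, V p)" and a: "cdiff a p" and V: "\<And>i. cdiff (\<lambda>p. V p $ i) p"
  shows "cdiff (\<lambda>p. g (a p, V p)) p"
    "cD (\<lambda>p. g (a p, V p)) p = (\<lambda>w. cD g (a p, V p) (cD a p w, \<chi> i. cD (\<lambda>p. V p $ i) p w))"
proof -
  have "((\<lambda>p. (a p, V p)) has_derivative (\<lambda>w. (cD a p w, \<chi> i. cD (\<lambda>p. V p $ i) p w))) (at p)"
    by (intro has_derivative_Pair has_derivative_vec_nthI cdiff_has_derivative a V)
  from has_derivative_compose[OF this cdiff_has_derivative[OF g]]
  have "((\<lambda>p. g (a p, V p)) has_derivative
      (\<lambda>w. cD g (a p, V p) (cD a p w, \<chi> i. cD (\<lambda>p. V p $ i) p w))) (at p)" .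
  moreover have "(cD a p (cscale c w), \<chi> i. cD (\<lambda>p. V p $ i) p (cscale c w)) =
      cscale c (cD a p w, \<chi> i. cD (\<lambda>p. V p $ i) p w)" for c w
    by (simp add: cscale_def cdiff_cD_cscale[OF a, unfolded cscale_def]
        cdiff_cD_cscale[OF V, unfolded cscale_def] vec_eq_iff)
  ultimately show "cdiff (\<lambda>p. g (a p, V p)) p"
    "cD (\<lambda>p. g (a p, V p)) p = (\<lambda>w. cD g (a p, V p) (cD a p w, \<chi> i. cD (\<lambda>p. V p $ i) p w))"
    by (auto intro!: cdiffI simp: frechet_derivative_at[symmetric] cdiff_cD_cscale[OF g])
qed

lemma hol_at_const [intro]: "hol_at (\<lambda>_. c) p"
  unfolding hol_at_def by (intro always_eventually allI cdiff_const)

lemma hol_at_fst [intro]: "hol_at fst p" "hol_at (\<lambda>p. fst p) p"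
  unfolding hol_at_def by (intro always_eventually allI cdiff_fst)+

lemma hol_at_snd_nth [intro]: "hol_at (\<lambda>p. snd p $ i) p"
  unfolding hol_at_def by (intro always_eventually allI cdiff_snd_nth)

lemma hol_at_add [intro]: "hol_at g p \<Longrightarrow> hol_at h p \<Longrightarrow> hol_at (\<lambda>p. g p + h p) p"
  unfolding hol_at_def by (erule (1) eventually_elim2) (rule cdiff_add)

lemma hol_at_diff [intro]: "hol_at g p \<Longrightarrow> hol_at h p \<Longrightarrow> hol_at (\<lambda>p. g p - h p) p"
  unfolding hol_at_def by (erule (1) eventually_elim2) (rule cdiff_diff)

lemma hol_at_mult [intro]: "hol_at g p \<Longrightarrow> hol_at h p \<Longrightarrow> hol_at (\<lambda>p. g p * h p) p"
  unfolding hol_at_def by (erule (1) eventually_elim2) (rule cdiff_mult)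

lemma hol_at_power [intro]: "hol_at g p \<Longrightarrow> hol_at (\<lambda>p. g p ^ n) p"
  by (induction n) auto

lemma hol_at_sum [intro]: "(\<And>i. i \<in> I \<Longrightarrow> hol_at (g i) p) \<Longrightarrow> hol_at (\<lambda>p. \<Sum>i\<in>I. g i p) p"
  by (induction I rule: infinite_finite_induct) auto

lemma vec_tendsto_hol_at:
  assumes "\<And>i. hol_at (\<lambda>p. V p $ i) p"
  shows "(V \<longlongrightarrow> V p) (nhds p)"
  by (rule vec_tendstoI) (rule hol_at_tendsto[OF assms])

lemma hol_at_tendsto_Pair:
  assumes "hol_at a p" "\<And>i. hol_at (\<lambda>p. V p $ i) p"
  shows "((\<lambda>p. (a p, V p)) \<longlongrightarrow> (a p, V p)) (nhds p)"
  by (intro tendsto_Pair hol_at_tendsto[OF assms(1)] vec_tendsto_hol_at[OF assms(2)])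

lemma hol_at_compose:
  assumes "hol_at g (a p, V p)" "hol_at a p" "\<And>i. hol_at (\<lambda>p. V p $ i) p"
  shows "hol_at (\<lambda>p. g (a p, V p)) p"
proof -
  have "eventually (\<lambda>p. cdiff g (a p, V p)) (nhds p)"
    using eventually_compose_filterlim[OF assms(1)[unfolded hol_at_def] hol_at_tendsto_Pair[OF assms(2,3)]] .
  moreover have "eventually (\<lambda>p. \<forall>i. cdiff (\<lambda>p. V p $ i) p) (nhds p)"
    using assms(3) unfolding hol_at_def by (rule eventually_all_finite)
  ultimately show ?thesis
    using assms(2) unfolding hol_at_def
    by eventually_elim (rule cdiff_compose, auto)
qed

section \<open>Complex conjugation\<close>

definition cconj :: "complex^'d \<Rightarrow> complex^'d" where "cconj z = (\<chi> i. cnj (z $ i))"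

lemma cconj_simps [simp]: "cconj z $ i = cnj (z $ i)" "cconj (cconj z) = z" "cconj (cvec x) = cvec x"
  by (auto simp: cconj_def cvec_def vec_eq_iff)

lemma bounded_linear_cconj: "bounded_linear cconj"
  by (rule bounded_linear_intro[where K = 1])
    (auto simp: cconj_def vec_eq_iff norm_vec_def scaleR_conv_of_real[where 'a = complex])

text \<open>Schwarz reflection: the derivative is conjugated on both sides, and a linear map between
  two antilinear ones gives a linear map.\<close>

lemma cdiff_cnj:
  assumes g: "cdiff g (cnj (fst p), cconj (snd p))"
  shows "cdiff (\<lambda>p. cnj (g (cnj (fst p), cconj (snd p)))) p"
proof -
  let ?c = "\<lambda>p. (cnj (fst p), cconj (snd p)) :: complex \<times> (complex^'a)"
  have bl: "bounded_linear ?c"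
    by (intro bounded_linear_Pair bounded_linear_compose[OF bounded_linear_cnj bounded_linear_fst]
        bounded_linear_compose[OF bounded_linear_cconj bounded_linear_snd])
  have "((\<lambda>p. g (?c p)) has_derivative (\<lambda>w. cD g (?c p) (?c w))) (at p)"
    by (rule has_derivative_compose[OF bounded_linear_imp_has_derivative[OF bl] cdiff_has_derivative[OF g]])
  then have "((\<lambda>p. cnj (g (?c p))) has_derivative (\<lambda>w. cnj (cD g (?c p) (?c w)))) (at p)"
    by (rule bounded_linear.has_derivative[OF bounded_linear_cnj])
  moreover have "?c (cscale c w) = cscale (cnj c) (?c w)" for c w
    by (simp add: cscale_def vec_eq_iff)
  ultimately show ?thesis
    by (auto intro!: cdiffI simp: cdiff_cD_cscale[OF g])
qed

lemma hol_at_cnj: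
  assumes g: "hol_at g (cnj (fst p), cconj (snd p))"
  shows "hol_at (\<lambda>p. cnj (g (cnj (fst p), cconj (snd p)))) p"
proof -
  let ?c = "\<lambda>p. (cnj (fst p), cconj (snd p)) :: complex \<times> (complex^'a)"
  have bl: "bounded_linear ?c"
    by (intro bounded_linear_Pair bounded_linear_compose[OF bounded_linear_cnj bounded_linear_fst]
        bounded_linear_compose[OF bounded_linear_cconj bounded_linear_snd])
  have "(?c \<longlongrightarrow> ?c p) (nhds p)"
    by (rule bounded_linear.tendsto[OF bl filterlim_ident])
  then have "eventually (\<lambda>p. cdiff g (?c p)) (nhds p)"
    by (rule eventually_compose_filterlim[OF g[unfolded hol_at_def]])
  then show ?thesis
    unfolding hol_at_def by eventually_elim (rule cdiff_cnj)
qed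

section \<open>Real points among the complex ones\<close>

definition rpt :: "real \<times> (real^'d) \<Rightarrow> complex \<times> (complex^'d)"
  where "rpt q = (of_real (fst q), cvec (snd q))"

lemma cvec_nth [simp]: "cvec x $ i = of_real (x $ i)"
  by (simp add: cvec_def)

lemma vec_Re_nth [simp]: "vec_Re z $ i = Re (z $ i)"
  by (simp add: vec_Re_def)

lemma vec_Re_cvec [simp]: "vec_Re (cvec x) = x"
  by (simp add: vec_eq_iff)

lemma norm_cvec [simp]: "norm (cvec x) = norm x"
  by (simp add: norm_vec_def)

lemma norm_vec_Re_le: "norm (vec_Re z) \<le> norm z"
  unfolding norm_vec_def by (intro L2_set_mono) (auto simp: abs_Re_le_cmod)

lemma bounded_linear_cvec: "bounded_linear cvec"
  by (rule bounded_linear_intro[where K = 1])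
    (auto simp: vec_eq_iff scaleR_conv_of_real[where 'a = complex])

lemma bounded_linear_vec_Re: "bounded_linear vec_Re"
  by (rule bounded_linear_intro[where K = 1]) (auto simp: vec_eq_iff norm_vec_Re_le)

lemma cvec_diff: "cvec (x - y) = cvec x - cvec y" and cvec_add: "cvec (x + y) = cvec x + cvec y"
  by (simp_all add: vec_eq_iff)

lemma norm_rpt: "norm (rpt q) = norm q"
  by (cases q) (simp add: rpt_def norm_Pair)

lemma bounded_linear_rpt: "bounded_linear rpt"
  by (rule bounded_linear_intro[where K = 1])
    (auto simp: rpt_def vec_eq_iff norm_rpt[unfolded rpt_def] scaleR_conv_of_real[where 'a = complex])

lemma dist_rpt: "dist (rpt p) (rpt q) = dist p q"
  by (simp add: dist_norm norm_rpt flip: linear_diff[OF bounded_linear.linear[OF bounded_linear_rpt]])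

lemma tendsto_rpt: "(rpt \<longlongrightarrow> rpt q) (nhds q)"
  by (rule bounded_linear.tendsto[OF bounded_linear_rpt filterlim_ident])

text \<open>\<open>bigO_step\<close> looks only at nonzero step sizes; through this inclusion,
  statements proved on full neighbourhoods of \<open>(0, x0)\<close> are fed into it.\<close>

lemma at_le_nhds: "at (0::real) \<times>\<^sub>F nhds x0 \<le> nhds (0, x0)"
  unfolding nhds_prod by (intro prod_filter_mono order_refl) (simp add: at_within_def)

lemma rpt_0: "rpt (0, x) = (0, cvec x)"
  by (simp add: rpt_def)

lemma rpt_Pair: "rpt (h, x) = (of_real h, cvec x)"
  by (simp add: rpt_def)

section \<open>Orders at real and at complex points\<close>

text \<open>A point \<open>p\<close> near a real point is \<open>a + \<i> b\<close> with \<open>a\<close>, \<open>b\<close> real, and the one-variable identity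
  theorem applies to \<open>\<zeta> \<mapsto> g (a + \<zeta> b)\<close>, which vanishes for small real \<open>\<zeta>\<close>.\<close>

lemma identity_real_points:
  fixes g :: "complex \<times> (complex^'d) \<Rightarrow> complex"
  assumes "hol_at g (rpt q0)" "eventually (\<lambda>q. g (rpt q) = 0) (nhds q0)"
  shows "eventually (\<lambda>p. g p = 0) (nhds (rpt q0))"
proof -
  obtain r1 where r1: "r1 > 0" "\<And>p. dist p (rpt q0) < r1 \<Longrightarrow> cdiff g p"
    using assms(1) unfolding hol_at_def eventually_nhds_metric by blast
  obtain r2 where r2: "r2 > 0" "\<And>q. dist q q0 < r2 \<Longrightarrow> g (rpt q) = 0"
    using assms(2) unfolding eventually_nhds_metric by blast
  define r where "r = min r1 r2"
  have r: "r > 0" "r \<le> r1" "r \<le> r2" using r1 r2 by (auto simp: r_def)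
  have "g p = 0" if p: "dist p (rpt q0) < r" for p
  proof -
    define a where "a = (Re (fst p), vec_Re (snd p))"
    define b where "b = (Im (fst p), \<chi> i. Im (snd p $ i)) "
    have pab: "p = rpt a + cscale \<i> (rpt b)"
      by (cases p) (auto simp: a_def b_def rpt_def cscale_def vec_eq_iff complex_eq_iff)
    \<comment> \<open>Taking real parts does not increase the distance to the real point
      \<open>q0\<close>, so the line starts inside the ball.\<close>
    have "norm (a - q0) \<le> norm (p - rpt q0)"
    proof -
      have "a - q0 = (Re (fst (p - rpt q0)), vec_Re (snd (p - rpt q0)))"
        by (cases q0) (auto simp: a_def rpt_def vec_eq_iff)
      moreover have "norm (Re u, vec_Re z) \<le> norm (u, z)" for u and z :: "complex^'d"
        unfolding norm_Pair using abs_Re_le_cmod[of u] norm_vec_Re_le[of z]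
        by (intro real_sqrt_le_mono add_mono power_mono) auto
      ultimately show ?thesis by (metis prod.collapse)
    qed
    then have a: "dist a q0 < r" using p by (simp add: dist_norm)
    \<comment> \<open>The parameters whose points on the line stay in the ball. As preimage of a
      ball under a linear map this set is convex, hence connected; it contains \<open>0\<close> and
      \<open>\<i>\<close>, and the parameter \<open>\<i>\<close> belongs to
      \<open>p\<close>.\<close>
    define A where "A = (\<lambda>\<zeta>. cscale \<zeta> (rpt b)) -` ball (rpt q0 - rpt a) r"
    have A: "\<zeta> \<in> A \<longleftrightarrow> dist (rpt a + cscale \<zeta> (rpt b)) (rpt q0) < r" for \<zeta>
    proof -
      have "norm (rpt q0 - rpt a - cscale \<zeta> (rpt b)) = norm (rpt a + cscale \<zeta> (rpt b) - rpt q0)"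
        by (metis norm_minus_commute diff_diff_add)
      then show ?thesis by (simp add: A_def dist_norm)
    qed
    have "open A"
      unfolding A_def
      by (intro open_vimage open_ball linear_continuous_on bounded_linear_cscale_left)
    have "convex A"
      unfolding A_def
      by (intro convex_linear_vimage convex_ball bounded_linear.linear bounded_linear_cscale_left)
    have "0 \<in> A" using a by (simp add: A dist_rpt)
    have "\<i> \<in> A" using p pab by (simp add: A)
    have real0: "g (rpt a + cscale (of_real t) (rpt b)) = 0" if "of_real t \<in> A" for t
    proof -
      have e: "rpt a + cscale (of_real t) (rpt b) = rpt (a + t *\<^sub>R b)"
        using linear_add[OF bounded_linear.linear[OF bounded_linear_rpt], of a "t *\<^sub>R b"]
          linear_scale[OF bounded_linear.linear[OF bounded_linear_rpt], of t b]
        by (simp add: cscale_of_real)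
      with that have "dist (a + t *\<^sub>R b) q0 < r" by (simp add: A dist_rpt)
      then show ?thesis using r2(2) r(3) e by simp
    qed
    have "g (rpt a + cscale \<i> (rpt b)) = 0"
    proof (rule analytic_continuation[where f = "\<lambda>\<zeta>. g (rpt a + cscale \<zeta> (rpt b))" and S = A
          and U = "A \<inter> range of_real" and \<xi> = 0 and w = \<i>])
      show "(\<lambda>\<zeta>. g (rpt a + cscale \<zeta> (rpt b))) holomorphic_on A"
        by (rule cdiff_line_holomorphic, rule r1(2)) (use A r in auto)
      show "0 islimpt A \<inter> range complex_of_real"
        unfolding islimpt_approachable
      proof (intro allI impI)
        fix e :: real assume "e > 0"
        obtain d where d: "d > 0" "ball 0 d \<subseteq> A"
          using \<open>open A\<close> \<open>0 \<in> A\<close> open_contains_ball by blast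
        let ?t = "complex_of_real (min e d / 2)"
        have "cmod ?t = min e d / 2" unfolding norm_of_real using \<open>e > 0\<close> d by simp
        then have "?t \<in> A" "?t \<noteq> 0" "dist ?t 0 < e"
          using d \<open>e > 0\<close> by (auto simp: dist_norm subset_iff)
        then show "\<exists>x'\<in>A \<inter> range complex_of_real. x' \<noteq> 0 \<and> dist x' 0 < e" by blast
      qed
    qed (use \<open>open A\<close> \<open>convex A\<close> \<open>0 \<in> A\<close> \<open>\<i> \<in> A\<close> real0 convex_connected in auto)
    then show ?thesis using pab by simp
  qed
  then show ?thesis
    unfolding eventually_nhds_metric using r(1) by blast
qed

lemma identity_real_points_eq:
  fixes g :: "complex \<times> (complex^'d) \<Rightarrow> complex"
  assumes "hol_at g (rpt q0)" "hol_at h (rpt q0)" "eventually (\<lambda>q. g (rpt q) = h (rpt q)) (nhds q0)"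
  shows "eventually (\<lambda>p. g p = h p) (nhds (rpt q0))"
  using identity_real_points[OF hol_at_diff[OF assms(1,2)]] assms(3) by simp

text \<open>The constant term is the limit at \<open>0\<close>, hence zero; dividing by
  \<open>h\<close> then lowers the degree and the exponent \<open>k\<close> together.\<close>

lemma poly_small_zero:
  fixes a :: "nat \<Rightarrow> complex"
  assumes "eventually (\<lambda>h. cmod (\<Sum>i<k. a i * of_real h ^ i) \<le> C * \<bar>h\<bar> ^ k) (at (0::real))"
    and "i < k"
  shows "a i = 0"
  using assms
proof (induction k arbitrary: a i)
  case (Suc k)
  have ev0: "eventually (\<lambda>h::real. h \<noteq> 0) (at 0)"
    by (auto simp: eventually_at_filter)
  have l1: "((\<lambda>h::real. \<Sum>i<Suc k. a i * of_real h ^ i) \<longlongrightarrow> 0) (at 0)"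
  proof (rule Lim_null_comparison[OF Suc.prems(1)])
    have "((\<lambda>h. C * \<bar>h\<bar> ^ Suc k) \<longlongrightarrow> C * \<bar>0::real\<bar> ^ Suc k) (at 0)"
      by (intro tendsto_intros)
    then show "((\<lambda>h::real. C * \<bar>h\<bar> ^ Suc k) \<longlongrightarrow> 0) (at 0)" by simp
  qed
  have l2: "((\<lambda>h::real. \<Sum>i<Suc k. a i * of_real h ^ i) \<longlongrightarrow> (\<Sum>i<Suc k. a i * of_real 0 ^ i)) (at 0)"
    by (intro tendsto_intros)
  have "(\<Sum>i<Suc k. a i * of_real (0::real) ^ i) = 0"
    by (rule tendsto_unique[OF at_neq_bot l2 l1])
  then have a0: "a 0 = 0"
    by (simp add: sum.lessThan_Suc_shift)
  have "eventually (\<lambda>h. cmod (\<Sum>i<k. a (Suc i) * of_real h ^ i) \<le> C * \<bar>h\<bar> ^ k) (at (0::real))"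
    using Suc.prems(1) ev0
  proof eventually_elim
    case (elim h)
    have "(\<Sum>i<Suc k. a i * of_real h ^ i) = of_real h * (\<Sum>i<k. a (Suc i) * of_real h ^ i)"
      by (simp add: sum.lessThan_Suc_shift a0 sum_distrib_left mult.left_commute del: sum.lessThan_Suc)
    with elim have "\<bar>h\<bar> * cmod (\<Sum>i<k. a (Suc i) * of_real h ^ i) \<le> \<bar>h\<bar> * (C * \<bar>h\<bar> ^ k)"
      by (simp add: norm_mult mult.left_commute)
    then show ?case using elim(2) by simp
  qed
  then have "a (Suc i) = 0" if "i < k" for i
    using Suc.IH[of "\<lambda>i. a (Suc i)"] that by blast
  then show ?case using a0 Suc.prems(2) by (cases i) auto
qed simp

text \<open>The Taylor coefficients of \<open>h \<mapsto> E (h, z)\<close> at \<open>0\<close> are \<open>dstep i E (0, z) / i!\<close>.\<close>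

definition dstep :: "nat \<Rightarrow> (complex \<times> (complex^'d) \<Rightarrow> complex) \<Rightarrow> complex \<times> (complex^'d) \<Rightarrow> complex"
  where "dstep i = ((\<lambda>g p. cD g p (1, 0)) ^^ i)"

lemma dstep_0 [simp]: "dstep 0 E = E"
  and dstep_Suc: "dstep (Suc i) E = (\<lambda>p. cD (dstep i E) p (1, 0))"
  by (simp_all add: dstep_def)

lemma hol_at_dstep: "hol_at E p \<Longrightarrow> hol_at (dstep i E) p"
  by (induction i) (auto simp: dstep_Suc intro: hol_at_cD)

text \<open>The one-variable Taylor theorem in the step size, for each fixed state; a common bound
  on \<open>dstep N E\<close> near \<open>(0, z0)\<close> makes \<open>B\<close> independent of the
  state.\<close>

lemma Taylor_step:
  fixes E :: "complex \<times> (complex^'d) \<Rightarrow> complex"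
  assumes E: "hol_at E (0, z0)"
  shows "\<exists>B\<ge>0. eventually (\<lambda>p. cmod (E p - (\<Sum>i<N. dstep i E (0, snd p) / fact i * fst p ^ i))
    \<le> B * cmod (fst p) ^ N) (nhds (0, z0))"
\<comment> \<open>The remainder estimate is used with degree \<open>N - 1\<close>, so the empty sum
  is treated apart, as mere local boundedness.\<close>
proof (cases N)
  case 0
  obtain r B where "0 < r" "0 \<le> B" "\<And>q. q \<in> cball (0, z0) r \<Longrightarrow> cdiff E q"
    "\<And>q. q \<in> cball (0, z0) r \<Longrightarrow> cmod (E q) \<le> B"
    using hol_at_bounded[OF E] by blast
  then have "eventually (\<lambda>p. cmod (E p) \<le> B) (nhds (0, z0))"
    unfolding eventually_nhds_metric by (intro exI[of _ r]) (auto simp: dist_commute)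
  then show ?thesis using 0 \<open>0 \<le> B\<close> by auto
next
  case (Suc n)
  obtain r B where B: "0 < r" "0 \<le> B" "\<And>q. q \<in> cball (0, z0) r \<Longrightarrow> cdiff (dstep N E) q"
    "\<And>q. q \<in> cball (0, z0) r \<Longrightarrow> cmod (dstep N E q) \<le> B"
    using hol_at_bounded[OF hol_at_dstep[OF E, of N]] by blast
  have "eventually (\<lambda>p. \<forall>i\<in>{..n}. cdiff (dstep i E) p) (nhds (0, z0))"
    by (rule eventually_ball_finite) (use hol_at_dstep[OF E] in \<open>auto simp: hol_at_def\<close>)
  then obtain r' where r': "r' > 0" "\<And>p i. dist p (0, z0) < r' \<Longrightarrow> i \<le> n \<Longrightarrow> cdiff (dstep i E) p"
    unfolding eventually_nhds_metric by blast
  define \<delta> where "\<delta> = min r r' / 2"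
  have \<delta>: "\<delta> > 0" using B r' by (simp add: \<delta>_def)
  have box: "dist (t, z) (0, z0) < min r r'" if "cmod t < \<delta>" "dist z z0 < \<delta>" for t z
  proof -
    have "dist (t, z) (0, z0) \<le> cmod t + dist z z0"
      using norm_Pair_le[of t "z - z0"] by (simp add: dist_norm)
    also have "\<dots> < min r r'" using that by (simp add: \<delta>_def)
    finally show ?thesis .
  qed
  have main: "cmod (E p - (\<Sum>i<N. dstep i E (0, snd p) / fact i * fst p ^ i)) \<le> B * cmod (fst p) ^ N"
    if p: "dist p (0, z0) < \<delta>" for p
  proof -
    obtain t z where tz: "p = (t, z)" by (cases p)
    have t: "cmod t < \<delta>" "dist z z0 < \<delta>"
      using p dist_fst_le[of p "(0, z0)"] dist_snd_le[of p "(0, z0)"] by (auto simp: tz)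
    have "cmod (dstep 0 E (t, z) - (\<Sum>i\<le>n. dstep i E (0, z) * (t - 0) ^ i / fact i))
        \<le> B * cmod (t - 0) ^ Suc n / fact n"
    proof (rule complex_Taylor[where S = "ball 0 \<delta>" and f = "\<lambda>i t. dstep i E (t, z)"])
      fix i and x :: complex assume x: "x \<in> ball 0 \<delta>" "i \<le> n"
      have e: "(x, z) = (0, z) + cscale x (1, 0)" for x :: complex
        by (simp add: cscale_def)
      have "cdiff (dstep i E) (x, z)" using r'(2) box[of x z] x t by auto
      then have "cdiff (dstep i E) ((0, z) + cscale x (1, 0))" by (simp only: e[symmetric])
      then have "((\<lambda>x. dstep i E (x, z)) has_field_derivative dstep (Suc i) E (x, z)) (at x)"
        using cdiff_line[of "dstep i E" "(0, z)" x "(1, 0)"] by (simp only: e[symmetric] dstep_Suc)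
      then show "((\<lambda>x. dstep i E (x, z)) has_field_derivative dstep (Suc i) E (x, z)) (at x within ball 0 \<delta>)"
        by (rule has_field_derivative_at_within)
    next
      fix x :: complex assume "x \<in> ball 0 \<delta>"
      then have "(x, z) \<in> cball (0, z0) r" using box[of x z] t by (auto simp: dist_commute)
      then show "cmod (dstep (Suc n) E (x, z)) \<le> B" using B(4) Suc by simp
    qed (use t \<delta> in auto)
    also have "\<dots> \<le> B * cmod (t - 0) ^ Suc n / 1"
      by (rule divide_left_mono) (use B(2) in auto)
    finally show ?thesis by (simp add: tz Suc lessThan_Suc_atMost mult.commute del: power_Suc)
  qed
  then show ?thesis
    using \<delta> B(2) unfolding eventually_nhds_metric by blast
qed

text \<open>By the identity theorem the low Taylor coefficients, which vanish at real points, vanish at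
  complex points as well.\<close>

lemma order_complex_points:
  fixes E :: "complex \<times> (complex^'d) \<Rightarrow> complex"
  assumes E: "hol_at E (rpt (0, x0))"
    and small: "eventually (\<lambda>q. cmod (E (rpt q)) \<le> C * \<bar>fst q\<bar> ^ k) (at 0 \<times>\<^sub>F nhds x0)"
  obtains c B where "0 \<le> B"
    "eventually (\<lambda>p. cmod (E p) \<le> B * cmod (fst p) ^ k) (nhds (rpt (0, x0)))"
    "eventually (\<lambda>p. cmod (E p - c (snd p) * fst p ^ k) \<le> B * cmod (fst p) ^ (k + 1)) (nhds (rpt (0, x0)))"
proof -
  note E' = E[unfolded rpt_0]
  obtain B where B: "B \<ge> 0" "eventually (\<lambda>p. cmod (E p - (\<Sum>i<k. dstep i E (0, snd p) / fact i * fst p ^ i))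
    \<le> B * cmod (fst p) ^ k) (nhds (rpt (0, x0)))"
    using Taylor_step[OF E', of k] unfolding rpt_0 by blast
  \<comment> \<open>One more Taylor term isolates the coefficient of \<open>h^k\<close>, which
    becomes the leading coefficient \<open>c\<close>.\<close>
  obtain B' where B': "B' \<ge> 0" "eventually (\<lambda>p. cmod (E p - (\<Sum>i<Suc k. dstep i E (0, snd p) / fact i * fst p ^ i))
    \<le> B' * cmod (fst p) ^ Suc k) (nhds (rpt (0, x0)))"
    using Taylor_step[OF E', of "Suc k"] unfolding rpt_0 by blast
  have "eventually (\<lambda>q. cmod (E (rpt q) - (\<Sum>i<k. dstep i E (0, snd (rpt q)) / fact i * fst (rpt q) ^ i))
    \<le> B * cmod (fst (rpt q)) ^ k) (at 0 \<times>\<^sub>F nhds x0)"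
    by (rule filter_leD[OF at_le_nhds], rule eventually_compose_filterlim[OF B(2) tendsto_rpt])
  with small have "eventually (\<lambda>q. cmod (\<Sum>i<k. dstep i E (0, cvec (snd q)) / fact i * of_real (fst q) ^ i)
    \<le> (B + C) * \<bar>fst q\<bar> ^ k) (at 0 \<times>\<^sub>F nhds x0)"
  proof eventually_elim
    case (elim q)
    let ?S = "\<Sum>i<k. dstep i E (0, cvec (snd q)) / fact i * of_real (fst q) ^ i"
    have "cmod ?S \<le> cmod (E (rpt q) - ?S) + cmod (E (rpt q))"
      using norm_triangle_ineq4[of "E (rpt q)" "E (rpt q) - ?S"] by simp
    then show ?case using elim by (simp add: rpt_def distrib_right)
  qed
  \<comment> \<open>Freezing the initial value leaves a polynomial in \<open>h\<close> alone, of
    degree below \<open>k\<close> and of size \<open>O(h^k)\<close>.\<close>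
  then have "eventually (\<lambda>x. eventually (\<lambda>h. cmod (\<Sum>i<k. dstep i E (0, cvec x) / fact i * of_real h ^ i)
    \<le> (B + C) * \<bar>h\<bar> ^ k) (at 0)) (nhds x0)"
    using eventually_eventually_prod_filter2 by fastforce
  then have zero: "eventually (\<lambda>x. \<forall>i<k. dstep i E (0, cvec x) = 0) (nhds x0)"
  proof eventually_elim
    case (elim x)
    show ?case using poly_small_zero[OF elim] by auto
  qed
  have "eventually (\<lambda>p. \<forall>i\<in>{..<k}. dstep i E (0, snd p) = 0) (nhds (rpt (0, x0)))"
  proof (rule eventually_ball_finite, safe)
    fix i assume i: "i < k"
    show "eventually (\<lambda>p. dstep i E (0, snd p) = 0) (nhds (rpt (0, x0)))"
    proof (rule identity_real_points)
      show "hol_at (\<lambda>p. dstep i E (0, snd p)) (rpt (0, x0))"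
        by (rule hol_at_compose[where V = snd and a = "\<lambda>_. 0"])
          (use hol_at_dstep[OF E'] in \<open>auto simp: rpt_def\<close>)
      have "filterlim snd (nhds x0) (nhds (0::real, x0))"
        using tendsto_snd[OF filterlim_ident, of "(0, x0)"] by simp
      from eventually_compose_filterlim[OF zero this]
      show "eventually (\<lambda>q. dstep i E (0, snd (rpt q)) = 0) (nhds (0, x0))"
        by eventually_elim (use i in \<open>auto simp: rpt_def\<close>)
    qed
  qed
  note zero' = this
  show ?thesis
  proof (rule that[of "B + B'" "\<lambda>z. dstep k E (0, z) / fact k"])
    show "eventually (\<lambda>p. cmod (E p) \<le> (B + B') * cmod (fst p) ^ k) (nhds (rpt (0, x0)))"
      using zero' B(2)
    proof eventually_elim
      case (elim p)
      have "(\<Sum>i<k. dstep i E (0, snd p) / fact i * fst p ^ i) = 0"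
        using elim(1) by (intro sum.neutral) auto
      with elim(2) have "cmod (E p) \<le> B * cmod (fst p) ^ k" by simp
      also have "\<dots> \<le> (B + B') * cmod (fst p) ^ k"
        using B'(1) by (intro mult_right_mono) auto
      finally show ?case .
    qed
    show "eventually (\<lambda>p. cmod (E p - dstep k E (0, snd p) / fact k * fst p ^ k)
      \<le> (B + B') * cmod (fst p) ^ (k + 1)) (nhds (rpt (0, x0)))"
      using zero' B'(2)
    proof eventually_elim
      case (elim p)
      have "(\<Sum>i<k. dstep i E (0, snd p) / fact i * fst p ^ i) = 0"
        using elim(1) by (intro sum.neutral) auto
      with elim(2) have "cmod (E p - dstep k E (0, snd p) / fact k * fst p ^ k) \<le> B' * cmod (fst p) ^ (k + 1)"
        by simp
      also have "\<dots> \<le> (B + B') * cmod (fst p) ^ (k + 1)"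
        using B(1) by (intro mult_right_mono) auto
      finally show ?case .
    qed
  qed (use B B' in auto)
qed

text \<open>Cauchy's estimate along \<open>(0, v)\<close>: the step size does not change on the
  disc, so \<open>cmod (fst p) ^ k\<close> is a constant there and passes to the derivative.\<close>

lemma order_cD:
  fixes E :: "complex \<times> (complex^'d) \<Rightarrow> complex"
  assumes E: "hol_at E p0" and B: "0 \<le> B"
    and small: "eventually (\<lambda>p. cmod (E p) \<le> B * cmod (fst p) ^ k) (nhds p0)"
  obtains \<rho> C where "0 < \<rho>" "0 \<le> C"
    "\<And>p v. dist p p0 < \<rho> \<Longrightarrow> cdiff E p"
    "\<And>p v. dist p p0 < \<rho> \<Longrightarrow> cmod (cD E p (0, v)) \<le> C * cmod (fst p) ^ k * norm v"
proof -
  obtain r where r: "r > 0" "\<And>p. dist p p0 < r \<Longrightarrow> cdiff E p \<and> cmod (E p) \<le> B * cmod (fst p) ^ k"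
    using eventually_conj[OF E[unfolded hol_at_def] small] unfolding eventually_nhds_metric by blast
  show ?thesis
  proof (rule that[of "r/2" "B / (r/2)"])
    fix p and v :: "complex^'d" assume p: "dist p p0 < r/2"
    then show "cdiff E p" using r by simp
    show "cmod (cD E p (0, v)) \<le> B / (r/2) * cmod (fst p) ^ k * norm v"
    proof (cases "v = 0")
      case True
      have "(0, v) = (0 :: complex \<times> (complex^'d))" using True by (simp add: zero_prod_def)
      then show ?thesis
        using linear_0[OF linear_cD[OF \<open>cdiff E p\<close>]] B r(1) by simp
    next
      case False
      have near: "dist (p + cscale t (0, v)) p0 < r" if "cmod t \<le> (r/2) / norm v" for t
      proof -
        have "dist (p + cscale t (0, v)) p0 \<le> norm (cscale t (0, v)) + dist p p0"
          using dist_triangle[of "p + cscale t (0, v)" p0 p] by (simp add: dist_norm)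
        also have "norm (cscale t (0, v)) \<le> r/2"
          using that False by (simp add: norm_cscale norm_Pair field_simps)
        finally show ?thesis using p by simp
      qed
      have "cmod (cD E p (0, v)) \<le> (B * cmod (fst p) ^ k) / ((r/2) / norm v)"
      proof (rule cdiff_Cauchy)
        show "0 < r / 2 / norm v" using False r by simp
        fix t assume "cmod t \<le> r / 2 / norm v"
        from r(2)[OF near[OF this]]
        show "cdiff E (p + cscale t (0, v))"
          "cmod (E (p + cscale t (0, v))) \<le> B * cmod (fst p) ^ k"
          by (auto simp: cscale_def)
      qed
      then show ?thesis by (simp add: ac_simps)
    qed
  qed (use r B in auto)
qed

text \<open>Mean value inequality on the slice of fixed step size \<open>t\<close>, which is convex,
  with the derivative bound of \<open>order_cD\<close>.\<close>

lemma order_Lipschitz: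
  fixes E :: "complex \<times> (complex^'d) \<Rightarrow> complex"
  assumes E: "hol_at E p0" and B: "0 \<le> B"
    and small: "eventually (\<lambda>p. cmod (E p) \<le> B * cmod (fst p) ^ k) (nhds p0)"
  obtains \<rho> C where "0 < \<rho>" "0 \<le> C"
    "\<And>t z z'. dist (t, z) p0 < \<rho> \<Longrightarrow> dist (t, z') p0 < \<rho> \<Longrightarrow>
      cmod (E (t, z) - E (t, z')) \<le> C * cmod t ^ k * norm (z - z')"
proof -
  obtain \<rho> C where \<rho>: "0 < \<rho>" "0 \<le> C"
    "\<And>p v. dist p p0 < \<rho> \<Longrightarrow> cdiff E p"
    "\<And>p v. dist p p0 < \<rho> \<Longrightarrow> cmod (cD E p (0, v)) \<le> C * cmod (fst p) ^ k * norm v"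
    using order_cD[OF assms] by metis
  show ?thesis
  proof (rule that[OF \<rho>(1,2)])
    fix t z z' assume z: "dist (t, z) p0 < \<rho>" "dist (t, z') p0 < \<rho>"
    define A where "A = {z. dist (t, z) p0 < \<rho>}"
    show "cmod (E (t, z) - E (t, z')) \<le> C * cmod t ^ k * norm (z - z')"
    proof (rule differentiable_bound[where S = A and f = "\<lambda>z. E (t, z)" and f' = "\<lambda>z v. cD E (t, z) (0, v)"])
      have "A = (\<lambda>z. (0, z)) -` ball (p0 - (t, 0)) \<rho>"
        by (cases p0) (auto simp: A_def dist_Pair_Pair dist_norm norm_minus_commute norm_Pair algebra_simps)
      then show "convex A"
        by (auto intro!: convex_linear_vimage convex_ball bounded_linear.linear bounded_linear_Pair
            bounded_linear_zero bounded_linear_ident)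
      fix z assume "z \<in> A"
      then have zA: "dist (t, z) p0 < \<rho>" by (simp add: A_def)
      have 1: "((\<lambda>z. (t, z)) has_derivative (\<lambda>v. (0, v))) (at z)"
        by (auto intro!: derivative_eq_intros)
      have "((\<lambda>z. E (t, z)) has_derivative (\<lambda>v. cD E (t, z) (0, v))) (at z)"
        by (rule has_derivative_compose[OF 1 cdiff_has_derivative[OF \<rho>(3)[OF zA]]])
      then show "((\<lambda>z. E (t, z)) has_derivative (\<lambda>v. cD E (t, z) (0, v))) (at z within A)"
        by (rule has_derivative_at_withinI)
      show "onorm (\<lambda>v. cD E (t, z) (0, v)) \<le> C * cmod t ^ k"
        by (rule onorm_bound) (use \<rho>(2) \<rho>(4)[OF zA] in auto)
    qed (use z in \<open>auto simp: A_def\<close>)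
  qed
qed

lemma hol_at_minus [intro]: "hol_at g p \<Longrightarrow> hol_at (\<lambda>p. - g p) p"
  using hol_at_diff[OF hol_at_const[of 0]] by simp

lemma hol_at_cmult [intro]: "hol_at g p \<Longrightarrow> hol_at (\<lambda>p. c * g p) p"
  using hol_at_mult[OF hol_at_const] .

lemma tendsto_vec_Re: "(f \<longlongrightarrow> z) F \<Longrightarrow> ((\<lambda>x. vec_Re (f x)) \<longlongrightarrow> vec_Re z) F"
  by (rule bounded_linear.tendsto[OF bounded_linear_vec_Re])

section \<open>Complex step sizes\<close>

text \<open>Unlike \<open>composition\<close>, this allows complex \<open>h\<close>.\<close>

primrec compC :: "(complex \<Rightarrow> 'z \<Rightarrow> 'z) \<Rightarrow> (nat \<Rightarrow> complex) \<Rightarrow> nat \<Rightarrow> complex \<times> 'z \<Rightarrow> 'z" where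
  "compC Sc \<alpha> 0 p = snd p"
| "compC Sc \<alpha> (Suc k) p = Sc (\<alpha> (Suc k) * fst p) (compC Sc \<alpha> k p)"

lemma composition_eq_compC: "composition Sc \<alpha> k h z = compC Sc \<alpha> k (of_real h, z)"
  by (induction k) auto

text \<open>\<open>compC\<close> recurses on the factor applied last; cancelling a composition
  against its reverse requires the factor applied first.\<close>

lemma compC_Suc_inner: "compC Sc \<beta> (Suc k) p = compC Sc (\<lambda>j. \<beta> (Suc j)) k (fst p, Sc (\<beta> 1 * fst p) (snd p))"
  by (induction k) auto

text \<open>At step size zero, \<open>time_symmetric\<close> says no more than that
  \<open>S 0\<close> is an involution, hence the separate assumption \<open>S_0\<close>. For the
  given method it is supplied by \<open>basic_method_at_0\<close>.\<close>

locale analytic_reversible =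
  fixes S :: "real \<Rightarrow> real^'d \<Rightarrow> real^'d" and Sc :: "complex \<Rightarrow> complex^'d \<Rightarrow> complex^'d"
  assumes ext: "complex_extension S Sc"
    and sym: "time_symmetric S"
    and S_0: "\<And>x. S 0 x = x"
begin

lemma hol_at_Sc: "hol_at (\<lambda>p. Sc (fst p) (snd p) $ i) (rpt (0, x))"
proof -
  obtain W where W: "open W" "\<And>x. (0, cvec x) \<in> W" "holomorphic_map W (\<lambda>(h, z). Sc h z)"
    using ext unfolding complex_extension_def by blast
  have "cdiff (\<lambda>p. Sc (fst p) (snd p) $ i) p" if "p \<in> W" for p
  proof -
    obtain D where D: "((\<lambda>(h, z). Sc h z) has_derivative D) (at p)"
      "\<And>c a v. D (c * a, c *s v) = c *s D (a, v)"
      using W(3) \<open>p \<in> W\<close> unfolding holomorphic_map_def by blast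
    have "((\<lambda>p. (case p of (h, z) \<Rightarrow> Sc h z) $ i) has_derivative (\<lambda>w. D w $ i)) (at p)"
      by (rule bounded_linear.has_derivative[OF bounded_linear_vec_nth D(1)])
    then have "((\<lambda>p. Sc (fst p) (snd p) $ i) has_derivative (\<lambda>w. D w $ i)) (at p)"
      by (simp add: split_beta)
    then show ?thesis
      by (rule cdiffI) (simp add: cscale_def D(2))
  qed
  moreover have "eventually (\<lambda>p. p \<in> W) (nhds (rpt (0, x)))"
    using W by (intro eventually_nhds_in_open) (auto simp: rpt_0)
  ultimately show ?thesis
    unfolding hol_at_def by (auto elim: eventually_mono)
qed

lemma Sc_real: "eventually (\<lambda>q. Sc (of_real (fst q)) (cvec (snd q)) = cvec (S (fst q) (snd q))) (nhds (0, x))"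
proof -
  obtain W where W: "open W" "\<And>x. (0, cvec x) \<in> W"
    "\<And>h x. (complex_of_real h, cvec x) \<in> W \<Longrightarrow> Sc (complex_of_real h) (cvec x) = cvec (S h x)"
    using ext unfolding complex_extension_def by blast
  have "eventually (\<lambda>p. p \<in> W) (nhds (rpt (0, x)))"
    using W by (intro eventually_nhds_in_open) (auto simp: rpt_0)
  from eventually_compose_filterlim[OF this tendsto_rpt] show ?thesis
    by eventually_elim (simp add: rpt_def W(3))
qed

lemma Sc_0: "Sc 0 (cvec x) = cvec x"
  using eventually_nhds_x_imp_x[OF Sc_real[of x]] S_0 by simp

text \<open>Both claims share one induction: the next factor is known to be holomorphic only near
  points \<open>(0, cvec x)\<close>, so the partial composition has to stay at \<open>cvec x\<close>
  for step size zero.\<close>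

lemma compC_base:
  shows hol_at_compC: "\<And>i. hol_at (\<lambda>p. compC Sc \<alpha> k p $ i) (rpt (0, x))"
    and compC_rpt_0: "compC Sc \<alpha> k (rpt (0, x)) = cvec x"
proof (induction k)
  case (Suc k)
  { case 1
    have "hol_at (\<lambda>p. (\<lambda>p. Sc (fst p) (snd p) $ i) (\<alpha> (Suc k) * fst p, compC Sc \<alpha> k p)) (rpt (0, x))"
    proof (rule hol_at_compose)
      show "hol_at (\<lambda>p. Sc (fst p) (snd p) $ i) (\<alpha> (Suc k) * fst (rpt (0, x)), compC Sc \<alpha> k (rpt (0, x)))"
        using hol_at_Sc[of i x] Suc.IH(2) by (simp add: rpt_0)
    qed (use Suc.IH in auto)
    then show ?case by simp
  next
    case 2
    show ?case using Suc.IH(2) Sc_0 by (simp add: rpt_0)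
  }
qed (auto simp: rpt_0)

text \<open>Pulls statements about \<open>Sc\<close> near \<open>rpt (0, x)\<close> back to the
  arguments that a further factor with coefficient \<open>c\<close> receives.\<close>

lemma tendsto_compC: "((\<lambda>p. (c * fst p, compC Sc \<alpha> k p)) \<longlongrightarrow> rpt (0, x)) (nhds (rpt (0, x)))"
proof -
  have "((\<lambda>p. (c * fst p, compC Sc \<alpha> k p)) \<longlongrightarrow> (c * fst (rpt (0, x)), compC Sc \<alpha> k (rpt (0, x)))) (nhds (rpt (0, x)))"
    by (rule hol_at_tendsto_Pair) (auto intro: hol_at_compC)
  then show ?thesis by (simp add: compC_rpt_0) (simp add: rpt_0)
qed

lemma tendsto_compC_real: "((\<lambda>q. vec_Re (compC Sc \<alpha> k (rpt q))) \<longlongrightarrow> x) (nhds (0, x))"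
proof -
  have "((\<lambda>p. compC Sc \<alpha> k p) \<longlongrightarrow> cvec x) (nhds (rpt (0, x)))"
    using vec_tendsto_hol_at[OF hol_at_compC[of \<alpha> k _ x]] by (simp add: compC_rpt_0)
  from tendsto_vec_Re[OF filterlim_compose[OF this tendsto_rpt]] show ?thesis by simp
qed

lemma tendsto_minus_fst: "((\<lambda>q. (- fst q, snd q)) \<longlongrightarrow> (0::real, x)) (nhds (0, x))"
proof -
  have "((\<lambda>q. (- fst q, snd q)) \<longlongrightarrow> (- fst (0::real, x), snd (0::real, x))) (nhds (0, x))"
    by (intro tendsto_intros filterlim_ident)
  then show ?thesis by simp
qed

lemma tendsto_S: "((\<lambda>q. S (fst q) (snd q)) \<longlongrightarrow> x) (nhds (0, x))"
proof -
  have "((\<lambda>q. vec_Re (compC Sc (\<lambda>_. 1) 1 (rpt q))) \<longlongrightarrow> x) (nhds (0, x))"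
    by (rule tendsto_compC_real)
  moreover have "eventually (\<lambda>q. vec_Re (compC Sc (\<lambda>_. 1) 1 (rpt q)) = S (fst q) (snd q)) (nhds (0, x))"
    using Sc_real[of x] by eventually_elim (simp add: rpt_def)
  ultimately show ?thesis by (rule Lim_transform_eventually)
qed

lemma Sc_inverse: "eventually (\<lambda>p. Sc (fst p) (Sc (- fst p) (snd p)) = snd p) (nhds (rpt (0, x)))"
proof -
  have eq: "eventually (\<lambda>p. Sc (fst p) (Sc (- fst p) (snd p)) $ i = snd p $ i) (nhds (rpt (0, x)))" for i
  proof (rule identity_real_points_eq)
    let ?V = "\<lambda>p. Sc (- fst p) (snd p)"
    \<comment> \<open>A step with the opposite step size is the one-factor composition with
      coefficient \<open>-1\<close>.\<close>
    have V: "hol_at (\<lambda>p. ?V p $ i) (rpt (0, x))" for i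
      using hol_at_compC[of "\<lambda>_. -1" 1 i x] by simp
    have "hol_at (\<lambda>p. (\<lambda>p. Sc (fst p) (snd p) $ i) (fst p, ?V p)) (rpt (0, x))"
    proof (rule hol_at_compose)
      show "hol_at (\<lambda>p. Sc (fst p) (snd p) $ i) (fst (rpt (0, x)), ?V (rpt (0, x)))"
        using hol_at_Sc[of i x] by (simp add: rpt_0 Sc_0)
    qed (use V in auto)
    then show "hol_at (\<lambda>p. Sc (fst p) (Sc (- fst p) (snd p)) $ i) (rpt (0, x))" by simp
    have 1: "((\<lambda>q. (fst q, S (- fst q) (snd q))) \<longlongrightarrow> (0, x)) (nhds (0, x))"
      using tendsto_Pair[OF tendsto_fst[OF filterlim_ident[of "nhds (0, x)"]] filterlim_compose[OF tendsto_S[of x] tendsto_minus_fst[of x]]]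
      by simp
    have 2: "eventually (\<lambda>q. S (fst q) (S (- fst q) (snd q)) = snd q) (nhds (0, x))"
      using sym[unfolded time_symmetric_def, THEN spec, of x] by (simp add: nhds_prod case_prod_unfold)
    show "eventually (\<lambda>q. Sc (fst (rpt q)) (Sc (- fst (rpt q)) (snd (rpt q))) $ i = snd (rpt q) $ i) (nhds (0, x))"
      using eventually_compose_filterlim[OF Sc_real[of x] 1]
        eventually_compose_filterlim[OF Sc_real[of x] tendsto_minus_fst[of x]] 2
      by eventually_elim (simp add: rpt_def)
  qed (rule hol_at_snd_nth)
  have "eventually (\<lambda>p. \<forall>i. Sc (fst p) (Sc (- fst p) (snd p)) $ i = snd p $ i) (nhds (rpt (0, x)))"
    by (rule eventually_all_finite) (rule eq)
  then show ?thesis by eventually_elim (simp add: vec_eq_iff)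
qed

lemma Sc_cnj: "eventually (\<lambda>p. Sc (cnj (fst p)) (cconj (snd p)) = cconj (Sc (fst p) (snd p))) (nhds (rpt (0, x)))"
proof -
  have eq: "eventually (\<lambda>p. Sc (fst p) (snd p) $ i = cnj (Sc (cnj (fst p)) (cconj (snd p)) $ i)) (nhds (rpt (0, x)))" for i
  proof (rule identity_real_points_eq)
    show "hol_at (\<lambda>p. Sc (fst p) (snd p) $ i) (rpt (0, x))" by (rule hol_at_Sc)
    \<comment> \<open>The conjugated map is holomorphic by reflection, and at real points both sides
      are the real value of \<open>S\<close>.\<close>
    have "hol_at (\<lambda>p. cnj ((\<lambda>p. Sc (fst p) (snd p) $ i) (cnj (fst p), cconj (snd p)))) (rpt (0, x))"
      by (rule hol_at_cnj) (use hol_at_Sc[of i x] in \<open>simp add: rpt_0\<close>)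
    then show "hol_at (\<lambda>p. cnj (Sc (cnj (fst p)) (cconj (snd p)) $ i)) (rpt (0, x))" by simp
    show "eventually (\<lambda>q. Sc (fst (rpt q)) (snd (rpt q)) $ i = cnj (Sc (cnj (fst (rpt q))) (cconj (snd (rpt q))) $ i)) (nhds (0, x))"
      using Sc_real[of x] by eventually_elim (simp add: rpt_def)
  qed
  have "eventually (\<lambda>p. \<forall>i. Sc (fst p) (snd p) $ i = cnj (Sc (cnj (fst p)) (cconj (snd p)) $ i)) (nhds (rpt (0, x)))"
    by (rule eventually_all_finite) (rule eq)
  then show ?thesis by eventually_elim (simp add: vec_eq_iff)
qed

lemma compC_cnj:
  "eventually (\<lambda>p. compC Sc (\<lambda>j. cnj (\<alpha> j)) k (cnj (fst p), cconj (snd p)) = cconj (compC Sc \<alpha> k p)) (nhds (rpt (0, x)))"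
proof (induction k)
  case (Suc k)
  show ?case
    using Suc eventually_compose_filterlim[OF Sc_cnj[of x] tendsto_compC[of "\<alpha> (Suc k)" \<alpha> k x]]
    by eventually_elim simp
qed simp

text \<open>The factor of \<open>\<beta>\<close> applied first has the coefficient of the factor of
  \<open>\<alpha>\<close> applied last, with opposite step size, so the two cancel by
  \<open>Sc_inverse\<close>. What remains has the same form with \<open>\<beta>\<close> shifted by
  one, which is why \<open>\<beta>\<close> is generalised.\<close>

lemma compC_reverse:
  "(\<And>j. 1 \<le> j \<Longrightarrow> j \<le> k \<Longrightarrow> \<beta> j = \<alpha> (k + 1 - j)) \<Longrightarrow>
    eventually (\<lambda>p. compC Sc \<beta> k (fst p, compC Sc \<alpha> k (- fst p, snd p)) = snd p) (nhds (rpt (0, x)))"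
proof (induction k arbitrary: \<beta>)
  case (Suc k)
  have IH: "eventually (\<lambda>p. compC Sc (\<lambda>j. \<beta> (Suc j)) k (fst p, compC Sc \<alpha> k (- fst p, snd p)) = snd p) (nhds (rpt (0, x)))"
    by (rule Suc.IH) (use Suc.prems in \<open>auto simp: Suc_diff_le\<close>)
  have t: "((\<lambda>p. (- fst p, snd p)) \<longlongrightarrow> rpt (0, x)) (nhds (rpt (0, x)))"
    using hol_at_tendsto_Pair[of "\<lambda>p. - fst p" "rpt (0, x)" snd] by (auto simp: rpt_0)
  have b: "\<beta> 1 = \<alpha> (Suc k)" using Suc.prems[of 1] by simp
  have "((\<lambda>p. (- \<alpha> (Suc k) * fst p, compC Sc \<alpha> k p)) \<longlongrightarrow> rpt (0, x)) (nhds (rpt (0, x)))"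
    by (rule tendsto_compC)
  from filterlim_compose[OF this t]
  have "((\<lambda>p. (\<alpha> (Suc k) * fst p, compC Sc \<alpha> k (- fst p, snd p))) \<longlongrightarrow> rpt (0, x)) (nhds (rpt (0, x)))"
    by simp
  from eventually_compose_filterlim[OF Sc_inverse[of x] this] IH show ?case
  proof eventually_elim
    case (elim p)
    have "compC Sc \<alpha> (Suc k) (- fst p, snd p) = Sc (- (\<alpha> (Suc k) * fst p)) (compC Sc \<alpha> k (- fst p, snd p))"
      by simp
    then show ?case
      using elim by (simp only: compC_Suc_inner[of Sc \<beta> k] fst_conv snd_conv b)
  qed
qed simp

end

section \<open>Order estimates in the step size\<close>

lemma bigO_step_iff:
  "bigO_step x0 k E \<longleftrightarrow> (\<exists>C. eventually (\<lambda>q. norm (E (fst q) (snd q)) \<le> C * \<bar>fst q\<bar> ^ k) (at 0 \<times>\<^sub>F nhds x0))"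
  (is "?L \<longleftrightarrow> ?R")
proof
  assume ?L
  then obtain C where "eventually (\<lambda>q. norm (norm (E (fst q) (snd q))) \<le> C * norm (fst q ^ k)) (at 0 \<times>\<^sub>F nhds x0)"
    unfolding bigO_step_def case_prod_unfold by (elim landau_o.bigE)
  then show ?R by (auto simp: power_abs)
next
  assume ?R
  then obtain C where "eventually (\<lambda>q. norm (E (fst q) (snd q)) \<le> C * \<bar>fst q\<bar> ^ k) (at 0 \<times>\<^sub>F nhds x0)"
    by blast
  then have "eventually (\<lambda>q. norm (norm (E (fst q) (snd q))) \<le> C * norm (fst q ^ k)) (at 0 \<times>\<^sub>F nhds x0)"
    by (simp add: power_abs)
  then show ?L
    unfolding bigO_step_def case_prod_unfold by (rule bigoI)
qed

lemma bigO_step_at_point: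
  assumes "bigO_step x k E"
  obtains C where "eventually (\<lambda>h. norm (E h x) \<le> C * \<bar>h\<bar> ^ k) (at 0)"
proof -
  obtain C where "eventually (\<lambda>q. norm (E (fst q) (snd q)) \<le> C * \<bar>fst q\<bar> ^ k) (at 0 \<times>\<^sub>F nhds x)"
    using assms unfolding bigO_step_iff by blast
  then have "eventually (\<lambda>x. eventually (\<lambda>h. norm (E h x) \<le> C * \<bar>h\<bar> ^ k) (at 0)) (nhds x)"
    using eventually_eventually_prod_filter2 by fastforce
  from that[OF eventually_nhds_x_imp_x[OF this]] show thesis .
qed

lemma eventually_small_step: "0 < \<delta> \<Longrightarrow> eventually (\<lambda>q. \<bar>fst q\<bar> < \<delta> \<and> fst q \<noteq> 0) (at (0::real) \<times>\<^sub>F nhds x0)"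
  unfolding eventually_prod_filter eventually_at_filter eventually_nhds_metric
  by (intro exI[of _ "\<lambda>h. \<bar>h\<bar> < \<delta> \<and> h \<noteq> 0"] exI[of _ "\<lambda>_. True"] conjI exI[of _ \<delta>]) auto

lemma bigO_step_mono:
  assumes "bigO_step x0 k E" "l \<le> k"
  shows "bigO_step x0 l E"
proof -
  obtain C where C: "eventually (\<lambda>q. norm (E (fst q) (snd q)) \<le> C * \<bar>fst q\<bar> ^ k) (at 0 \<times>\<^sub>F nhds x0)"
    using assms(1) unfolding bigO_step_iff by blast
  have "eventually (\<lambda>q. norm (E (fst q) (snd q)) \<le> \<bar>C\<bar> * \<bar>fst q\<bar> ^ l) (at 0 \<times>\<^sub>F nhds x0)"
    using C eventually_small_step[OF zero_less_one, of x0]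
  proof eventually_elim
    case (elim q)
    have "C * \<bar>fst q\<bar> ^ k \<le> \<bar>C\<bar> * \<bar>fst q\<bar> ^ l"
      using elim assms(2) by (intro mult_mono power_decreasing) auto
    then show ?case using elim by linarith
  qed
  then show ?thesis unfolding bigO_step_iff by blast
qed

text \<open>Only norms are compared, so that identities valid merely near \<open>(0, x0)\<close>, or
  between real and complex quantities, can transfer an order.\<close>

lemma bigO_step_cong:
  assumes "bigO_step x0 k E" "eventually (\<lambda>q. norm (E' (fst q) (snd q)) \<le> norm (E (fst q) (snd q))) (at 0 \<times>\<^sub>F nhds x0)"
  shows "bigO_step x0 k E'"
proof -
  obtain C where C: "eventually (\<lambda>q. norm (E (fst q) (snd q)) \<le> C * \<bar>fst q\<bar> ^ k) (at 0 \<times>\<^sub>F nhds x0)"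
    using assms(1) unfolding bigO_step_iff by blast
  from C assms(2) have "eventually (\<lambda>q. norm (E' (fst q) (snd q)) \<le> C * \<bar>fst q\<bar> ^ k) (at 0 \<times>\<^sub>F nhds x0)"
    by eventually_elim linarith
  then show ?thesis unfolding bigO_step_iff by blast
qed

lemma bigO_step_add:
  assumes "bigO_step x0 k E" "bigO_step x0 k E'"
  shows "bigO_step x0 k (\<lambda>h x. E h x + E' h x)"
proof -
  obtain C where C: "eventually (\<lambda>q. norm (E (fst q) (snd q)) \<le> C * \<bar>fst q\<bar> ^ k) (at 0 \<times>\<^sub>F nhds x0)"
    using assms(1) unfolding bigO_step_iff by blast
  obtain C' where C': "eventually (\<lambda>q. norm (E' (fst q) (snd q)) \<le> C' * \<bar>fst q\<bar> ^ k) (at 0 \<times>\<^sub>F nhds x0)"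
    using assms(2) unfolding bigO_step_iff by blast
  from C C' have "eventually (\<lambda>q. norm (E (fst q) (snd q) + E' (fst q) (snd q)) \<le> (C + C') * \<bar>fst q\<bar> ^ k) (at 0 \<times>\<^sub>F nhds x0)"
  proof eventually_elim
    case (elim q)
    then show ?case
      using norm_triangle_ineq[of "E (fst q) (snd q)" "E' (fst q) (snd q)"] by (simp add: distrib_right)
  qed
  then show ?thesis unfolding bigO_step_iff by blast
qed

lemma bigO_step_cmult:
  fixes E :: "real \<Rightarrow> 'a::topological_space \<Rightarrow> 'b::real_normed_field"
  assumes "bigO_step x0 k E"
  shows "bigO_step x0 k (\<lambda>h x. c * E h x)"
proof -
  obtain C where C: "eventually (\<lambda>q. norm (E (fst q) (snd q)) \<le> C * \<bar>fst q\<bar> ^ k) (at 0 \<times>\<^sub>F nhds x0)"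
    using assms(1) unfolding bigO_step_iff by blast
  from C have "eventually (\<lambda>q. norm (c * E (fst q) (snd q)) \<le> (norm c * C) * \<bar>fst q\<bar> ^ k) (at 0 \<times>\<^sub>F nhds x0)"
    by eventually_elim (simp add: norm_mult mult.assoc mult_left_mono)
  then show ?thesis unfolding bigO_step_iff by blast
qed

lemma bigO_step_diff:
  fixes E :: "real \<Rightarrow> 'a::topological_space \<Rightarrow> 'b::real_normed_field"
  assumes "bigO_step x0 k E" "bigO_step x0 k E'"
  shows "bigO_step x0 k (\<lambda>h x. E h x - E' h x)"
  using bigO_step_add[OF assms(1) bigO_step_cmult[OF assms(2), of "-1"]] by simp

lemma bigO_step_minus_arg:
  assumes "bigO_step x0 k E"
  shows "bigO_step x0 k (\<lambda>h x. E (- h) x)"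
proof -
  obtain C where C: "eventually (\<lambda>q. norm (E (fst q) (snd q)) \<le> C * \<bar>fst q\<bar> ^ k) (at 0 \<times>\<^sub>F nhds x0)"
    using assms(1) unfolding bigO_step_iff by blast
  have "filterlim (\<lambda>q. (- fst q, snd q)) (at (0::real) \<times>\<^sub>F nhds x0) (at 0 \<times>\<^sub>F nhds x0)"
  proof (rule filterlim_Pair)
    have "filterlim (\<lambda>h::real. - h) (at 0) (at 0)"
      unfolding filterlim_at by (auto intro!: tendsto_eq_intros simp: eventually_at_filter)
    then show "filterlim (\<lambda>q. - fst q) (at (0::real)) (at 0 \<times>\<^sub>F nhds x0)"
      by (rule filterlim_compose[OF _ filterlim_fst])
  qed (rule filterlim_snd)
  from eventually_compose_filterlim[OF C this] show ?thesis
    unfolding bigO_step_iff by auto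
qed

lemma bigO_step_vecI:
  fixes E :: "real \<Rightarrow> 'a::topological_space \<Rightarrow> 'b::real_normed_vector^'d"
  assumes "\<And>i. bigO_step x0 k (\<lambda>h x. E h x $ i)"
  shows "bigO_step x0 k E"
proof -
  have "\<forall>i. \<exists>C. eventually (\<lambda>q. norm (E (fst q) (snd q) $ i) \<le> C * \<bar>fst q\<bar> ^ k) (at 0 \<times>\<^sub>F nhds x0)"
    using assms[unfolded bigO_step_iff] by (rule allI)
  from choice[OF this] obtain C
    where C: "\<forall>i. eventually (\<lambda>q. norm (E (fst q) (snd q) $ i) \<le> C i * \<bar>fst q\<bar> ^ k) (at 0 \<times>\<^sub>F nhds x0)"
    by (rule exE)
  have "eventually (\<lambda>q. \<forall>i. norm (E (fst q) (snd q) $ i) \<le> C i * \<bar>fst q\<bar> ^ k) (at 0 \<times>\<^sub>F nhds x0)"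
    by (rule eventually_all_finite) (rule C[THEN spec])
  then have "eventually (\<lambda>q. norm (E (fst q) (snd q)) \<le> (\<Sum>i\<in>UNIV. C i) * \<bar>fst q\<bar> ^ k) (at 0 \<times>\<^sub>F nhds x0)"
  proof eventually_elim
    case (elim q)
    have "norm (E (fst q) (snd q)) \<le> (\<Sum>i\<in>UNIV. norm (E (fst q) (snd q) $ i))"
      unfolding norm_vec_def by (rule L2_set_le_sum) simp
    also have "\<dots> \<le> (\<Sum>i\<in>UNIV. C i * \<bar>fst q\<bar> ^ k)"
      using elim by (intro sum_mono) auto
    finally show ?case by (simp add: sum_distrib_right)
  qed
  then show ?thesis unfolding bigO_step_iff by blast
qed

lemma bigO_step_nth:
  fixes E :: "real \<Rightarrow> 'a::topological_space \<Rightarrow> 'b::real_normed_vector^'d"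
  assumes "bigO_step x0 k E"
  shows "bigO_step x0 k (\<lambda>h x. E h x $ i)"
  by (rule bigO_step_cong[OF assms]) (intro always_eventually allI Finite_Cartesian_Product.norm_nth_le)

section \<open>The Lie series of the flow\<close>

text \<open>Estimates from \<open>has_order\<close> say nothing about step size zero; this adds the
  value there.\<close>

lemma eventually_nhds_0_step:
  assumes "eventually P (at (0::real) \<times>\<^sub>F nhds x0)" "eventually (\<lambda>x. P (0, x)) (nhds x0)"
  shows "eventually P (nhds (0, x0))"
proof -
  obtain Pf Pg where P: "eventually Pf (at 0)" "eventually Pg (nhds x0)" "\<And>h x. Pf h \<Longrightarrow> Pg x \<Longrightarrow> P (h, x)"
    using assms(1) unfolding eventually_prod_filter by blast
  have "eventually (\<lambda>h. h \<noteq> 0 \<longrightarrow> Pf h) (nhds 0)"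
    using P(1) by (simp add: eventually_at_filter)
  moreover have "eventually (\<lambda>x. Pg x \<and> P (0, x)) (nhds x0)"
    using P(2) assms(2) by (rule eventually_conj)
  ultimately show ?thesis
    unfolding nhds_prod eventually_prod_filter
    by (intro exI[of _ "\<lambda>h. h \<noteq> 0 \<longrightarrow> Pf h"] exI[of _ "\<lambda>x. Pg x \<and> P (0, x)"]) (use P(3) in force)
qed

lemma hol_at_0_snd:
  assumes "hol_at g (rpt (0, x))"
  shows "hol_at (\<lambda>p. g (0, snd p)) (rpt (0, x))"
  by (rule hol_at_compose[where V = snd and a = "\<lambda>_. 0"]) (use assms in \<open>auto simp: rpt_0\<close>)

locale analytic_integrator = analytic_reversible S Sc
  for S :: "real \<Rightarrow> real^'d \<Rightarrow> real^'d" and Sc :: "complex \<Rightarrow> complex^'d \<Rightarrow> complex^'d" +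
  fixes f :: "real^'d \<Rightarrow> real^'d" and \<phi> :: "real \<Rightarrow> real^'d \<Rightarrow> real^'d"
  assumes flow: "exact_flow f \<phi>" and order2: "has_order \<phi> 2 S"
begin

lemma \<phi>_0: "\<phi> 0 x = x"
  using flow unfolding exact_flow_def by blast

lemma flow_derivative:
  "eventually (\<lambda>q. ((\<lambda>s. \<phi> s (snd q)) has_vector_derivative f (\<phi> (fst q) (snd q))) (at (fst q))) (nhds (0, x))"
  using flow[unfolded exact_flow_def, THEN conjunct2, THEN spec, of x]
  by (simp add: nhds_prod case_prod_unfold)

text \<open>Holomorphic extension of the vector field: the derivative of \<open>S h x\<close> in
  \<open>h\<close> at zero is \<open>f x\<close>, and \<open>Sc\<close> has a holomorphic one. The
  step-size component of \<open>p\<close> is discarded.\<close>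

definition fc :: "'d \<Rightarrow> complex \<times> (complex^'d) \<Rightarrow> complex"
  where "fc i p = cD (\<lambda>p. Sc (fst p) (snd p) $ i) (0, snd p) (1, 0)"

lemma hol_at_fc: "hol_at (fc i) (rpt (0, x))"
  unfolding fc_def[abs_def] by (rule hol_at_0_snd) (rule hol_at_cD[OF hol_at_Sc])

text \<open>The error \<open>O(h^3)\<close> makes the difference quotients of \<open>S\<close> and
  \<open>\<phi>\<close> at zero differ by \<open>O(h^2)\<close>.\<close>

lemma S_derivative: "((\<lambda>h. S h x $ i) has_field_derivative f x $ i) (at 0)"
proof -
  have 1: "((\<lambda>h. \<phi> h x) has_vector_derivative f x) (at 0)"
    using eventually_nhds_x_imp_x[OF flow_derivative[of x]] by (simp add: \<phi>_0)
  have "((\<lambda>h. \<phi> h x $ i) has_field_derivative f x $ i) (at 0)"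
    using bounded_linear.has_vector_derivative[OF bounded_linear_vec_nth 1, of i]
    by (simp add: has_real_derivative_iff_has_vector_derivative)
  then have 2: "((\<lambda>h. (\<phi> h x $ i - x $ i) / h) \<longlongrightarrow> f x $ i) (at 0)"
    by (simp add: DERIV_def \<phi>_0)
  obtain C where ev: "eventually (\<lambda>h. norm (S h x - \<phi> h x) \<le> C * \<bar>h\<bar> ^ 3) (at 0)"
    using bigO_step_at_point[of x 3 "\<lambda>h x. S h x - \<phi> h x"] order2 by (auto simp: has_order_def)
  have "((\<lambda>h. (S h x $ i - \<phi> h x $ i) / h) \<longlongrightarrow> 0) (at 0)"
  proof (rule Lim_null_comparison)
    show "eventually (\<lambda>h. norm ((S h x $ i - \<phi> h x $ i) / h) \<le> C * \<bar>h\<bar> ^ 2) (at 0)"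
      using ev eventually_neq_at_within[of 0 0]
    proof eventually_elim
      case (elim h)
      have "\<bar>S h x $ i - \<phi> h x $ i\<bar> \<le> norm (S h x - \<phi> h x)"
        using component_le_norm_cart[of "S h x - \<phi> h x" i] by simp
      also have "\<dots> \<le> (C * \<bar>h\<bar> ^ 2) * \<bar>h\<bar>"
        using elim(1) by (simp add: power3_eq_cube power2_eq_square mult.assoc)
      finally show ?case using elim(2) by (simp add: abs_divide pos_divide_le_eq)
    qed
    have "((\<lambda>h. C * \<bar>h\<bar> ^ 2) \<longlongrightarrow> C * \<bar>0::real\<bar> ^ 2) (at 0)" by (intro tendsto_intros)
    then show "((\<lambda>h::real. C * \<bar>h\<bar> ^ 2) \<longlongrightarrow> 0) (at 0)" by simp
  qed
  from tendsto_add[OF 2 this] show ?thesis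
    by (simp add: DERIV_def S_0 add_divide_distrib[symmetric])
qed

lemma fc_real: "fc i (0, cvec x) = of_real (f x $ i)"
proof -
  let ?G = "\<lambda>p. Sc (fst p) (snd p) $ i"
  have "cdiff ?G (rpt (0, x))" by (rule hol_at_cdiff[OF hol_at_Sc])
  then have "cdiff ?G ((0, cvec x) + cscale 0 (1, 0))" by (simp add: rpt_0)
  from cdiff_line[OF this]
  have "((\<lambda>t. Sc t (cvec x) $ i) has_field_derivative fc i (0, cvec x)) (at (of_real 0))"
    by (simp add: fc_def) (simp add: cscale_def)
  then have 1: "((\<lambda>h. Sc (of_real h) (cvec x) $ i) has_vector_derivative fc i (0, cvec x)) (at 0)"
    by (rule has_vector_derivative_real_field)
  have 2: "((\<lambda>h. complex_of_real (S h x $ i)) has_vector_derivative of_real (f x $ i)) (at 0)"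
    by (rule has_vector_derivative_of_real[OF S_derivative])
  have "((\<lambda>h. (h, x)) \<longlongrightarrow> (0::real, x)) (nhds 0)"
    by (intro tendsto_Pair filterlim_ident tendsto_const)
  from eventually_compose_filterlim[OF Sc_real this]
  have "eventually (\<lambda>h. Sc (of_real h) (cvec x) $ i = complex_of_real (S h x $ i)) (nhds 0)"
    by eventually_elim simp
  then obtain U where U: "open U" "0 \<in> U" "\<And>h. h \<in> U \<Longrightarrow> Sc (of_real h) (cvec x) $ i = complex_of_real (S h x $ i)"
    unfolding eventually_nhds by blast
  have "((\<lambda>h. complex_of_real (S h x $ i)) has_vector_derivative fc i (0, cvec x)) (at 0)"
    by (rule has_vector_derivative_transform_within_open[OF 1 U])
  then show ?thesis using 2 by (rule vector_derivative_unique_at)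
qed

text \<open>The operator \<open>F\<close> of the Lie series convention, the sum of
  \<open>f_i d/dx_i\<close>, on holomorphic functions; \<open>(0, axis i 1)\<close> is the direction
  of the \<open>i\<close>-th state coordinate.\<close>

definition Lie :: "(complex \<times> (complex^'d) \<Rightarrow> complex) \<Rightarrow> complex \<times> (complex^'d) \<Rightarrow> complex"
  where "Lie g p = (\<Sum>i\<in>UNIV. fc i p * cD g p (0, axis i 1))"

lemma hol_at_Lie: "hol_at g (rpt (0, x)) \<Longrightarrow> hol_at (Lie g) (rpt (0, x))"
  unfolding Lie_def[abs_def] by (intro hol_at_sum hol_at_mult hol_at_fc hol_at_cD)

lemma Lie_real:
  assumes "cdiff g (0, cvec y)"
  shows "Lie g (0, cvec y) = cD g (0, cvec y) (0, cvec (f y))"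
proof -
  have "(0, cvec (f y)) = (\<Sum>i\<in>UNIV. cscale (of_real (f y $ i)) (0, axis i 1))"
    by (simp add: cscale_def prod_eq_iff fst_sum snd_sum vec_eq_iff axis_def if_distrib sum.delta cong: if_cong)
  then have "cD g (0, cvec y) (0, cvec (f y)) = (\<Sum>i\<in>UNIV. cD g (0, cvec y) (cscale (of_real (f y $ i)) (0, axis i 1)))"
    by (simp only: linear_sum[OF linear_cD[OF assms]])
  then show ?thesis
    by (simp add: Lie_def fc_real cdiff_cD_cscale[OF assms])
qed

lemma Lie_flow:
  assumes "((\<lambda>s. \<phi> s x) has_vector_derivative f (\<phi> t x)) (at t)" "cdiff g (0, cvec (\<phi> t x))"
  shows "((\<lambda>t. g (0, cvec (\<phi> t x))) has_vector_derivative Lie g (0, cvec (\<phi> t x))) (at t)"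
proof -
  have bl: "bounded_linear (\<lambda>y::real^'d. (0::complex, cvec y))"
    by (intro bounded_linear_Pair bounded_linear_zero bounded_linear_cvec)
  have "((\<lambda>t. (0::complex, cvec (\<phi> t x))) has_derivative (\<lambda>s. s *\<^sub>R (0, cvec (f (\<phi> t x))))) (at t)"
    using bounded_linear.has_vector_derivative[OF bl assms(1)] by (simp add: has_vector_derivative_def)
  from has_derivative_compose[OF this cdiff_has_derivative[OF assms(2)]]
  show ?thesis
    unfolding has_vector_derivative_def Lie_real[OF assms(2)]
    by (simp only: linear_scale[OF linear_cD[OF assms(2)]])
qed

definition lie :: "nat \<Rightarrow> 'd \<Rightarrow> complex \<times> (complex^'d) \<Rightarrow> complex"
  where "lie j i = (Lie ^^ j) (\<lambda>p. snd p $ i)"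

lemma lie_simps: "lie 0 i p = snd p $ i" "lie (Suc j) i = Lie (lie j i)"
  by (simp_all add: lie_def)

lemma hol_at_lie: "hol_at (lie j i) (rpt (0, x))"
  by (induction j) (auto simp: lie_def intro: hol_at_Lie)

text \<open>Truncation of \<open>exp(hF)[x_i]\<close> before the term \<open>h^N\<close>; near real
  points at step zero it is holomorphic in step size and state.\<close>

definition lie_series :: "nat \<Rightarrow> 'd \<Rightarrow> complex \<times> (complex^'d) \<Rightarrow> complex"
  where "lie_series N i p = (\<Sum>j<N. lie j i (0, snd p) / fact j * fst p ^ j)"

lemma hol_at_lie_series: "hol_at (lie_series N i) (rpt (0, x))"
proof -
  have "hol_at (\<lambda>p. \<Sum>j<N. (1 / fact j) * (lie j i (0, snd p) * fst p ^ j)) (rpt (0, x))"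
    by (intro hol_at_sum hol_at_cmult hol_at_mult hol_at_0_snd hol_at_lie hol_at_power hol_at_fst)
  then show ?thesis by (simp add: lie_series_def[abs_def])
qed

text \<open>Along the flow the derivative of the truncated series with remaining time \<open>c - t\<close> telescopes.\<close>

lemma lie_series_flow_derivative:
  assumes d: "((\<lambda>s. \<phi> s x) has_vector_derivative f (\<phi> t x)) (at t)"
    and c: "\<And>j. j \<le> M \<Longrightarrow> cdiff (lie j i) (0, cvec (\<phi> t x))"
  shows "((\<lambda>t. lie_series (Suc M) i (of_real (c - t), cvec (\<phi> t x))) has_vector_derivative
    lie (Suc M) i (0, cvec (\<phi> t x)) / fact M * of_real (c - t) ^ M) (at t)"
  using c
proof (induction M)
  case 0
  have "((\<lambda>t. lie 0 i (0, cvec (\<phi> t x))) has_vector_derivative Lie (lie 0 i) (0, cvec (\<phi> t x))) (at t)"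
    by (rule Lie_flow[OF d]) (use 0 in simp)
  then show ?case by (simp add: lie_series_def lie_simps)
next
  case (Suc M)
  have 1: "((\<lambda>t. lie (Suc M) i (0, cvec (\<phi> t x))) has_vector_derivative lie (Suc (Suc M)) i (0, cvec (\<phi> t x))) (at t)"
    unfolding lie_simps(2)[of "Suc M"] by (rule Lie_flow[OF d]) (use Suc.prems in simp)
  have "((\<lambda>t. complex_of_real (c - t) ^ Suc M / fact (Suc M)) has_vector_derivative
      - (of_real (c - t) ^ M / fact M)) (at t)"
  proof -
    have "((\<lambda>t. (c - t) ^ Suc M / fact (Suc M)) has_field_derivative - ((c - t) ^ M / fact M)) (at t)"
      by (auto intro!: derivative_eq_intros simp: field_simps simp del: power_Suc of_nat_Suc)
    from has_vector_derivative_of_real[OF this, where 'a = complex] show ?thesis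
      by (simp del: power_Suc fact_Suc)
  qed
  from has_vector_derivative_mult[OF 1 this]
  have 2: "((\<lambda>t. lie (Suc M) i (0, cvec (\<phi> t x)) / fact (Suc M) * of_real (c - t) ^ Suc M) has_vector_derivative
      lie (Suc (Suc M)) i (0, cvec (\<phi> t x)) / fact (Suc M) * of_real (c - t) ^ Suc M
      - lie (Suc M) i (0, cvec (\<phi> t x)) / fact M * of_real (c - t) ^ M) (at t)"
    by (simp only: times_divide_eq_left times_divide_eq_right mult_minus_right uminus_add_conv_diff)
  have IH: "((\<lambda>t. lie_series (Suc M) i (of_real (c - t), cvec (\<phi> t x))) has_vector_derivative
    lie (Suc M) i (0, cvec (\<phi> t x)) / fact M * of_real (c - t) ^ M) (at t)"
    by (rule Suc.IH) (use Suc.prems in simp)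
  from has_vector_derivative_add[OF IH 2] show ?case
    by (simp add: lie_series_def)
qed

text \<open>\<open>exact_flow\<close> speaks of differentiability in time for each initial value.
  Joint continuity is borrowed from \<open>S\<close>, to which \<open>\<phi>\<close> is uniformly
  close by the order assumption.\<close>

lemma tendsto_\<phi>: "((\<lambda>q. \<phi> (fst q) (snd q)) \<longlongrightarrow> x) (nhds (0, x))"
proof (rule tendstoI)
  fix e :: real assume e: "e > 0"
  obtain C where C: "eventually (\<lambda>q. norm (S (fst q) (snd q) - \<phi> (fst q) (snd q)) \<le> C * \<bar>fst q\<bar> ^ 3) (at 0 \<times>\<^sub>F nhds x)"
    using order2 unfolding has_order_def bigO_step_iff by auto
  have "((\<lambda>q. C * \<bar>fst q\<bar> ^ 3) \<longlongrightarrow> C * \<bar>fst (0::real, x)\<bar> ^ 3) (nhds (0, x))"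
    by (intro tendsto_intros filterlim_ident)
  then have "eventually (\<lambda>q. C * \<bar>fst q\<bar> ^ 3 < e / 2) (nhds (0::real, x))"
    using e by (intro order_tendstoD(2)) auto
  from filter_leD[OF at_le_nhds this]
  have 1: "eventually (\<lambda>q. C * \<bar>fst q\<bar> ^ 3 < e / 2) (at 0 \<times>\<^sub>F nhds x)" .
  have "eventually (\<lambda>q. dist (S (fst q) (snd q)) x < e / 2) (nhds (0, x))"
    using tendstoD[OF tendsto_S] e half_gt_zero by blast
  from filter_leD[OF at_le_nhds this]
  have "eventually (\<lambda>q. dist (S (fst q) (snd q)) x < e / 2) (at 0 \<times>\<^sub>F nhds x)" .
  with 1 C have "eventually (\<lambda>q. dist (\<phi> (fst q) (snd q)) x < e) (at 0 \<times>\<^sub>F nhds x)"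
  proof eventually_elim
    case (elim q)
    have "dist (\<phi> (fst q) (snd q)) x \<le> dist (S (fst q) (snd q)) (\<phi> (fst q) (snd q)) + dist (S (fst q) (snd q)) x"
      by (rule dist_triangle3)
    then show ?case using elim by (simp add: dist_norm)
  qed
  then show "eventually (\<lambda>q. dist (\<phi> (fst q) (snd q)) x < e) (nhds (0, x))"
    by (rule eventually_nhds_0_step) (use e in \<open>auto simp: \<phi>_0 eventually_nhds_metric\<close>)
qed

lemma tendsto_\<phi>_cvec: "((\<lambda>q. (0, cvec (\<phi> (fst q) (snd q)))) \<longlongrightarrow> rpt (0, x)) (nhds (0, x))"
  unfolding rpt_0 by (intro tendsto_Pair tendsto_const bounded_linear.tendsto[OF bounded_linear_cvec] tendsto_\<phi>)

text \<open>Mean value inequality along the flow, from time \<open>0\<close> to \<open>h\<close>,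
  for the series with remaining time \<open>c - t\<close>. The choice \<open>c = h\<close> compares
  the flow with the series at the starting point; \<open>c = 0\<close> compares the series with step
  \<open>-h\<close> at the endpoint with the starting point.\<close>

lemma lie_series_flow:
  "\<exists>B. eventually (\<lambda>q. \<forall>c\<in>{0, fst q}.
    cmod (lie_series (Suc M) i (of_real (c - fst q), cvec (\<phi> (fst q) (snd q)))
      - lie_series (Suc M) i (of_real c, cvec (snd q))) \<le> B * \<bar>fst q\<bar> ^ Suc M) (nhds (0, x))"
proof -
  obtain r B where rB: "0 < r" "0 \<le> B" "\<And>q. q \<in> cball (rpt (0, x)) r \<Longrightarrow> cdiff (lie (Suc M) i) q"
    "\<And>q. q \<in> cball (rpt (0, x)) r \<Longrightarrow> cmod (lie (Suc M) i q) \<le> B"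
    using hol_at_bounded[OF hol_at_lie[of "Suc M" i x]] by blast
  have e1: "eventually (\<lambda>p. cmod (lie (Suc M) i p) \<le> B) (nhds (rpt (0, x)))"
    unfolding eventually_nhds_metric using rB(1,4) by (intro exI[of _ r]) (auto simp: dist_commute)
  have "eventually (\<lambda>p. \<forall>j\<in>{..M}. cdiff (lie j i) p) (nhds (rpt (0, x)))"
    by (rule eventually_ball_finite) (use hol_at_lie in \<open>auto simp: hol_at_def\<close>)
  from eventually_conj[OF flow_derivative[of x] eventually_conj[OF
      eventually_compose_filterlim[OF e1 tendsto_\<phi>_cvec]
      eventually_compose_filterlim[OF this tendsto_\<phi>_cvec]]]
  obtain \<delta> where \<delta>: "\<delta> > 0" "\<And>q. dist q (0, x) < \<delta> \<Longrightarrow>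
      ((\<lambda>s. \<phi> s (snd q)) has_vector_derivative f (\<phi> (fst q) (snd q))) (at (fst q)) \<and>
      cmod (lie (Suc M) i (0, cvec (\<phi> (fst q) (snd q)))) \<le> B \<and>
      (\<forall>j\<in>{..M}. cdiff (lie j i) (0, cvec (\<phi> (fst q) (snd q))))"
    unfolding eventually_nhds_metric by blast
  have "cmod (lie_series (Suc M) i (of_real (c - h), cvec (\<phi> h y))
      - lie_series (Suc M) i (of_real c, cvec y)) \<le> B * \<bar>h\<bar> ^ Suc M"
    if hy: "dist (h, y) (0, x) < \<delta>" and c: "c \<in> {0, h}" for h y c
  proof -
    let ?v = "\<lambda>t. lie_series (Suc M) i (of_real (c - t), cvec (\<phi> t y))"
    let ?v' = "\<lambda>t. lie (Suc M) i (0, cvec (\<phi> t y)) / fact M * of_real (c - t) ^ M"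
    have "cmod (?v h - ?v 0) \<le> (B * \<bar>h\<bar> ^ M) * norm (h - 0)"
    proof (rule differentiable_bound[where S = "closed_segment 0 h" and f' = "\<lambda>t s. s *\<^sub>R ?v' t"])
      fix t assume t: "t \<in> closed_segment 0 h"
      have th: "\<bar>t\<bar> \<le> \<bar>h\<bar>" "\<bar>c - t\<bar> \<le> \<bar>h\<bar>"
        using t c by (auto simp: closed_segment_eq_real_ivl split: if_splits)
      have "dist (t, y) (0, x) \<le> dist (h, y) (0, x)"
        using th(1) by (auto simp: dist_Pair_Pair intro!: real_sqrt_le_mono simp: abs_le_square_iff)
      then have ty: "dist (t, y) (0, x) < \<delta>" using hy by linarith
      have d: "(?v has_vector_derivative ?v' t) (at t)"
        by (rule lie_series_flow_derivative) (use \<delta>(2)[OF ty] in auto)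
      then show "(?v has_derivative (\<lambda>s. s *\<^sub>R ?v' t)) (at t within closed_segment 0 h)"
        unfolding has_vector_derivative_def by (rule has_derivative_at_withinI)
      have "cmod (?v' t) \<le> B * \<bar>h\<bar> ^ M"
      proof -
        have "cmod (?v' t) = cmod (lie (Suc M) i (0, cvec (\<phi> t y))) * \<bar>c - t\<bar> ^ M / fact M"
          by (simp add: norm_mult norm_divide norm_power flip: of_real_diff)
        also have "\<dots> \<le> (B * \<bar>h\<bar> ^ M) / 1"
          using \<delta>(2)[OF ty] th(2) rB(2)
          by (intro frac_le mult_mono power_mono) auto
        finally show ?thesis by simp
      qed
      then show "onorm (\<lambda>s. s *\<^sub>R ?v' t) \<le> B * \<bar>h\<bar> ^ M"
        using rB(2) by (intro onorm_bound) (auto simp: mult.commute[of "\<bar>_\<bar>"] intro!: mult_right_mono)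
    qed auto
    then show ?thesis by (simp add: \<phi>_0 mult.assoc mult.commute[of "\<bar>h\<bar>"])
  qed
  then show ?thesis
    unfolding eventually_nhds_metric using \<delta>(1) by (intro exI[of _ B] exI[of _ \<delta>]) fastforce
qed

text \<open>At remaining time zero the series is the coordinate itself. The second estimate takes
  the place of the group law \<open>\<phi>_{-h} o \<phi>_h = id\<close>.\<close>

lemma flow_eq_lie_series:
  "\<exists>B. eventually (\<lambda>q. cmod (of_real (\<phi> (fst q) (snd q) $ i) - lie_series (Suc M) i (rpt q)) \<le> B * \<bar>fst q\<bar> ^ Suc M) (nhds (0, x))"
  "\<exists>B. eventually (\<lambda>q. cmod (lie_series (Suc M) i (of_real (- fst q), cvec (\<phi> (fst q) (snd q))) - of_real (snd q $ i)) \<le> B * \<bar>fst q\<bar> ^ Suc M) (nhds (0, x))"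
proof -
  obtain B where B: "eventually (\<lambda>q. \<forall>c\<in>{0, fst q}.
    cmod (lie_series (Suc M) i (of_real (c - fst q), cvec (\<phi> (fst q) (snd q)))
      - lie_series (Suc M) i (of_real c, cvec (snd q))) \<le> B * \<bar>fst q\<bar> ^ Suc M) (nhds (0, x))"
    using lie_series_flow by blast
  have 0: "lie_series (Suc M) i (0, cvec y) = of_real (y $ i)" for y
    by (simp add: lie_series_def sum.lessThan_Suc_shift lie_simps del: sum.lessThan_Suc)
  show "\<exists>B. eventually (\<lambda>q. cmod (of_real (\<phi> (fst q) (snd q) $ i) - lie_series (Suc M) i (rpt q)) \<le> B * \<bar>fst q\<bar> ^ Suc M) (nhds (0, x))"
    using B by (intro exI[of _ B], elim eventually_mono) (simp add: 0 rpt_def)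
  show "\<exists>B. eventually (\<lambda>q. cmod (lie_series (Suc M) i (of_real (- fst q), cvec (\<phi> (fst q) (snd q))) - of_real (snd q $ i)) \<le> B * \<bar>fst q\<bar> ^ Suc M) (nhds (0, x))"
    using B by (intro exI[of _ B], elim eventually_mono) (simp add: 0)
qed

end

lemma order_at_base_zero:
  fixes g :: "complex \<times> (complex^'d) \<Rightarrow> complex"
  assumes g: "hol_at g (rpt (0, x0))" and 0: "\<And>x. g (rpt (0, x)) = 0"
  shows "bigO_step x0 1 (\<lambda>h x. g (rpt (h, x)))"
proof -
  obtain B where "eventually (\<lambda>p. cmod (g p - (\<Sum>i<1. dstep i g (0, snd p) / fact i * fst p ^ i))
      \<le> B * cmod (fst p) ^ 1) (nhds (rpt (0, x0)))"
    using Taylor_step[of g "cvec x0" 1] g unfolding rpt_0 by blast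
  from filter_leD[OF at_le_nhds eventually_compose_filterlim[OF this tendsto_rpt]]
  have "eventually (\<lambda>q. norm (g (rpt (fst q, snd q))) \<le> B * \<bar>fst q\<bar> ^ 1) (at 0 \<times>\<^sub>F nhds x0)"
    by eventually_elim (use 0 in \<open>simp add: rpt_def\<close>)
  then show ?thesis unfolding bigO_step_iff by blast
qed

lemma bigO_step_nhdsI:
  assumes "eventually (\<lambda>q. norm (E (fst q) (snd q)) \<le> B * \<bar>fst q\<bar> ^ k) (nhds (0, x0))"
  shows "bigO_step x0 k E"
  using filter_leD[OF at_le_nhds assms] unfolding bigO_step_iff by blast

text \<open>In \<open>g = c h^k + O(h^(k+1))\<close> the leading term is multiplied by
  \<open>(-1)^k\<close> when \<open>h\<close> changes sign.\<close>

lemma leading_parity: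
  fixes g :: "complex \<times> (complex^'d) \<Rightarrow> complex"
  assumes g: "hol_at g (rpt (0, x0))" and k: "bigO_step x0 k (\<lambda>h x. g (rpt (h, x)))"
  shows "bigO_step x0 (k + 1) (\<lambda>h x. g (rpt (- h, x)) - (- 1) ^ k * g (rpt (h, x)))"
proof -
  obtain C where C: "eventually (\<lambda>q. cmod (g (rpt q)) \<le> C * \<bar>fst q\<bar> ^ k) (at 0 \<times>\<^sub>F nhds x0)"
    using k unfolding bigO_step_iff by auto
  obtain c B where B: "0 \<le> B"
    "eventually (\<lambda>p. cmod (g p) \<le> B * cmod (fst p) ^ k) (nhds (rpt (0, x0)))"
    "eventually (\<lambda>p. cmod (g p - c (snd p) * fst p ^ k) \<le> B * cmod (fst p) ^ (k + 1)) (nhds (rpt (0, x0)))"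
    by (rule order_complex_points[OF g C])
  have 1: "bigO_step x0 (k + 1) (\<lambda>h x. g (rpt (h, x)) - c (cvec x) * of_real h ^ k)"
    by (rule bigO_step_nhdsI[where B = B])
      (use eventually_compose_filterlim[OF B(3) tendsto_rpt] in \<open>simp add: rpt_def\<close>)
  from bigO_step_diff[OF bigO_step_minus_arg[OF this] bigO_step_cmult[OF this, of "(-1) ^ k"]]
  show ?thesis
    by (rule bigO_step_cong) (intro always_eventually allI, simp add: power_minus[of "of_real _"] algebra_simps)
qed

text \<open>Orders add: \<open>k\<close> from the Lipschitz constant of \<open>g\<close>,
  \<open>l\<close> from the distance of the arguments. As \<open>u\<close> and \<open>v\<close> are
  complex, the order of \<open>g\<close> is first carried to complex points.\<close>

lemma Lipschitz_step:
  fixes g :: "complex \<times> (complex^'d) \<Rightarrow> complex"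
  assumes g: "hol_at g (rpt (0, x0))" and k: "bigO_step x0 k (\<lambda>h x. g (rpt (h, x)))"
    and u: "((\<lambda>q. (of_real (fst q), u (fst q) (snd q))) \<longlongrightarrow> rpt (0, x0)) (nhds (0, x0))"
    and v: "((\<lambda>q. (of_real (fst q), v (fst q) (snd q))) \<longlongrightarrow> rpt (0, x0)) (nhds (0, x0))"
    and uv: "bigO_step x0 l (\<lambda>h x. u h x - v h x)"
  shows "bigO_step x0 (k + l) (\<lambda>h x. g (of_real h, u h x) - g (of_real h, v h x))"
proof -
  obtain C where C: "eventually (\<lambda>q. cmod (g (rpt q)) \<le> C * \<bar>fst q\<bar> ^ k) (at 0 \<times>\<^sub>F nhds x0)"
    using k unfolding bigO_step_iff by auto
  obtain c B where B: "0 \<le> B"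
    "eventually (\<lambda>p. cmod (g p) \<le> B * cmod (fst p) ^ k) (nhds (rpt (0, x0)))"
    "eventually (\<lambda>p. cmod (g p - c (snd p) * fst p ^ k) \<le> B * cmod (fst p) ^ (k + 1)) (nhds (rpt (0, x0)))"
    by (rule order_complex_points[OF g C])
  obtain \<rho> L where L: "0 < \<rho>" "0 \<le> L"
    "\<And>t z z'. dist (t, z) (rpt (0, x0)) < \<rho> \<Longrightarrow> dist (t, z') (rpt (0, x0)) < \<rho> \<Longrightarrow>
      cmod (g (t, z) - g (t, z')) \<le> L * cmod t ^ k * norm (z - z')"
    using order_Lipschitz[OF g B(1,2)] by blast
  obtain D where D: "eventually (\<lambda>q. norm (u (fst q) (snd q) - v (fst q) (snd q)) \<le> D * \<bar>fst q\<bar> ^ l) (at 0 \<times>\<^sub>F nhds x0)"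
    using uv unfolding bigO_step_iff by blast
  have "eventually (\<lambda>q. norm (g (of_real (fst q), u (fst q) (snd q)) - g (of_real (fst q), v (fst q) (snd q)))
      \<le> (L * D) * \<bar>fst q\<bar> ^ (k + l)) (at 0 \<times>\<^sub>F nhds x0)"
    using filter_leD[OF at_le_nhds tendstoD[OF u L(1)]] filter_leD[OF at_le_nhds tendstoD[OF v L(1)]] D
  proof eventually_elim
    case (elim q)
    have "cmod (g (of_real (fst q), u (fst q) (snd q)) - g (of_real (fst q), v (fst q) (snd q)))
        \<le> L * cmod (of_real (fst q)) ^ k * norm (u (fst q) (snd q) - v (fst q) (snd q))"
      by (rule L(3)[OF elim(1,2)])
    also have "\<dots> \<le> L * cmod (of_real (fst q)) ^ k * (D * \<bar>fst q\<bar> ^ l)"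
      using elim(3) L(2) by (intro mult_left_mono) auto
    finally show ?case by (simp add: power_add ac_simps)
  qed
  then show ?thesis unfolding bigO_step_iff by blast
qed

section \<open>The leading error term\<close>

locale symmetric_conjugate = analytic_integrator S Sc f \<phi>
  for S :: "real \<Rightarrow> real^'d \<Rightarrow> real^'d" and Sc :: "complex \<Rightarrow> complex^'d \<Rightarrow> complex^'d"
    and f :: "real^'d \<Rightarrow> real^'d" and \<phi> :: "real \<Rightarrow> real^'d \<Rightarrow> real^'d" +
  fixes \<alpha> :: "nat \<Rightarrow> complex" and s r :: nat
  assumes symconj: "\<And>j. j \<in> {1..s} \<Longrightarrow> \<alpha> (s + 1 - j) = cnj (\<alpha> j)"
    and order_r: "has_order (\<lambda>h x. cvec (\<phi> h x)) r (\<lambda>h x. composition Sc \<alpha> s h (cvec x))"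
begin

abbreviation \<psi> where "\<psi> \<equiv> compC Sc \<alpha> s"
abbreviation \<psi>' where "\<psi>' \<equiv> compC Sc (\<lambda>j. cnj (\<alpha> j)) s"

lemma conjugate_adjoint: "eventually (\<lambda>p. \<psi>' (fst p, \<psi> (- fst p, snd p)) = snd p) (nhds (rpt (0, x)))"
  by (rule compC_reverse) (use symconj in auto)

lemma \<psi>'_real: "eventually (\<lambda>q. \<psi>' (rpt q) = cconj (\<psi> (rpt q))) (nhds (0, x))"
  using eventually_compose_filterlim[OF compC_cnj[of \<alpha> s x] tendsto_rpt]
  by eventually_elim (simp add: rpt_def)

text \<open>Error against the truncated Lie series instead of the flow, hence holomorphic and open
  to \<open>leading_parity\<close>. \<open>Suc (r + 1)\<close> terms reach \<open>h^(r+1)\<close>,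
  so truncation costs \<open>O(h^(r+2))\<close> and does not touch the leading error term.\<close>

definition E where "E i p = \<psi> p $ i - lie_series (Suc (r + 1)) i p"
definition E' where "E' i p = \<psi>' p $ i - lie_series (Suc (r + 1)) i p"

lemma hol_at_E: "hol_at (E i) (rpt (0, x))" and hol_at_E': "hol_at (E' i) (rpt (0, x))"
  unfolding E_def[abs_def] E'_def[abs_def] by (intro hol_at_diff hol_at_compC hol_at_lie_series)+

lemma \<psi>_order: "bigO_step x0 (r + 1) (\<lambda>h x. \<psi> (rpt (h, x)) $ i - of_real (\<phi> h x $ i))"
proof -
  have "bigO_step x0 (r + 1) (\<lambda>h x. (composition Sc \<alpha> s h (cvec x) - cvec (\<phi> h x)) $ i)"
    by (rule bigO_step_nth) (use order_r in \<open>simp add: has_order_def\<close>)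
  then show ?thesis by (simp add: composition_eq_compC rpt_def)
qed

text \<open>At real points the error of \<open>\<psi>'\<close> is the conjugate of that of
  \<open>\<psi>\<close>, because \<open>\<phi>\<close> is real.\<close>

lemma \<psi>'_order: "bigO_step x0 (r + 1) (\<lambda>h x. \<psi>' (rpt (h, x)) $ i - of_real (\<phi> h x $ i))"
proof (rule bigO_step_cong[OF \<psi>_order[of x0 i]])
  show "eventually (\<lambda>q. norm (\<psi>' (rpt (fst q, snd q)) $ i - of_real (\<phi> (fst q) (snd q) $ i))
      \<le> norm (\<psi> (rpt (fst q, snd q)) $ i - of_real (\<phi> (fst q) (snd q) $ i))) (at 0 \<times>\<^sub>F nhds x0)"
    using filter_leD[OF at_le_nhds \<psi>'_real[of x0]]
  proof eventually_elim
    case (elim q)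
    have "\<psi>' (rpt q) $ i - of_real (\<phi> (fst q) (snd q) $ i) = cnj (\<psi> (rpt q) $ i - of_real (\<phi> (fst q) (snd q) $ i))"
      using elim by simp
    then have "cmod (\<psi>' (rpt q) $ i - of_real (\<phi> (fst q) (snd q) $ i)) = cmod (\<psi> (rpt q) $ i - of_real (\<phi> (fst q) (snd q) $ i))"
      by (simp only: complex_mod_cnj)
    then show ?case by simp
  qed
qed

lemma lie_series_order:
  "bigO_step x0 (Suc M) (\<lambda>h x. of_real (\<phi> h x $ i) - lie_series (Suc M) i (rpt (h, x)))"
  using flow_eq_lie_series(1)[of i M x0] bigO_step_nhdsI[of "\<lambda>h x. of_real (\<phi> h x $ i) - lie_series (Suc M) i (rpt (h, x))"]
  by auto

lemma lie_series_inverse_flow: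
  "bigO_step x0 (Suc M) (\<lambda>h x. lie_series (Suc M) i (rpt (h, \<phi> (- h) x)) - of_real (x $ i))"
proof -
  have "bigO_step x0 (Suc M) (\<lambda>h x. lie_series (Suc M) i (of_real (- h), cvec (\<phi> h x)) - of_real (x $ i))"
    using flow_eq_lie_series(2)[of M i x0]
      bigO_step_nhdsI[of "\<lambda>h x. lie_series (Suc M) i (of_real (- h), cvec (\<phi> h x)) - of_real (x $ i)"]
    by auto
  from bigO_step_minus_arg[OF this] show ?thesis by (simp add: rpt_def)
qed

lemma E_order: "bigO_step x0 (r + 1) (\<lambda>h x. E i (rpt (h, x)))"
  using bigO_step_add[OF \<psi>_order[of x0 i] bigO_step_mono[OF lie_series_order[of x0 "r + 1" i], of "r + 1"]]
  by (simp add: E_def)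

lemma E'_order: "bigO_step x0 (r + 1) (\<lambda>h x. E' i (rpt (h, x)))"
  using bigO_step_add[OF \<psi>'_order[of x0 i] bigO_step_mono[OF lie_series_order[of x0 "r + 1" i], of "r + 1"]]
  by (simp add: E'_def)

lemma flow_near_identity: "bigO_step x0 1 (\<lambda>h x. \<phi> h x - x)"
proof (rule bigO_step_vecI)
  fix i
  have 0: "lie_series (Suc 0) i (rpt (0, y)) - snd (rpt (0, y)) $ i = 0" for y
    by (simp add: lie_series_def lie_simps rpt_def)
  have "bigO_step x0 1 (\<lambda>h x. lie_series (Suc 0) i (rpt (h, x)) - snd (rpt (h, x)) $ i)"
    by (rule order_at_base_zero[where g = "\<lambda>p. lie_series (Suc 0) i p - snd p $ i", OF _ 0])
      (intro hol_at_diff hol_at_lie_series hol_at_snd_nth)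
  from bigO_step_add[OF lie_series_order[of x0 0 i, folded One_nat_def] this]
  have *: "bigO_step x0 1 (\<lambda>h x. complex_of_real (\<phi> h x $ i) - of_real (x $ i))"
    by (simp add: rpt_def)
  show "bigO_step x0 1 (\<lambda>h x. (\<phi> h x - x) $ i)"
    by (rule bigO_step_cong[OF *]) (simp flip: of_real_diff)
qed

lemma tendsto_\<psi>_minus: "((\<lambda>q. (of_real (fst q), \<psi> (rpt (- fst q, snd q)))) \<longlongrightarrow> rpt (0, x)) (nhds (0, x))"
  using filterlim_compose[OF filterlim_compose[OF tendsto_compC[of "-1" \<alpha> s x] tendsto_rpt] tendsto_minus_fst[of x]]
  by (simp add: rpt_def)

lemma tendsto_\<phi>_minus: "((\<lambda>q. rpt (fst q, \<phi> (- fst q) (snd q))) \<longlongrightarrow> rpt (0, x)) (nhds (0, x))"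
proof -
  have "((\<lambda>q. \<phi> (- fst q) (snd q)) \<longlongrightarrow> x) (nhds (0, x))"
    using filterlim_compose[OF tendsto_\<phi>[of x] tendsto_minus_fst[of x]] by simp
  from tendsto_Pair[OF tendsto_fst[OF filterlim_ident[of "nhds (0, x)"]] this]
  have "((\<lambda>q. (fst q, \<phi> (- fst q) (snd q))) \<longlongrightarrow> (0, x)) (nhds (0, x))" by simp
  from filterlim_compose[OF tendsto_rpt this] show ?thesis .
qed

text \<open>The leading error term of \<open>\<psi>\<close> is determined up to conjugation by \<open>\<psi>'\<^sub>h \<circ> \<psi>\<^sub>-\<^sub>h = id\<close>.\<close>

lemma leading_error:
  "bigO_step x0 (r + 2) (\<lambda>h x. (- 1) ^ (r + 1) * (\<psi> (rpt (h, x)) $ i - of_real (\<phi> h x $ i))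
    + (\<psi>' (rpt (h, x)) $ i - of_real (\<phi> h x $ i)))"
proof -
  let ?P = "lie_series (Suc (r + 1)) i"
  \<comment> \<open>Subtracting the identity leaves a function of order one, so exchanging
    \<open>\<psi>_{-h}\<close> for \<open>\<phi>_{-h}\<close> inside it, a change of
    \<open>O(h^(r+1))\<close>, costs only \<open>O(h^(r+2))\<close>.\<close>
  let ?K = "\<lambda>p. \<psi>' p $ i - snd p $ i"
  have K: "hol_at ?K (rpt (0, x0))" by (intro hol_at_diff hol_at_compC hol_at_snd_nth)
  have K1: "bigO_step x0 1 (\<lambda>h x. ?K (rpt (h, x)))"
    by (rule order_at_base_zero[OF K]) (simp only: compC_rpt_0, simp add: rpt_0)
  have t: "((\<lambda>q. (of_real (fst q), cvec (snd q))) \<longlongrightarrow> rpt (0, x0)) (nhds (0, x0))"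
    using tendsto_rpt[of "(0, x0)"] by (simp add: rpt_def[abs_def])
  have "bigO_step x0 (r + 1) (\<lambda>h x. \<psi> (rpt (h, x)) - cvec (\<phi> h x))"
    by (rule bigO_step_vecI) (use \<psi>_order in simp)
  from bigO_step_minus_arg[OF this]
  have d: "bigO_step x0 (r + 1) (\<lambda>h x. \<psi> (rpt (- h, x)) - cvec (\<phi> (- h) x))" .
  have 1: "bigO_step x0 (1 + (r + 1)) (\<lambda>h x. ?K (of_real h, \<psi> (rpt (- h, x))) - ?K (of_real h, cvec (\<phi> (- h) x)))"
    by (rule Lipschitz_step[OF K K1 _ _ d]) (use tendsto_\<psi>_minus tendsto_\<phi>_minus in \<open>simp_all add: rpt_def\<close>)
  have "bigO_step x0 1 (\<lambda>h x. cvec (\<phi> h x) - cvec x)"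
    by (rule bigO_step_cong[OF flow_near_identity]) (simp flip: cvec_diff)
  from bigO_step_minus_arg[OF this]
  have e: "bigO_step x0 1 (\<lambda>h x. cvec (\<phi> (- h) x) - cvec x)" .
  \<comment> \<open>\<open>E'\<close> is already \<open>O(h^(r+1))\<close>; moving its argument by
    \<open>O(h)\<close>, from \<open>\<phi>_{-h}(x)\<close> to \<open>x\<close>, gains one more
    order.\<close>
  have 2: "bigO_step x0 (r + 1 + 1) (\<lambda>h x. E' i (of_real h, cvec (\<phi> (- h) x)) - E' i (of_real h, cvec x))"
    by (rule Lipschitz_step[OF hol_at_E' E'_order _ _ e])
      (use tendsto_\<phi>_minus t in \<open>simp_all add: rpt_def\<close>)
  have 3: "bigO_step x0 (r + 2) (\<lambda>h x. ?P (rpt (h, \<phi> (- h) x)) - of_real (x $ i))"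
    using lie_series_inverse_flow[of x0 "r + 1" i] by simp
  have 4: "bigO_step x0 (r + 2) (\<lambda>h x. ?P (rpt (- h, x)) - of_real (\<phi> (- h) x $ i))"
    using bigO_step_cmult[OF bigO_step_minus_arg[OF lie_series_order[of x0 "r + 1" i]], of "-1"] by simp
  have 5: "bigO_step x0 (r + 2) (\<lambda>h x. E i (rpt (- h, x)) - (- 1) ^ (r + 1) * E i (rpt (h, x)))"
    using leading_parity[OF hol_at_E E_order, of x0 i] by simp
  have 6: "bigO_step x0 (r + 2) (\<lambda>h x. of_real (\<phi> h x $ i) - ?P (rpt (h, x)))"
    using lie_series_order[of x0 "r + 1" i] by simp
  let ?e1 = "\<lambda>h x. ?K (of_real h, \<psi> (rpt (- h, x))) - ?K (of_real h, cvec (\<phi> (- h) x))"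
  let ?e2 = "\<lambda>h x. E' i (of_real h, cvec (\<phi> (- h) x)) - E' i (of_real h, cvec x)"
  let ?e3 = "\<lambda>h x. ?P (rpt (h, \<phi> (- h) x)) - of_real (x $ i)"
  let ?e4 = "\<lambda>h x. ?P (rpt (- h, x)) - of_real (\<phi> (- h) x $ i)"
  let ?e5 = "\<lambda>h x. E i (rpt (- h, x)) - (- 1) ^ (r + 1) * E i (rpt (h, x))"
  let ?e6 = "\<lambda>h x. of_real (\<phi> h x $ i) - ?P (rpt (h, x))"
  have h1: "bigO_step x0 (r + 2) ?e1" using 1 by simp
  have h2: "bigO_step x0 (r + 2) ?e2" using 2 by simp
  \<comment> \<open>Since \<open>\<psi>'_h(\<psi>_{-h}(x)) = x\<close>, the sum of
    \<open>?e1\<close> to \<open>?e5\<close> telescopes to the negative of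
    \<open>(-1)^(r+1) E + E'\<close> at \<open>(h, x)\<close>; the multiple of \<open>?e6\<close>
    then exchanges the series for the flow.\<close>
  have all: "bigO_step x0 (r + 2) (\<lambda>h x. - 1 * (?e1 h x + ?e2 h x + ?e3 h x + ?e4 h x + ?e5 h x) - (1 + (- 1) ^ (r + 1)) * ?e6 h x)"
    by (rule bigO_step_diff[OF bigO_step_cmult[OF bigO_step_add[OF bigO_step_add[OF bigO_step_add[OF
      bigO_step_add[OF h1 h2] 3] 4] 5]] bigO_step_cmult[OF 6]])
  show ?thesis
  proof (rule bigO_step_cong[OF all])
    show "eventually (\<lambda>q. norm ((- 1) ^ (r + 1) * (\<psi> (rpt (fst q, snd q)) $ i - of_real (\<phi> (fst q) (snd q) $ i))
        + (\<psi>' (rpt (fst q, snd q)) $ i - of_real (\<phi> (fst q) (snd q) $ i)))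
      \<le> norm (- 1 * (?e1 (fst q) (snd q) + ?e2 (fst q) (snd q) + ?e3 (fst q) (snd q) + ?e4 (fst q) (snd q)
          + ?e5 (fst q) (snd q)) - (1 + (- 1) ^ (r + 1)) * ?e6 (fst q) (snd q))) (at 0 \<times>\<^sub>F nhds x0)"
      using filter_leD[OF at_le_nhds eventually_compose_filterlim[OF conjugate_adjoint[of x0] t]]
    proof eventually_elim
      case (elim q)
      obtain h x where q: "q = (h, x)" by (cases q)
      have "\<psi>' (of_real h, \<psi> (rpt (- h, x))) = cvec x"
        using elim by (simp add: q rpt_def)
      then have x: "\<psi>' (of_real h, \<psi> (rpt (- h, x))) $ i = of_real (x $ i)" by simp
      have "(- 1) ^ (r + 1) * (\<psi> (rpt (h, x)) $ i - of_real (\<phi> h x $ i)) + (\<psi>' (rpt (h, x)) $ i - of_real (\<phi> h x $ i))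
        = - 1 * (?e1 h x + ?e2 h x + ?e3 h x + ?e4 h x + ?e5 h x) - (1 + (- 1) ^ (r + 1)) * ?e6 h x"
        unfolding E_def E'_def snd_conv x by (simp add: rpt_def algebra_simps)
      then show ?case by (simp only: q fst_conv snd_conv order_refl)
    qed
  qed
qed

end

section \<open>The real part of the composition\<close>

lemma bigO_step_norm_add:
  assumes "bigO_step x0 k E" "bigO_step x0 k E'"
    and "eventually (\<lambda>q. norm (D (fst q) (snd q)) \<le> norm (E (fst q) (snd q)) + norm (E' (fst q) (snd q))) (at 0 \<times>\<^sub>F nhds x0)"
  shows "bigO_step x0 k D"
proof -
  obtain C where C: "eventually (\<lambda>q. norm (E (fst q) (snd q)) \<le> C * \<bar>fst q\<bar> ^ k) (at 0 \<times>\<^sub>F nhds x0)"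
    using assms(1) unfolding bigO_step_iff by blast
  obtain C' where C': "eventually (\<lambda>q. norm (E' (fst q) (snd q)) \<le> C' * \<bar>fst q\<bar> ^ k) (at 0 \<times>\<^sub>F nhds x0)"
    using assms(2) unfolding bigO_step_iff by blast
  from C C' assms(3) have "eventually (\<lambda>q. norm (D (fst q) (snd q)) \<le> (C + C') * \<bar>fst q\<bar> ^ k) (at 0 \<times>\<^sub>F nhds x0)"
    by eventually_elim (simp add: distrib_right)
  then show ?thesis unfolding bigO_step_iff by blast
qed

text \<open>The first-order terms in \<open>w\<close> and \<open>- w\<close> cancel, which leaves
  two Taylor remainders quadratic in \<open>w\<close>.\<close>

lemma second_difference_step:
  fixes g :: "complex \<times> (complex^'d) \<Rightarrow> complex"
  assumes g: "hol_at g (rpt (0, x0))"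
    and v: "((\<lambda>q. (of_real (fst q), v (fst q) (snd q))) \<longlongrightarrow> rpt (0, x0)) (nhds (0, x0))"
    and vw: "((\<lambda>q. (of_real (fst q), v (fst q) (snd q) + w (fst q) (snd q))) \<longlongrightarrow> rpt (0, x0)) (nhds (0, x0))"
    and w: "bigO_step x0 l w"
  shows "bigO_step x0 (2 * l) (\<lambda>h x. g (of_real h, v h x + w h x) + g (of_real h, v h x - w h x) - 2 * g (of_real h, v h x))"
proof -
  obtain \<rho> C where \<rho>: "0 < \<rho>" "0 \<le> C" "\<And>q. q \<in> cball (rpt (0, x0)) (2 * \<rho>) \<Longrightarrow> cdiff g q"
    "\<And>p w. p \<in> cball (rpt (0, x0)) \<rho> \<Longrightarrow> norm w \<le> \<rho> \<Longrightarrow> cmod (g (p + w) - g p - cD g p w) \<le> C * (norm w)\<^sup>2"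
    using hol_at_Taylor2[OF g] by blast
  obtain D where D: "eventually (\<lambda>q. norm (w (fst q) (snd q)) \<le> D * \<bar>fst q\<bar> ^ l) (at 0 \<times>\<^sub>F nhds x0)"
    using w unfolding bigO_step_iff by blast
  have r2: "\<rho> / 2 > 0" using \<rho>(1) by simp
  have "eventually (\<lambda>q. norm (g (of_real (fst q), v (fst q) (snd q) + w (fst q) (snd q))
      + g (of_real (fst q), v (fst q) (snd q) - w (fst q) (snd q)) - 2 * g (of_real (fst q), v (fst q) (snd q)))
      \<le> (2 * C * D\<^sup>2) * \<bar>fst q\<bar> ^ (2 * l)) (at 0 \<times>\<^sub>F nhds x0)"
    using filter_leD[OF at_le_nhds tendstoD[OF v r2]] filter_leD[OF at_le_nhds tendstoD[OF vw r2]] D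
  proof eventually_elim
    case (elim q)
    define h V W where hvw: "h = fst q" "V = v (fst q) (snd q)" "W = w (fst q) (snd q)"
    define p where "p = (complex_of_real h, V)"
    have "dist p (rpt (0, x0)) < \<rho> / 2" "dist (p + (0, W)) (rpt (0, x0)) < \<rho> / 2"
      using elim(1,2) by (simp_all add: p_def hvw)
    \<comment> \<open>\<open>w\<close> is small because \<open>v\<close> and \<open>v + w\<close>
      tend to the same point; the Taylor estimate then applies to \<open>- w\<close> as
      well.\<close>
    moreover have "norm ((0::complex), W) = dist (p + (0, W)) p" by (simp add: dist_norm)
    moreover have "dist (p + (0, W)) p \<le> dist (p + (0, W)) (rpt (0, x0)) + dist p (rpt (0, x0))"
      by (rule dist_triangle2)
    ultimately have nW: "norm ((0::complex), W) \<le> \<rho>" and p: "p \<in> cball (rpt (0, x0)) \<rho>"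
      and p2: "p \<in> cball (rpt (0, x0)) (2 * \<rho>)"
      using \<rho>(1) by (simp_all add: dist_commute)
    have "cD g p (- (0, W)) = - cD g p (0, W)"
      by (rule linear_neg[OF linear_cD[OF \<rho>(3)[OF p2]]])
    then have "g (p + (0, W)) + g (p + - (0, W)) - 2 * g p
        = (g (p + (0, W)) - g p - cD g p (0, W)) + (g (p + - (0, W)) - g p - cD g p (- (0, W)))"
      by simp
    also have "cmod \<dots> \<le> C * (norm ((0::complex), W))\<^sup>2 + C * (norm (- ((0::complex), W)))\<^sup>2"
      by (intro order_trans[OF norm_triangle_ineq] add_mono \<rho>(4)[OF p]) (use nW in simp_all)
    also have "\<dots> = 2 * C * (norm W)\<^sup>2" by simp
    also have "\<dots> \<le> 2 * C * (D * \<bar>h\<bar> ^ l)\<^sup>2"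
      using elim(3) \<rho>(2) by (intro mult_left_mono power_mono) (simp_all add: hvw)
    also have "\<dots> = (2 * C * D\<^sup>2) * \<bar>h\<bar> ^ (2 * l)"
      by (simp add: power_mult_distrib power_mult[symmetric] mult.commute)
    finally show ?case by (simp add: p_def hvw)
  qed
  then show ?thesis unfolding bigO_step_iff by blast
qed

text \<open>\<open>F\<close> is the identity plus a contraction with constant \<open>1/2\<close>,
  hence injective; solving \<open>F x = y\<close> means finding a fixed point of
  \<open>x \<mapsto> y - (F x - x)\<close>.\<close>

lemma near_identity_inverse:
  fixes F :: "'a::{real_normed_vector,complete_space} \<Rightarrow> 'a"
  assumes \<rho>: "0 < \<rho>"
    and lip: "\<And>x y. dist x x0 < \<rho> \<Longrightarrow> dist y x0 < \<rho> \<Longrightarrow> norm ((F x - x) - (F y - y)) \<le> norm (x - y) / 2"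
    and small: "dist (F x0) x0 \<le> \<rho> / 8"
  shows "inj_on F (ball x0 \<rho>)" and "dist y x0 < \<rho> / 8 \<Longrightarrow> y \<in> F ` ball x0 \<rho>"
proof -
  show "inj_on F (ball x0 \<rho>)"
  proof (rule inj_onI)
    fix x y assume "x \<in> ball x0 \<rho>" "y \<in> ball x0 \<rho>" "F x = F y"
    then have "norm (y - x) \<le> norm (x - y) / 2"
      using lip[of x y] by (simp add: dist_commute)
    then have "norm (x - y) \<le> 0" by (simp add: norm_minus_commute)
    then show "x = y" by simp
  qed
  assume y: "dist y x0 < \<rho> / 8"
  have "\<exists>!x\<in>cball x0 (\<rho> / 2). y - (F x - x) = x"
  proof (rule Banach_fix[where c = "1/2"])
    show "complete (cball x0 (\<rho> / 2))"
      by (simp add: complete_eq_closed)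
    \<comment> \<open>The radius is kept by
      \<open>\<rho>/8 + \<rho>/4 + \<rho>/8 = \<rho>/2\<close>: distance of \<open>y\<close>,
      contraction, displacement of \<open>x0\<close>.\<close>
    show "(\<lambda>x. y - (F x - x)) ` cball x0 (\<rho> / 2) \<subseteq> cball x0 (\<rho> / 2)"
    proof
      fix z assume "z \<in> (\<lambda>x. y - (F x - x)) ` cball x0 (\<rho> / 2)"
      then obtain x where x': "x \<in> cball x0 (\<rho> / 2)" and xz: "z = y - (F x - x)"
        by blast
      have x: "dist x x0 \<le> \<rho> / 2" "z = y - (F x - x)"
        using x' by (simp add: dist_commute) (rule xz)
      have "norm ((F x - x) - (F x0 - x0)) \<le> norm (x - x0) / 2"
        using lip[of x x0] x \<rho> by simp
      then have 1: "norm ((F x - x) - (F x0 - x0)) \<le> \<rho> / 4"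
        using x by (simp add: dist_norm)
      have "z - x0 = (y - x0) - ((F x - x) - (F x0 - x0)) - (F x0 - x0)"
        using x(2) by simp
      then have "norm (z - x0) \<le> norm (y - x0) + norm ((F x - x) - (F x0 - x0)) + norm (F x0 - x0)"
        by (metis norm_triangle_ineq4 add_right_mono order_trans)
      then show "z \<in> cball x0 (\<rho> / 2)"
        using 1 y small by (simp add: dist_norm norm_minus_commute)
    qed
    show "dist (y - (F x - x)) (y - (F z - z)) \<le> 1 / 2 * dist x z"
      if "x \<in> cball x0 (\<rho> / 2)" "z \<in> cball x0 (\<rho> / 2)" for x z
    proof -
      have "dist (y - (F x - x)) (y - (F z - z)) = norm ((F x - x) - (F z - z))"
        unfolding dist_norm by (metis diff_diff_eq2 diff_add_cancel norm_minus_commute add_diff_cancel_left diff_diff_add minus_diff_eq)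
      then show ?thesis using lip[of x z] that \<rho> by (auto simp: dist_norm norm_minus_commute)
    qed
  qed (use \<rho> in auto)
  then obtain x where x: "x \<in> cball x0 (\<rho> / 2)" "y - (F x - x) = x" by blast
  then have "F x = y" by (simp add: algebra_simps)
  moreover have "x \<in> ball x0 \<rho>" using x(1) \<rho> by auto
  ultimately show "y \<in> F ` ball x0 \<rho>" by blast
qed

context symmetric_conjugate
begin

text \<open>\<open>Rc\<close> and \<open>Ic\<close> continue the real and imaginary part of
  \<open>\<psi>\<close> holomorphically, which \<open>Re\<close> and \<open>Im\<close> would not;
  they are real at real points near step zero, but in general not at complex ones.\<close>

definition Rc where "Rc i p = (1/2) * (\<psi> p $ i + \<psi>' p $ i)"
definition Ic where "Ic i p = (- \<i>/2) * (\<psi> p $ i - \<psi>' p $ i)"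

abbreviation R where "R \<equiv> real_part_method Sc \<alpha> s"

lemma hol_at_Rc: "hol_at (Rc i) (rpt (0, x))" and hol_at_Ic: "hol_at (Ic i) (rpt (0, x))"
  unfolding Rc_def[abs_def] Ic_def[abs_def]
  by (intro hol_at_cmult hol_at_add hol_at_diff hol_at_compC)+

lemma \<psi>_eq: "\<psi> p $ i = Rc i p + \<i> * Ic i p" and \<psi>'_eq: "\<psi>' p $ i = Rc i p - \<i> * Ic i p"
  by (simp_all add: Rc_def Ic_def field_simps)

lemma R_eq: "R h x = (1/2) *\<^sub>R (vec_Re (\<psi> (rpt (h, x))) + vec_Re (\<psi>' (rpt (h, x))))"
  by (simp add: real_part_method_def composition_eq_compC rpt_def vec_eq_iff)

lemma Rc_real: "eventually (\<lambda>q. \<forall>i. Rc i (rpt q) = of_real (R (fst q) (snd q) $ i)) (nhds (0, x))"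
  using \<psi>'_real[of x] by eventually_elim (simp add: Rc_def R_eq complex_eq_iff)

lemma Ic_real: "eventually (\<lambda>q. \<forall>i. Ic i (rpt q) \<in> \<real>) (nhds (0, x))"
  using \<psi>'_real[of x] by eventually_elim (simp add: Ic_def complex_is_Real_iff)

lemma tendsto_R: "((\<lambda>q. R (fst q) (snd q)) \<longlongrightarrow> x) (nhds (0, x))"
proof -
  have "((\<lambda>q. (1/2) *\<^sub>R (vec_Re (\<psi> (rpt q)) + vec_Re (\<psi>' (rpt q)))) \<longlongrightarrow> (1/2) *\<^sub>R (x + x)) (nhds (0, x))"
    by (intro tendsto_intros tendsto_compC_real)
  then show ?thesis by (simp add: R_eq scaleR_2[symmetric] del: scaleR_2)
qed

lemma R_minus_order:
  assumes "\<And>i. bigO_step x0 k (\<lambda>h x. Rc i (rpt (h, x)) - of_real (\<phi> h x $ i))"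
  shows "bigO_step x0 k (\<lambda>h x. R h x - \<phi> h x)"
proof (rule bigO_step_vecI)
  fix i
  show "bigO_step x0 k (\<lambda>h x. (R h x - \<phi> h x) $ i)"
  proof (rule bigO_step_cong[OF assms[of i]])
    show "eventually (\<lambda>q. norm ((R (fst q) (snd q) - \<phi> (fst q) (snd q)) $ i)
        \<le> norm (Rc i (rpt (fst q, snd q)) - of_real (\<phi> (fst q) (snd q) $ i))) (at 0 \<times>\<^sub>F nhds x0)"
      using filter_leD[OF at_le_nhds Rc_real[of x0]]
      by eventually_elim (simp flip: of_real_diff)
  qed
qed

lemma R_order_r: "bigO_step x0 (r + 1) (\<lambda>h x. R h x - \<phi> h x)"
proof (rule R_minus_order)
  fix i
  from bigO_step_cmult[OF bigO_step_add[OF \<psi>_order[of x0 i] \<psi>'_order[of x0 i]], of "1/2"]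
  show "bigO_step x0 (r + 1) (\<lambda>h x. Rc i (rpt (h, x)) - of_real (\<phi> h x $ i))"
    by (rule bigO_step_cong) (intro always_eventually allI, simp add: Rc_def field_simps)
qed

text \<open>For odd \<open>r\<close> the sign in \<open>leading_error\<close> is \<open>+1\<close>,
  and the sum there is twice the error of \<open>Rc\<close>.\<close>

lemma R_order_odd:
  assumes "odd r"
  shows "bigO_step x0 (r + 2) (\<lambda>h x. R h x - \<phi> h x)"
proof (rule R_minus_order)
  fix i
  from bigO_step_cmult[OF leading_error[of x0 i], of "1/2"]
  show "bigO_step x0 (r + 2) (\<lambda>h x. Rc i (rpt (h, x)) - of_real (\<phi> h x $ i))"
    by (rule bigO_step_cong) (intro always_eventually allI, use assms in \<open>simp add: Rc_def field_simps\<close>)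
qed

lemma Ic_order_r: "bigO_step x0 (r + 1) (\<lambda>h x. Ic i (rpt (h, x)))"
  using bigO_step_cmult[OF bigO_step_diff[OF \<psi>_order[of x0 i] \<psi>'_order[of x0 i]], of "- \<i>/2"]
  by (simp add: Ic_def)

text \<open>For even \<open>r\<close> the sign in \<open>leading_error\<close> is \<open>-1\<close>;
  the flow cancels and a multiple of \<open>Ic\<close> remains.\<close>

lemma Ic_order_even:
  assumes "even r"
  shows "bigO_step x0 (r + 2) (\<lambda>h x. Ic i (rpt (h, x)))"
proof -
  from bigO_step_cmult[OF leading_error[of x0 i], of "\<i>/2"] show ?thesis
    by (rule bigO_step_cong)
      (intro always_eventually allI, use assms in \<open>simp add: Ic_def norm_mult norm_minus_commute\<close>)
qed

text \<open>Conjugation exchanges \<open>\<psi>\<close> and \<open>\<psi>'\<close>, at complex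
  points too, and \<open>Rc\<close> is symmetric in the two.\<close>

lemma Rc_cnj: "eventually (\<lambda>p. \<forall>i. Rc i (cnj (fst p), cconj (snd p)) = cnj (Rc i p)) (nhds (rpt (0, x)))"
  using compC_cnj[of \<alpha> s x] compC_cnj[of "\<lambda>j. cnj (\<alpha> j)" s x]
  by eventually_elim (simp add: Rc_def add.commute)

lemma tendsto_R_minus: "((\<lambda>q. rpt (fst q, R (- fst q) (snd q))) \<longlongrightarrow> rpt (0, x)) (nhds (0, x))"
proof -
  have "((\<lambda>q. R (- fst q) (snd q)) \<longlongrightarrow> x) (nhds (0, x))"
    using filterlim_compose[OF tendsto_R[of x] tendsto_minus_fst[of x]] by simp
  from tendsto_Pair[OF tendsto_fst[OF filterlim_ident[of "nhds (0, x)"]] this]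
  have "((\<lambda>q. (fst q, R (- fst q) (snd q))) \<longlongrightarrow> (0, x)) (nhds (0, x))" by simp
  from filterlim_compose[OF tendsto_rpt this] show ?thesis .
qed

text \<open>With \<open>\<psi>\<^sub>-\<^sub>h(x) = a + \<i> b\<close>, where \<open>b = O(h\<^sup>m)\<close>, the real part of \<open>x = \<psi>'\<^sub>h(a + \<i> b)\<close> is
  \<open>R\<^sub>h(a) + O(h\<^sup>2\<^sup>m)\<close>: the term of first order in \<open>b\<close> is imaginary up to \<open>DI\<^sub>h(a) b\<close>.\<close>

lemma R_R_minus:
  assumes Im: "\<And>i. bigO_step x0 m (\<lambda>h x. Ic i (rpt (h, x)))"
  shows "bigO_step x0 (2 * m) (\<lambda>h x. R h (R (- h) x) - x)"
proof (rule bigO_step_vecI)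
  fix i
  let ?u = "\<lambda>h x. \<psi> (rpt (- h, x))"
  let ?a = "\<lambda>h x. cvec (R (- h) x)"
  \<comment> \<open>For small \<open>h\<close> this is \<open>\<i>\<close> times \<open>Ic\<close>
    at step size \<open>-h\<close>, hence of order \<open>m\<close>.\<close>
  let ?w = "\<lambda>h x. ?u h x - ?a h x"
  have minus: "eventually (\<lambda>q. \<forall>i. Rc i (rpt (- fst q, snd q)) = of_real (R (- fst q) (snd q) $ i)) (at 0 \<times>\<^sub>F nhds x0)"
    using filter_leD[OF at_le_nhds eventually_compose_filterlim[OF Rc_real[of x0] tendsto_minus_fst]] by simp
  have w: "bigO_step x0 m ?w"
  proof (rule bigO_step_vecI)
    fix i
    have "bigO_step x0 m (\<lambda>h x. \<i> * Ic i (rpt (- h, x)))"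
      by (rule bigO_step_cmult[OF bigO_step_minus_arg[OF Im]])
    then show "bigO_step x0 m (\<lambda>h x. ?w h x $ i)"
    proof (rule bigO_step_cong)
      show "eventually (\<lambda>q. norm (?w (fst q) (snd q) $ i) \<le> norm (\<i> * Ic i (rpt (- fst q, snd q)))) (at 0 \<times>\<^sub>F nhds x0)"
        using minus by eventually_elim (simp add: \<psi>_eq)
    qed
  qed
  have a: "((\<lambda>q. (of_real (fst q), ?a (fst q) (snd q))) \<longlongrightarrow> rpt (0, x0)) (nhds (0, x0))"
    using tendsto_R_minus[of x0] by (simp add: rpt_def)
  \<comment> \<open>\<open>Ic\<close> is real at the real point \<open>?a\<close>, so the imaginary
    part of \<open>Ic\<close> at \<open>?u\<close> is that of this difference; the order
    \<open>m\<close> of \<open>Ic\<close> adds to the order \<open>m\<close> of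
    \<open>?w\<close>.\<close>
  have 1: "bigO_step x0 (2 * m) (\<lambda>h x. Ic i (of_real h, ?u h x) - Ic i (of_real h, ?a h x))"
    using Lipschitz_step[OF hol_at_Ic Im tendsto_\<psi>_minus a w] by (simp add: mult_2)
  \<comment> \<open>\<open>?a - ?w\<close> is the conjugate of \<open>?a + ?w = ?u\<close>, so by
    \<open>Rc_cnj\<close> the first two terms add up to twice the real part of \<open>Rc\<close> at
    \<open>?u\<close>.\<close>
  have 2: "bigO_step x0 (2 * m) (\<lambda>h x. Rc i (of_real h, ?a h x + ?w h x) + Rc i (of_real h, ?a h x - ?w h x)
      - 2 * Rc i (of_real h, ?a h x))"
    by (rule second_difference_step[OF hol_at_Rc a _ w]) (use tendsto_\<psi>_minus[of x0] in simp)
  have t: "((\<lambda>q. (of_real (fst q), cvec (snd q))) \<longlongrightarrow> rpt (0, x0)) (nhds (0, x0))"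
    using tendsto_rpt[of "(0, x0)"] by (simp add: rpt_def[abs_def])
  have ta: "((\<lambda>q. (fst q, R (- fst q) (snd q))) \<longlongrightarrow> (0, x0)) (nhds (0, x0))"
    using tendsto_Pair[OF tendsto_fst[OF filterlim_ident[of "nhds (0, x0)"]]
        filterlim_compose[OF tendsto_R[of x0] tendsto_minus_fst[of x0]]] by simp
  show "bigO_step x0 (2 * m) (\<lambda>h x. (R h (R (- h) x) - x) $ i)"
  proof (rule bigO_step_norm_add[OF 2 1])
    show "eventually (\<lambda>q. norm ((R (fst q) (R (- fst q) (snd q)) - snd q) $ i)
      \<le> norm (Rc i (of_real (fst q), ?a (fst q) (snd q) + ?w (fst q) (snd q))
          + Rc i (of_real (fst q), ?a (fst q) (snd q) - ?w (fst q) (snd q)) - 2 * Rc i (of_real (fst q), ?a (fst q) (snd q)))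
        + norm (Ic i (of_real (fst q), ?u (fst q) (snd q)) - Ic i (of_real (fst q), ?a (fst q) (snd q)))) (at 0 \<times>\<^sub>F nhds x0)"
      using filter_leD[OF at_le_nhds eventually_compose_filterlim[OF conjugate_adjoint[of x0] t]]
        filter_leD[OF at_le_nhds eventually_compose_filterlim[OF Rc_cnj[of x0] tendsto_\<psi>_minus[of x0]]]
        filter_leD[OF at_le_nhds eventually_compose_filterlim[OF \<psi>'_real[of x0] tendsto_minus_fst[of x0]]]
        filter_leD[OF at_le_nhds eventually_compose_filterlim[OF Rc_real[of x0] ta]]
        filter_leD[OF at_le_nhds eventually_compose_filterlim[OF Ic_real[of x0] ta]]
        minus
    proof eventually_elim
      case (elim q)
      define h x u A where hx: "h = fst q" "x = snd q" "u = \<psi> (rpt (- h, x))" "A = R (- h) x"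
      have x: "\<psi>' (of_real h, u) = cvec x" using elim(1) by (simp add: hx rpt_def)
      have u': "cvec A - (u - cvec A) = cconj u"
      proof -
        have "cconj u $ j = Rc j (rpt (- h, x)) - \<i> * Ic j (rpt (- h, x))" for j
          using elim(3) \<psi>'_eq[of "rpt (- h, x)" j] by (simp add: hx)
        moreover have "u $ j = Rc j (rpt (- h, x)) + \<i> * Ic j (rpt (- h, x))" for j
          by (simp add: hx \<psi>_eq)
        moreover have "Rc j (rpt (- h, x)) = of_real (A $ j)" for j
          using elim(6) by (simp add: hx)
        ultimately show ?thesis by (simp add: vec_eq_iff)
      qed
      have c: "Rc i (of_real h, cconj u) = cnj (Rc i (of_real h, u))"
        using elim(2) by (simp add: hx)
      have R: "Rc i (of_real h, cvec A) = of_real (R h A $ i)"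
        using elim(4) by (simp add: hx rpt_def)
      have I: "Im (Ic i (of_real h, cvec A)) = 0"
        using elim(5) by (simp add: hx rpt_def complex_is_Real_iff)
      have "of_real (x $ i) = Rc i (of_real h, u) - \<i> * Ic i (of_real h, u)"
        using x \<psi>'_eq[of "(of_real h, u)" i] by simp
      then have "x $ i = Re (Rc i (of_real h, u)) + Im (Ic i (of_real h, u))"
        by (simp add: complex_eq_iff)
      then have "R h A $ i - x $ i = - Re (Rc i (of_real h, u) + Rc i (of_real h, cconj u) - 2 * Rc i (of_real h, cvec A)) / 2
          - Im (Ic i (of_real h, u) - Ic i (of_real h, cvec A))"
        by (simp add: c R I)
      then have "\<bar>R h A $ i - x $ i\<bar> \<le> \<bar>Re (Rc i (of_real h, u) + Rc i (of_real h, cconj u) - 2 * Rc i (of_real h, cvec A))\<bar>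
          + \<bar>Im (Ic i (of_real h, u) - Ic i (of_real h, cvec A))\<bar>"
        by linarith
      also have "\<dots> \<le> cmod (Rc i (of_real h, u) + Rc i (of_real h, cconj u) - 2 * Rc i (of_real h, cvec A))
          + cmod (Ic i (of_real h, u) - Ic i (of_real h, cvec A))"
        by (intro add_mono abs_Re_le_cmod abs_Im_le_cmod)
      finally show ?case using u' by (simp add: hx)
    qed
  qed
qed

text \<open>\<open>Rc - id\<close> vanishes at step size zero, so it has order one and Lipschitz
  constant \<open>O(h)\<close>. This supplies the contraction for
  \<open>near_identity_inverse\<close> on a ball independent of \<open>h\<close>.\<close>

lemma R_near_identity_Lipschitz:
  "\<exists>L \<delta>. 0 < \<delta> \<and> 0 \<le> L \<and> (\<forall>h x y. \<bar>h\<bar> < \<delta> \<longrightarrow> dist x x0 < \<delta> \<longrightarrow> dist y x0 < \<delta> \<longrightarrow>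
    norm ((R h x - x) - (R h y - y)) \<le> L * \<bar>h\<bar> * norm (x - y))"
proof -
  let ?K = "\<lambda>i p. Rc i p - snd p $ i"
  have "\<forall>i. \<exists>L. 0 \<le> L \<and> (\<exists>\<rho>>0. \<forall>t z z'. dist (t, z) (rpt (0, x0)) < \<rho> \<longrightarrow> dist (t, z') (rpt (0, x0)) < \<rho> \<longrightarrow>
      cmod (?K i (t, z) - ?K i (t, z')) \<le> L * cmod t * norm (z - z'))"
  proof
    fix i
    have K: "hol_at (?K i) (rpt (0, x0))" by (intro hol_at_diff hol_at_Rc hol_at_snd_nth)
    have "bigO_step x0 1 (\<lambda>h x. ?K i (rpt (h, x)))"
      by (rule order_at_base_zero[OF K]) (simp only: Rc_def compC_rpt_0, simp add: rpt_0)
    then obtain C where C: "eventually (\<lambda>q. cmod (?K i (rpt q)) \<le> C * \<bar>fst q\<bar> ^ 1) (at 0 \<times>\<^sub>F nhds x0)"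
      unfolding bigO_step_iff by auto
    obtain c B where B: "0 \<le> B"
      "eventually (\<lambda>p. cmod (?K i p) \<le> B * cmod (fst p) ^ 1) (nhds (rpt (0, x0)))"
      "eventually (\<lambda>p. cmod (?K i p - c (snd p) * fst p ^ 1) \<le> B * cmod (fst p) ^ (1 + 1)) (nhds (rpt (0, x0)))"
      by (rule order_complex_points[OF K C])
    obtain \<rho> L where L: "0 < \<rho>" "0 \<le> L"
      "\<And>t z z'. dist (t, z) (rpt (0, x0)) < \<rho> \<Longrightarrow> dist (t, z') (rpt (0, x0)) < \<rho> \<Longrightarrow>
        cmod (?K i (t, z) - ?K i (t, z')) \<le> L * cmod t ^ 1 * norm (z - z')"
      using order_Lipschitz[OF K B(1,2)] by blast
    show "\<exists>L. 0 \<le> L \<and> (\<exists>\<rho>>0. \<forall>t z z'. dist (t, z) (rpt (0, x0)) < \<rho> \<longrightarrow> dist (t, z') (rpt (0, x0)) < \<rho> \<longrightarrow>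
      cmod (?K i (t, z) - ?K i (t, z')) \<le> L * cmod t * norm (z - z'))"
      by (intro exI[of _ L] conjI L(2) exI[of _ \<rho>] L(1) allI impI) (use L(3) in simp)
  qed
  from choice[OF this] obtain L where "\<forall>i. 0 \<le> L i \<and> (\<exists>\<rho>>0. \<forall>t z z'. dist (t, z) (rpt (0, x0)) < \<rho> \<longrightarrow>
      dist (t, z') (rpt (0, x0)) < \<rho> \<longrightarrow> cmod (?K i (t, z) - ?K i (t, z')) \<le> L i * cmod t * norm (z - z'))"
    by (rule exE)
  then have L: "\<And>i. 0 \<le> L i" "\<forall>i. \<exists>\<rho>>0. \<forall>t z z'. dist (t, z) (rpt (0, x0)) < \<rho> \<longrightarrow>
      dist (t, z') (rpt (0, x0)) < \<rho> \<longrightarrow> cmod (?K i (t, z) - ?K i (t, z')) \<le> L i * cmod t * norm (z - z')"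
    by simp_all
  from choice[OF L(2)] obtain \<rho> where \<rho>: "\<forall>i. \<rho> i > 0 \<and> (\<forall>t z z'. dist (t, z) (rpt (0, x0)) < \<rho> i \<longrightarrow>
      dist (t, z') (rpt (0, x0)) < \<rho> i \<longrightarrow> cmod (?K i (t, z) - ?K i (t, z')) \<le> L i * cmod t * norm (z - z'))"
    by (rule exE)
  obtain \<sigma> where \<sigma>: "\<sigma> > 0" "\<And>q. dist q (0, x0) < \<sigma> \<Longrightarrow> \<forall>i. Rc i (rpt q) = of_real (R (fst q) (snd q) $ i)"
    using Rc_real[of x0] unfolding eventually_nhds_metric by blast
  \<comment> \<open>Half of the minimum, because step size and state are bounded separately and the
    two bounds add in the product distance.\<close>
  define \<delta> where "\<delta> = Min (insert \<sigma> (range \<rho>)) / 2"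
  have \<delta>: "\<delta> > 0" "2 * \<delta> \<le> \<sigma>" "\<And>i. 2 * \<delta> \<le> \<rho> i"
  proof -
    have "Min (insert \<sigma> (range \<rho>)) > 0" by (subst Min_gr_iff) (use \<sigma> \<rho> in auto)
    then show "\<delta> > 0" by (simp add: \<delta>_def)
    have "Min (insert \<sigma> (range \<rho>)) \<le> \<sigma>" "Min (insert \<sigma> (range \<rho>)) \<le> \<rho> i" for i
      by (rule Min_le; simp)+
    then show "2 * \<delta> \<le> \<sigma>" "\<And>i. 2 * \<delta> \<le> \<rho> i" by (simp_all only: \<delta>_def) simp_all
  qed
  have main: "norm ((R h x - x) - (R h y - y)) \<le> (\<Sum>i\<in>UNIV. L i) * \<bar>h\<bar> * norm (x - y)"
    if h: "\<bar>h\<bar> < \<delta>" and xy: "dist x x0 < \<delta>" "dist y x0 < \<delta>" for h x y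
  proof -
    have near: "dist (h, x) (0, x0) < 2 * \<delta>" if "dist x x0 < \<delta>" for x
      using norm_Pair_le[of h "x - x0"] h that by (simp add: dist_norm)
    have near': "dist (complex_of_real h, cvec x) (rpt (0, x0)) < 2 * \<delta>" if "dist x x0 < \<delta>" for x
      using near[OF that] dist_rpt[of "(h, x)" "(0, x0)"] by (simp add: rpt_def)
    have "norm ((R h x - x) - (R h y - y)) \<le> (\<Sum>i\<in>UNIV. \<bar>((R h x - x) - (R h y - y)) $ i\<bar>)"
      by (rule norm_le_l1_cart)
    also have "\<dots> \<le> (\<Sum>i\<in>UNIV. L i * \<bar>h\<bar> * norm (x - y))"
    proof (rule sum_mono)
      fix i
      have "of_real (R h x $ i) = Rc i (of_real h, cvec x)" "of_real (R h y $ i) = Rc i (of_real h, cvec y)"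
        using \<sigma>(2)[of "(h, x)"] \<sigma>(2)[of "(h, y)"] near[OF xy(1)] near[OF xy(2)] \<delta>(2) by (simp_all add: rpt_def)
      then have "complex_of_real (((R h x - x) - (R h y - y)) $ i) = ?K i (of_real h, cvec x) - ?K i (of_real h, cvec y)"
        by simp
      then have "\<bar>((R h x - x) - (R h y - y)) $ i\<bar> = cmod (?K i (of_real h, cvec x) - ?K i (of_real h, cvec y))"
        by (metis norm_of_real real_norm_def)
      also have "\<dots> \<le> L i * cmod (of_real h) * norm (cvec x - cvec y)"
      proof -
        have "dist (complex_of_real h, cvec x) (rpt (0, x0)) < \<rho> i" "dist (complex_of_real h, cvec y) (rpt (0, x0)) < \<rho> i"
          using near'[OF xy(1)] near'[OF xy(2)] \<delta>(3)[of i] by linarith+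
        then show ?thesis using \<rho> by blast
      qed
      finally show "\<bar>((R h x - x) - (R h y - y)) $ i\<bar> \<le> L i * \<bar>h\<bar> * norm (x - y)"
        by (simp flip: cvec_diff)
    qed
    finally show ?thesis by (simp add: sum_distrib_right)
  qed
  show ?thesis
    by (intro exI[of _ "\<Sum>i\<in>UNIV. L i"] exI[of _ \<delta>] conjI \<delta>(1) sum_nonneg L(1) allI impI main)
qed

text \<open>For \<open>y = R_{-h}^{-1}(x)\<close> the difference \<open>y - R_h(x)\<close> is
  \<open>y - R_h(R_{-h}(y))\<close>, so \<open>R_R_minus\<close> is applied at \<open>y\<close>
  instead of \<open>x\<close>. Its bound is therefore needed on all of \<open>U\<close>, which is
  fixed before \<open>h\<close>.\<close>

lemma R_pseudo_symmetric:
  assumes Im: "\<And>i. bigO_step x0 m (\<lambda>h x. Ic i (rpt (h, x)))"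
  shows "\<exists>U. open U \<and> x0 \<in> U \<and>
    (\<forall>\<^sub>F (h, x) in at 0 \<times>\<^sub>F nhds x0. inj_on (R (- h)) U \<and> x \<in> R (- h) ` U) \<and>
    bigO_step x0 (2 * m) (\<lambda>h x. adjoint_on U R h x - R h x)"
proof -
  obtain L \<delta> where L: "0 < \<delta>" "0 \<le> L" "\<And>h x y. \<bar>h\<bar> < \<delta> \<Longrightarrow> dist x x0 < \<delta> \<Longrightarrow> dist y x0 < \<delta> \<Longrightarrow>
    norm ((R h x - x) - (R h y - y)) \<le> L * \<bar>h\<bar> * norm (x - y)"
    using R_near_identity_Lipschitz[of x0] by blast
  obtain C where C: "eventually (\<lambda>q. norm (R (fst q) (R (- fst q) (snd q)) - snd q) \<le> C * \<bar>fst q\<bar> ^ (2 * m)) (at 0 \<times>\<^sub>F nhds x0)"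
    using R_R_minus[OF Im] unfolding bigO_step_iff by blast
  then obtain Pf Pg where P: "eventually Pf (at 0)" "eventually Pg (nhds x0)"
    "\<And>h x. Pf h \<Longrightarrow> Pg x \<Longrightarrow> norm (R h (R (- h) x) - x) \<le> C * \<bar>h\<bar> ^ (2 * m)"
    unfolding eventually_prod_filter by auto
  obtain \<gamma> where \<gamma>: "\<gamma> > 0" "\<And>x. dist x x0 < \<gamma> \<Longrightarrow> Pg x"
    using P(2) unfolding eventually_nhds_metric by blast
  \<comment> \<open>\<open>\<delta>\<close> secures the Lipschitz bound on \<open>U\<close>,
    \<open>\<gamma>\<close> the estimate of \<open>R_R_minus\<close> at every preimage in
    \<open>U\<close>.\<close>
  define \<rho> where "\<rho> = min \<delta> \<gamma>"
  have \<rho>: "\<rho> > 0" "\<rho> \<le> \<delta>" "\<rho> \<le> \<gamma>" using L(1) \<gamma>(1) by (auto simp: \<rho>_def)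
  define U where "U = ball x0 \<rho>"
  have "((\<lambda>h. R (- h) x0) \<longlongrightarrow> x0) (nhds 0)"
  proof -
    have "((\<lambda>h::real. (- h, x0)) \<longlongrightarrow> (- 0, x0)) (nhds 0)"
      by (intro tendsto_intros filterlim_ident)
    then have "((\<lambda>h::real. (- h, x0)) \<longlongrightarrow> (0, x0)) (nhds 0)" by simp
    from filterlim_compose[OF tendsto_R this] show ?thesis by simp
  qed
  then have "eventually (\<lambda>h. dist (R (- h) x0) x0 < \<rho> / 8) (nhds 0)"
    by (rule tendstoD) (use \<rho> in simp)
  then obtain \<eta> where \<eta>: "\<eta> > 0" "\<And>h. \<bar>h\<bar> < \<eta> \<Longrightarrow> dist (R (- h) x0) x0 < \<rho> / 8"
    unfolding eventually_nhds_metric by (auto simp: dist_norm)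
  \<comment> \<open>The last bound forces \<open>L * \<bar>h\<bar> \<le> 1/2\<close>;
    \<open>L + 1\<close> instead of \<open>L\<close> avoids a zero denominator.\<close>
  define \<theta> where "\<theta> = min (min \<eta> \<delta>) (1 / (2 * (L + 1)))"
  have \<theta>: "\<theta> > 0" "\<theta> \<le> \<eta>" "\<theta> \<le> \<delta>" "\<theta> \<le> 1 / (2 * (L + 1))"
    using \<eta>(1) L(1,2) by (auto simp: \<theta>_def)
  have inv: "inj_on (R (- h)) U" "dist x x0 < \<rho> / 8 \<Longrightarrow> x \<in> R (- h) ` U" if h: "\<bar>h\<bar> < \<theta>" for h x
  proof -
    have Lh: "L * \<bar>h\<bar> \<le> 1 / 2"
    proof -
      have "L * \<bar>h\<bar> \<le> (L + 1) * (1 / (2 * (L + 1)))"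
        using h \<theta>(4) L(2) by (intro mult_mono) auto
      also have "\<dots> = 1 / 2" using L(2) by (simp add: field_simps)
      finally show ?thesis .
    qed
    have lip: "norm ((R (- h) x - x) - (R (- h) y - y)) \<le> norm (x - y) / 2"
      if "dist x x0 < \<rho>" "dist y x0 < \<rho>" for x y
    proof -
      have "norm ((R (- h) x - x) - (R (- h) y - y)) \<le> L * \<bar>- h\<bar> * norm (x - y)"
        by (rule L(3)) (use h \<theta> \<rho> that in auto)
      also have "\<dots> \<le> 1 / 2 * norm (x - y)"
        using Lh by (intro mult_right_mono) auto
      finally show ?thesis by simp
    qed
    have small: "dist (R (- h) x0) x0 \<le> \<rho> / 8"
      using \<eta>(2)[of h] h \<theta> by simp
    show "inj_on (R (- h)) U" "dist x x0 < \<rho> / 8 \<Longrightarrow> x \<in> R (- h) ` U"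
      unfolding U_def using near_identity_inverse[of \<rho> x0 "R (- h)"] \<rho>(1) lip small by blast+
  qed
  have ev: "eventually (\<lambda>q. \<bar>fst q\<bar> < \<theta> \<and> Pf (fst q) \<and> dist (snd q) x0 < \<rho> / 8) (at 0 \<times>\<^sub>F nhds x0)"
  proof -
    have "eventually (\<lambda>h::real. \<bar>h\<bar> < \<theta> \<and> Pf h) (at 0)"
      by (rule eventually_conj[OF _ P(1)]) (use \<theta>(1) in \<open>auto simp: eventually_at dist_norm\<close>)
    moreover have "eventually (\<lambda>x. dist x x0 < \<rho> / 8) (nhds x0)"
      unfolding eventually_nhds_metric using \<rho>(1) by (intro exI[of _ "\<rho> / 8"]) auto
    ultimately show ?thesis
      unfolding eventually_prod_filter by fastforce
  qed
  show ?thesis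
  proof (intro exI[of _ U] conjI)
    show "open U" "x0 \<in> U" using \<rho>(1) by (simp_all add: U_def)
    show "\<forall>\<^sub>F (h, x) in at 0 \<times>\<^sub>F nhds x0. inj_on (R (- h)) U \<and> x \<in> R (- h) ` U"
      using ev by eventually_elim (auto simp: case_prod_unfold inv)
    have "eventually (\<lambda>q. norm (adjoint_on U R (fst q) (snd q) - R (fst q) (snd q)) \<le> C * \<bar>fst q\<bar> ^ (2 * m)) (at 0 \<times>\<^sub>F nhds x0)"
      using ev
    proof eventually_elim
      case (elim q)
      define y where "y = adjoint_on U R (fst q) (snd q)"
      have im: "snd q \<in> R (- fst q) ` U" using inv(2) elim by blast
      have y: "y \<in> U" "R (- fst q) y = snd q"
        unfolding y_def adjoint_on_def using inv_into_into[OF im] f_inv_into_f[OF im] by simp_all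
      then have "Pg y" using \<rho>(3) by (intro \<gamma>(2)) (simp add: U_def dist_commute)
      then have "norm (R (fst q) (R (- fst q) y) - y) \<le> C * \<bar>fst q\<bar> ^ (2 * m)"
        using P(3) elim by blast
      then show ?case using y by (simp add: y_def norm_minus_commute)
    qed
    then show "bigO_step x0 (2 * m) (\<lambda>h x. adjoint_on U R h x - R h x)"
      unfolding bigO_step_iff by blast
  qed
qed

end

section \<open>Pseudo-symplecticity\<close>

lemma bigO_step_mult:
  fixes E :: "real \<Rightarrow> 'a::topological_space \<Rightarrow> 'b::real_normed_field"
  assumes "bigO_step x0 k E" "bigO_step x0 l E'"
  shows "bigO_step x0 (k + l) (\<lambda>h x. E h x * E' h x)"
proof -
  obtain C where C: "eventually (\<lambda>q. norm (E (fst q) (snd q)) \<le> C * \<bar>fst q\<bar> ^ k) (at 0 \<times>\<^sub>F nhds x0)"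
    using assms(1) unfolding bigO_step_iff by blast
  obtain D where D: "eventually (\<lambda>q. norm (E' (fst q) (snd q)) \<le> D * \<bar>fst q\<bar> ^ l) (at 0 \<times>\<^sub>F nhds x0)"
    using assms(2) unfolding bigO_step_iff by blast
  from C D have "eventually (\<lambda>q. norm (E (fst q) (snd q) * E' (fst q) (snd q)) \<le> (C * D) * \<bar>fst q\<bar> ^ (k + l)) (at 0 \<times>\<^sub>F nhds x0)"
  proof eventually_elim
    case (elim q)
    have "norm (E (fst q) (snd q)) * norm (E' (fst q) (snd q)) \<le> (C * \<bar>fst q\<bar> ^ k) * (D * \<bar>fst q\<bar> ^ l)"
      using elim order_trans[OF norm_ge_zero elim(1)] by (intro mult_mono) auto
    then show ?case by (simp add: norm_mult power_add ac_simps)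
  qed
  then show ?thesis unfolding bigO_step_iff by blast
qed

lemma bigO_step_sum:
  assumes "finite I" "\<And>i. i \<in> I \<Longrightarrow> bigO_step x0 k (E i)"
  shows "bigO_step x0 k (\<lambda>h x. \<Sum>i\<in>I. E i h x)"
  using assms
proof (induction I rule: finite_induct)
  case empty
  show ?case unfolding bigO_step_iff by (intro exI[of _ 0]) simp
next
  case (insert i I)
  have "bigO_step x0 k (\<lambda>h x. E i h x + (\<Sum>i\<in>I. E i h x))"
    using insert by (intro bigO_step_add) auto
  then show ?case using insert by simp
qed

text \<open>On real arguments the imaginary part is constantly zero, hence so is its derivative, and
  the complex derivative in real directions is the real one.\<close>

lemma cdiff_real_restriction:
  assumes g: "cdiff g (rpt (h, x))" and eq: "eventually (\<lambda>y. g (rpt (h, y)) = of_real (F y)) (nhds x)"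
  shows "(F has_derivative (\<lambda>v. Re (cD g (rpt (h, x)) (0, cvec v)))) (at x)"
    and "of_real (Re (cD g (rpt (h, x)) (0, cvec v))) = cD g (rpt (h, x)) (0, cvec v)"
proof -
  have 1: "((\<lambda>y. rpt (h, y)) has_derivative (\<lambda>v. (0, cvec v))) (at x)"
    unfolding rpt_Pair
    by (intro has_derivative_Pair has_derivative_const bounded_linear_imp_has_derivative bounded_linear_cvec)
  have 2: "((\<lambda>y. g (rpt (h, y))) has_derivative (\<lambda>v. cD g (rpt (h, x)) (0, cvec v))) (at x)"
    by (rule has_derivative_compose[OF 1 cdiff_has_derivative[OF g]])
  obtain U where U: "open U" "x \<in> U" "\<And>y. y \<in> U \<Longrightarrow> g (rpt (h, y)) = of_real (F y)"
    using eq unfolding eventually_nhds by blast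
  have 3: "((\<lambda>y. complex_of_real (F y)) has_derivative (\<lambda>v. cD g (rpt (h, x)) (0, cvec v))) (at x)"
    by (rule has_derivative_transform_within_open[OF 2 U])
  show "(F has_derivative (\<lambda>v. Re (cD g (rpt (h, x)) (0, cvec v)))) (at x)"
    using has_derivative_Re[OF 3] by simp
  have "((\<lambda>y::real^'a. 0::real) has_derivative (\<lambda>v. Im (cD g (rpt (h, x)) (0, cvec v)))) (at x)"
    using has_derivative_Im[OF 3] by simp
  from has_derivative_unique[OF this has_derivative_const]
  have "Im (cD g (rpt (h, x)) (0, cvec v)) = 0" by metis
  then show "of_real (Re (cD g (rpt (h, x)) (0, cvec v))) = cD g (rpt (h, x)) (0, cvec v)"
    by (simp add: complex_eq_iff)
qed

text \<open>Jacobian in the state only, with the step size held fixed, to match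
  \<open>jacobian\<close> in \<open>symplectic_defect\<close>.\<close>

definition cjac :: "('d \<Rightarrow> complex \<times> (complex^'d) \<Rightarrow> complex) \<Rightarrow> complex \<times> (complex^'d) \<Rightarrow> complex^'d^'d"
  where "cjac g p = (\<chi> i k. cD (g i) p (0, axis k 1))"

definition cmat :: "real^'d^'d \<Rightarrow> complex^'d^'d" where "cmat J = (\<chi> k l. of_real (J $ k $ l))"

lemma cvec_axis: "cvec (axis k 1) = axis k 1"
  by (simp add: vec_eq_iff axis_def)

lemma cjac_real:
  fixes F :: "real^'d \<Rightarrow> real^'d"
  assumes g: "\<And>i. cdiff (g i) (rpt (h, x))"
    and eq: "\<And>i. eventually (\<lambda>y. g i (rpt (h, y)) = of_real (F y $ i)) (nhds x)"
  shows "cjac g (rpt (h, x)) = cmat (jacobian F (at x))"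
proof -
  have "(F has_derivative (\<lambda>v. \<chi> i. Re (cD (g i) (rpt (h, x)) (0, cvec v)))) (at x)"
    by (rule has_derivative_vec_nthI) (rule cdiff_real_restriction(1)[OF g eq])
  then have "frechet_derivative F (at x) = (\<lambda>v. \<chi> i. Re (cD (g i) (rpt (h, x)) (0, cvec v)))"
    by (rule frechet_derivative_at[symmetric])
  then show ?thesis
    by (simp add: cjac_def cmat_def jacobian_def matrix_def vec_eq_iff cvec_axis
        cdiff_real_restriction(2)[OF g eq, of _ "axis _ 1", unfolded cvec_axis])
qed

lemma cmat_mult: "cmat (A ** B) = cmat A ** cmat B"
  by (simp add: cmat_def matrix_matrix_mult_def vec_eq_iff)

lemma cmat_transpose: "cmat (transpose A) = transpose (cmat A)"
  by (simp add: cmat_def transpose_def vec_eq_iff)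

lemma cD_0_expand:
  assumes "cdiff g p"
  shows "cD g p (0, v) = (\<Sum>j\<in>UNIV. cD g p (0, axis j 1) * v $ j)"
proof -
  have "(0, v) = (\<Sum>j\<in>UNIV. cscale (v $ j) (0, axis j 1))"
    by (simp add: cscale_def prod_eq_iff fst_sum snd_sum vec_eq_iff axis_def if_distrib sum.delta cong: if_cong)
  then have "cD g p (0, v) = (\<Sum>j\<in>UNIV. cD g p (cscale (v $ j) (0, axis j 1)))"
    by (simp only: linear_sum[OF linear_cD[OF assms]])
  then show ?thesis
    by (simp add: cdiff_cD_cscale[OF assms] mult.commute)
qed

context analytic_reversible
begin

text \<open>With the plain transpose, as opposed to the conjugate one, the entries are polynomials
  in first derivatives of \<open>Sc\<close>, hence holomorphic, and the identity theorem carries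
  symplecticity to complex points.\<close>

lemma Sc_symplectic:
  assumes symp: "symplectic_integrator J S"
  shows "eventually (\<lambda>p. transpose (cjac (\<lambda>i p. Sc (fst p) (snd p) $ i) p) ** cmat J
    ** cjac (\<lambda>i p. Sc (fst p) (snd p) $ i) p = cmat J) (nhds (rpt (0, x)))"
proof -
  let ?g = "\<lambda>i p. Sc (fst p) (snd p) $ i"
  let ?M = "\<lambda>p. transpose (cjac ?g p) ** cmat J ** cjac ?g p"
  have real: "eventually (\<lambda>q. ?M (rpt q) = cmat J) (nhds (0, x))"
  proof -
    have "eventually (\<lambda>p. \<forall>i. cdiff (?g i) p) (nhds (rpt (0, x)))"
      by (rule eventually_all_finite) (rule hol_at_Sc[unfolded hol_at_def])
    from eventually_compose_filterlim[OF this tendsto_rpt]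
    have 1: "eventually (\<lambda>q. \<forall>i. cdiff (?g i) (rpt q)) (nhds (0, x))" .
    \<comment> \<open>Differentiating the equality of \<open>Sc\<close> and \<open>S\<close> takes
      its validity in a neighbourhood of each nearby point.\<close>
    have 2: "eventually (\<lambda>q. eventually (\<lambda>q. Sc (of_real (fst q)) (cvec (snd q)) = cvec (S (fst q) (snd q))) (nhds q)) (nhds (0, x))"
      using Sc_real[of x] by (simp add: eventually_eventually)
    have 3: "eventually (\<lambda>q. symplectic_defect J S (fst q) (snd q) = 0) (nhds (0, x))"
      using symp[unfolded symplectic_integrator_def, THEN spec, of x]
      by (auto simp: nhds_prod case_prod_unfold elim: eventually_mono)
    from 1 2 3 show ?thesis
    proof eventually_elim
      case (elim q)
      obtain h y where q: "q = (h, y)" by (cases q)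
      have "((\<lambda>y. (h, y)) \<longlongrightarrow> (h, y)) (nhds y)"
        by (intro tendsto_Pair filterlim_ident tendsto_const)
      from eventually_compose_filterlim[OF elim(2)[unfolded q] this]
      have "eventually (\<lambda>y. ?g i (rpt (h, y)) = of_real (S h y $ i)) (nhds y)" for i
        by eventually_elim (simp add: rpt_def)
      then have "cjac ?g (rpt (h, y)) = cmat (jacobian (S h) (at y))"
        using elim(1) by (intro cjac_real) (auto simp: q)
      moreover have "transpose (jacobian (S h) (at y)) ** J ** jacobian (S h) (at y) = J"
        using elim(3) by (simp add: q symplectic_defect_def)
      ultimately show ?case
        by (simp add: q flip: cmat_mult cmat_transpose)
    qed
  qed
  have "eventually (\<lambda>p. ?M p $ k $ l = cmat J $ k $ l) (nhds (rpt (0, x)))" for k l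
  proof (rule identity_real_points_eq)
    have "hol_at (\<lambda>p. \<Sum>b\<in>UNIV. (\<Sum>a\<in>UNIV. cD (?g a) p (0, axis k 1) * cmat J $ a $ b) * cD (?g b) p (0, axis l 1)) (rpt (0, x))"
      by (intro hol_at_sum hol_at_mult hol_at_cD hol_at_Sc hol_at_const)
    then show "hol_at (\<lambda>p. ?M p $ k $ l) (rpt (0, x))"
      by (simp add: matrix_matrix_mult_def transpose_def cjac_def)
    show "hol_at (\<lambda>p. cmat J $ k $ l) (rpt (0, x))" by (rule hol_at_const)
    show "eventually (\<lambda>q. ?M (rpt q) $ k $ l = cmat J $ k $ l) (nhds (0, x))"
      using real by eventually_elim simp
  qed
  then have "eventually (\<lambda>p. \<forall>k. \<forall>l. ?M p $ k $ l = cmat J $ k $ l) (nhds (rpt (0, x)))"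
    by (intro eventually_all_finite)
  then show ?thesis
    by eventually_elim (intro iffD2[OF vec_eq_iff] allI, blast)
qed

text \<open>By the chain rule the Jacobians multiply, since the step-size argument is constant in
  state directions, and each factor preserves \<open>cmat J\<close>.\<close>

lemma compC_symplectic:
  assumes symp: "symplectic_integrator J S"
  shows "eventually (\<lambda>p. transpose (cjac (\<lambda>i p. compC Sc \<alpha> k p $ i) p) ** cmat J
    ** cjac (\<lambda>i p. compC Sc \<alpha> k p $ i) p = cmat J) (nhds (rpt (0, x)))"
proof (induction k)
  case 0
  have "cD (\<lambda>p. snd p $ i) p = (\<lambda>p. snd p $ i)" for i and p :: "complex \<times> (complex^'d)"
    by (rule frechet_derivative_at[symmetric], rule bounded_linear_imp_has_derivative)
      (rule bounded_linear_compose[OF bounded_linear_vec_nth bounded_linear_snd])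
  then have "cjac (\<lambda>i p. snd p $ i) p = mat 1" for p :: "complex \<times> (complex^'d)"
    by (simp add: cjac_def mat_def axis_def vec_eq_iff)
  then show ?case by simp
next
  case (Suc k)
  let ?g = "\<lambda>i p. Sc (fst p) (snd p) $ i"
  let ?V = "compC Sc \<alpha> k"
  let ?a = "\<lambda>p. \<alpha> (Suc k) * fst p"
  have t: "((\<lambda>p. (?a p, ?V p)) \<longlongrightarrow> rpt (0, x)) (nhds (rpt (0, x)))"
    by (rule tendsto_compC)
  have "eventually (\<lambda>p. \<forall>i. cdiff (?g i) p) (nhds (rpt (0, x)))"
    by (rule eventually_all_finite) (rule hol_at_Sc[unfolded hol_at_def])
  from eventually_compose_filterlim[OF this t]
  have 1: "eventually (\<lambda>p. \<forall>i. cdiff (?g i) (?a p, ?V p)) (nhds (rpt (0, x)))" .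
  have 2: "eventually (\<lambda>p. \<forall>i. cdiff (\<lambda>p. ?V p $ i) p) (nhds (rpt (0, x)))"
    by (rule eventually_all_finite) (rule hol_at_compC[unfolded hol_at_def])
  show ?case
    using 1 2 eventually_compose_filterlim[OF Sc_symplectic[OF symp] t] Suc
  proof eventually_elim
    case (elim p)
    let ?A = "cjac ?g (?a p, ?V p)"
    let ?B = "cjac (\<lambda>i p. ?V p $ i) p"
    have ca: "cdiff ?a p" by (rule cdiff_cmult(1)[OF cdiff_fst])
    have "cD fst p = fst" for p :: "complex \<times> (complex^'d)"
      by (rule frechet_derivative_at[symmetric]) (intro bounded_linear_imp_has_derivative bounded_linear_fst)
    then have cDa: "cD ?a p (0, v) = 0" for v
      by (simp add: cdiff_cmult(2)[OF cdiff_fst])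
    have "cjac (\<lambda>i p. compC Sc \<alpha> (Suc k) p $ i) p = ?A ** ?B"
    proof -
      have e: "cD (\<lambda>p. compC Sc \<alpha> (Suc k) p $ i) p (0, axis l 1) = (\<Sum>j\<in>UNIV. ?A $ i $ j * ?B $ j $ l)" for i l
      proof -
        have "cD (\<lambda>p. ?g i (?a p, ?V p)) p (0, axis l 1)
            = cD (?g i) (?a p, ?V p) (0, \<chi> j. cD (\<lambda>p. ?V p $ j) p (0, axis l 1))"
          using cdiff_compose(2)[of "?g i" ?a p ?V] elim(1,2) ca by (simp add: cDa)
        also have "\<dots> = (\<Sum>j\<in>UNIV. ?A $ i $ j * ?B $ j $ l)"
          by (subst cD_0_expand) (use elim(1) in \<open>auto simp: cjac_def\<close>)
        finally show ?thesis by simp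
      qed
      show ?thesis
        unfolding matrix_matrix_mult_def
        by (intro iffD2[OF vec_eq_iff] allI)
          (simp only: vec_lambda_beta cjac_def[of "\<lambda>i p. compC Sc \<alpha> (Suc k) p $ i"] e)
    qed
    then have "transpose (cjac (\<lambda>i p. compC Sc \<alpha> (Suc k) p $ i) p) ** cmat J ** cjac (\<lambda>i p. compC Sc \<alpha> (Suc k) p $ i) p
        = transpose ?B ** (transpose ?A ** cmat J ** ?A) ** ?B"
      by (simp only: matrix_transpose_mul matrix_mul_assoc)
    then show ?case using elim(3,4) by simp
  qed
qed

end

context symmetric_conjugate
begin

text \<open>The real part of \<open>(DR + \<i> DI)\<^sup>T J (DR + \<i> DI) = J\<close> is \<open>DR\<^sup>T J DR - DI\<^sup>T J DI = J\<close>.\<close>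

lemma R_pseudo_symplectic:
  assumes symp: "symplectic_integrator J S" and Im: "\<And>i. bigO_step x0 m (\<lambda>h x. Ic i (rpt (h, x)))"
  shows "bigO_step x0 (2 * m) (symplectic_defect J R)"
proof -
  let ?B = "\<lambda>a k h x. cD (Ic a) (rpt (h, x)) (0, axis k 1)"
  \<comment> \<open>Differentiation in the state does not lower the order in the step size, by
    \<open>order_cD\<close>.\<close>
  have dI: "bigO_step x0 m (?B a k)" for a k
  proof -
    obtain C where C: "eventually (\<lambda>q. cmod (Ic a (rpt q)) \<le> C * \<bar>fst q\<bar> ^ m) (at 0 \<times>\<^sub>F nhds x0)"
      using Im[of a] unfolding bigO_step_iff by auto
    obtain c B where B: "0 \<le> B"
      "eventually (\<lambda>p. cmod (Ic a p) \<le> B * cmod (fst p) ^ m) (nhds (rpt (0, x0)))"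
      "eventually (\<lambda>p. cmod (Ic a p - c (snd p) * fst p ^ m) \<le> B * cmod (fst p) ^ (m + 1)) (nhds (rpt (0, x0)))"
      by (rule order_complex_points[OF hol_at_Ic C])
    obtain \<rho> C where \<rho>: "0 < \<rho>" "0 \<le> C"
      "\<And>p v. dist p (rpt (0, x0)) < \<rho> \<Longrightarrow> cdiff (Ic a) p"
      "\<And>p v. dist p (rpt (0, x0)) < \<rho> \<Longrightarrow> cmod (cD (Ic a) p (0, v)) \<le> C * cmod (fst p) ^ m * norm v"
      by (rule order_cD[OF hol_at_Ic B(1,2)]) blast
    show ?thesis
    proof (rule bigO_step_nhdsI[where B = C])
      show "eventually (\<lambda>q. norm (?B a k (fst q) (snd q)) \<le> C * \<bar>fst q\<bar> ^ m) (nhds (0, x0))"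
        using tendstoD[OF tendsto_rpt[of "(0, x0)"] \<rho>(1)]
      proof eventually_elim
        case (elim q)
        have "norm (axis k (1::complex) :: complex^'d) = 1" by (metis cvec_axis norm_cvec norm_axis_1)
        with \<rho>(4)[OF elim, of "axis k 1"] show ?case by (simp add: rpt_def)
      qed
    qed
  qed
  have entry: "bigO_step x0 (2 * m) (\<lambda>h x. symplectic_defect J R h x $ k $ l)" for k l
  proof -
    have "bigO_step x0 (m + m) (\<lambda>h x. \<Sum>b\<in>UNIV. \<Sum>a\<in>UNIV. (of_real (J $ a $ b) * ?B a k h x) * ?B b l h x)"
      by (intro bigO_step_sum finite bigO_step_mult bigO_step_cmult dI)
    then have D: "bigO_step x0 (2 * m) (\<lambda>h x. \<Sum>b\<in>UNIV. \<Sum>a\<in>UNIV. (of_real (J $ a $ b) * ?B a k h x) * ?B b l h x)"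
      by (simp add: mult_2)
    have cd: "eventually (\<lambda>p. \<forall>i. cdiff (Rc i) p \<and> cdiff (Ic i) p) (nhds (rpt (0, x0)))"
      using hol_at_Rc hol_at_Ic unfolding hol_at_def by (intro eventually_all_finite eventually_conj)
    have rR: "eventually (\<lambda>q. eventually (\<lambda>q. \<forall>i. Rc i (rpt q) = of_real (R (fst q) (snd q) $ i)) (nhds q)) (nhds (0, x0))"
      using Rc_real[of x0] by (simp add: eventually_eventually)
    have rI: "eventually (\<lambda>q. eventually (\<lambda>q. \<forall>i. Ic i (rpt q) \<in> \<real>) (nhds q)) (nhds (0, x0))"
      using Ic_real[of x0] by (simp add: eventually_eventually)
    have "eventually (\<lambda>q. norm (symplectic_defect J R (fst q) (snd q) $ k $ l)
        \<le> norm (\<Sum>b\<in>UNIV. \<Sum>a\<in>UNIV. (of_real (J $ a $ b) * ?B a k (fst q) (snd q)) * ?B b l (fst q) (snd q))) (nhds (0, x0))"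
      using eventually_compose_filterlim[OF compC_symplectic[OF symp, of \<alpha> s x0] tendsto_rpt]
        eventually_compose_filterlim[OF cd tendsto_rpt] rR rI
    proof eventually_elim
      case (elim q)
      obtain h x where q: "q = (h, x)" by (cases q)
      define A where "A = jacobian (R h) (at x)"
      define K where "K = (\<chi> i k. Re (?B i k h x))"
      have t: "((\<lambda>y. (h, y)) \<longlongrightarrow> (h, x)) (nhds x)"
        by (intro tendsto_Pair filterlim_ident tendsto_const)
      have "eventually (\<lambda>y. Rc i (rpt (h, y)) = of_real (R h y $ i)) (nhds x)" for i
        using eventually_compose_filterlim[OF elim(3)[unfolded q] t] by eventually_elim simp
      then have jR: "cjac Rc (rpt (h, x)) = cmat A"
        unfolding A_def using elim(2) by (intro cjac_real) (auto simp: q)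
      have eqI: "eventually (\<lambda>y. Ic i (rpt (h, y)) = of_real (Re (Ic i (rpt (h, y))))) (nhds x)" for i
        using eventually_compose_filterlim[OF elim(4)[unfolded q] t] by eventually_elim simp
      have jI: "?B i k h x = of_real (K $ i $ k)" for i k
        using cdiff_real_restriction(2)[OF _ eqI[of i], of "axis k 1"] elim(2) by (simp add: q cvec_axis K_def)
      have j\<psi>: "cjac (\<lambda>i p. \<psi> p $ i) (rpt (h, x)) $ i $ k = of_real (A $ i $ k) + \<i> * of_real (K $ i $ k)" for i k
      proof -
        have c: "cdiff (Rc i) (rpt (h, x))" "cdiff (Ic i) (rpt (h, x))" using elim(2) by (auto simp: q)
        have "cD (\<lambda>p. Rc i p + \<i> * Ic i p) (rpt (h, x)) (0, axis k 1)
            = cD (Rc i) (rpt (h, x)) (0, axis k 1) + \<i> * cD (Ic i) (rpt (h, x)) (0, axis k 1)"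
          by (simp only: cdiff_add(2)[OF c(1) cdiff_cmult(1)[OF c(2)]] cdiff_cmult(2)[OF c(2)])
        moreover have "cD (Rc i) (rpt (h, x)) (0, axis k 1) = of_real (A $ i $ k)"
          using arg_cong[OF jR, of "\<lambda>M. M $ i $ k"] by (simp add: cjac_def cmat_def)
        ultimately show ?thesis by (simp add: cjac_def \<psi>_eq jI)
      qed
      have "(transpose (cjac (\<lambda>i p. \<psi> p $ i) (rpt (h, x))) ** cmat J ** cjac (\<lambda>i p. \<psi> p $ i) (rpt (h, x))) $ k $ l = cmat J $ k $ l"
        using elim(1) by (simp add: q)
      then have "(\<Sum>b\<in>UNIV. (\<Sum>a\<in>UNIV. (of_real (A $ a $ k) + \<i> * of_real (K $ a $ k)) * of_real (J $ a $ b))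
          * (of_real (A $ b $ l) + \<i> * of_real (K $ b $ l))) = complex_of_real (J $ k $ l)"
        by (simp add: matrix_matrix_mult_def transpose_def j\<psi> cmat_def)
      \<comment> \<open>\<open>A\<close>, \<open>K\<close> and \<open>J\<close> are real, so the
        mixed terms are imaginary and drop out; the square of \<open>\<i>\<close> gives the minus
        sign.\<close>
      from arg_cong[OF this, of Re]
      have "(\<Sum>b\<in>UNIV. (\<Sum>a\<in>UNIV. A $ a $ k * J $ a $ b) * A $ b $ l) - (\<Sum>b\<in>UNIV. (\<Sum>a\<in>UNIV. K $ a $ k * J $ a $ b) * K $ b $ l) = J $ k $ l"
        by (simp add: sum_subtractf)
      then have "symplectic_defect J R h x $ k $ l = (\<Sum>b\<in>UNIV. (\<Sum>a\<in>UNIV. K $ a $ k * J $ a $ b) * K $ b $ l)"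
        unfolding symplectic_defect_def A_def[symmetric]
        by (simp add: matrix_matrix_mult_def transpose_def)
      then have "complex_of_real (symplectic_defect J R h x $ k $ l)
          = (\<Sum>b\<in>UNIV. \<Sum>a\<in>UNIV. (of_real (J $ a $ b) * ?B a k h x) * ?B b l h x)"
        by (simp add: jI sum_distrib_left sum_distrib_right ac_simps)
      then have "cmod (complex_of_real (symplectic_defect J R h x $ k $ l))
          = cmod (\<Sum>b\<in>UNIV. \<Sum>a\<in>UNIV. (of_real (J $ a $ b) * ?B a k h x) * ?B b l h x)"
        by (rule arg_cong)
      then show ?case by (simp add: q)
    qed
    from filter_leD[OF at_le_nhds this] show ?thesis
      by (rule bigO_step_cong[OF D])
  qed
  show ?thesis
    by (intro bigO_step_vecI entry)
qed

end

section \<open>Smoothness\<close>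

lemma Ck_on_cong:
  assumes "open U" "\<And>z. z \<in> U \<Longrightarrow> g z = g' z" "Ck_on k U g"
  shows "Ck_on k U g'"
  using assms(2,3)
proof (induction k arbitrary: g g')
  case 0
  then show ?case by (simp cong: continuous_on_cong)
next
  case (Suc k)
  have d: "(g' has_derivative frechet_derivative g (at z)) (at z)" if "z \<in> U" for z
  proof -
    have "(g has_derivative frechet_derivative g (at z)) (at z)"
      using Suc.prems(2) that by (simp add: frechet_derivative_works)
    then show ?thesis
      by (rule has_derivative_transform_within_open[OF _ assms(1) that]) (rule Suc.prems(1))
  qed
  have "Ck_on k U (\<lambda>z. frechet_derivative g' (at z) v)" for v
  proof (rule Suc.IH)
    show "Ck_on k U (\<lambda>z. frechet_derivative g (at z) v)" using Suc.prems(2) by simp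
    show "frechet_derivative g (at z) v = frechet_derivative g' (at z) v" if "z \<in> U" for z
      using frechet_derivative_at[OF d[OF that]] by metis
  qed
  then show ?case using differentiableI[OF d] by simp
qed

lemma has_derivative_Re_cdiff:
  assumes "\<And>i. cdiff (g i) (rpt q)"
  shows "((\<lambda>q. \<chi> i. Re (g i (rpt q))) has_derivative (\<lambda>v. \<chi> i. Re (cD (g i) (rpt q) (rpt v)))) (at q)"
proof (rule has_derivative_vec_nthI)
  fix i
  have "((\<lambda>q. g i (rpt q)) has_derivative (\<lambda>v. cD (g i) (rpt q) (rpt v))) (at q)"
    by (rule has_derivative_compose[OF bounded_linear_imp_has_derivative[OF bounded_linear_rpt]
          cdiff_has_derivative[OF assms]])
  from has_derivative_Re[OF this]
  show "((\<lambda>q. (\<chi> i. Re (g i (rpt q))) $ i) has_derivative (\<lambda>v. Re (cD (g i) (rpt q) (rpt v)))) (at q)"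
    by simp
qed

text \<open>A directional derivative has the same form with
  \<open>p \<mapsto> cD (g i) p (rpt v)\<close> in place of \<open>g i\<close>, again complex
  differentiable on \<open>W\<close> by \<open>hol_at_cD\<close>; hence the induction over all
  \<open>g\<close>.\<close>

lemma Ck_on_Re_cdiff:
  fixes g :: "'d \<Rightarrow> complex \<times> (complex^'d) \<Rightarrow> complex"
  assumes "open W" "open U" and sub: "\<And>q. q \<in> U \<Longrightarrow> rpt q \<in> W"
    and "\<And>i p. p \<in> W \<Longrightarrow> cdiff (g i) p"
  shows "Ck_on k U (\<lambda>q. \<chi> i. Re (g i (rpt q)))"
  using assms(4)
proof (induction k arbitrary: g)
  case base: 0
  have "isCont (\<lambda>q. \<chi> i. Re (g i (rpt q))) q" if "q \<in> U" for q
    by (rule has_derivative_continuous[OF has_derivative_Re_cdiff]) (rule base[OF sub[OF that]])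
  then show ?case by (simp add: continuous_at_imp_continuous_on)
next
  case (Suc k)
  have d: "((\<lambda>q. \<chi> i. Re (g i (rpt q))) has_derivative (\<lambda>v. \<chi> i. Re (cD (g i) (rpt q) (rpt v)))) (at q)"
    if "q \<in> U" for q
    by (rule has_derivative_Re_cdiff) (rule Suc.prems[OF sub[OF that]])
  have "Ck_on k U (\<lambda>q. frechet_derivative (\<lambda>q. \<chi> i. Re (g i (rpt q))) (at q) v)" for v
  proof (rule Ck_on_cong[OF assms(2)])
    show "Ck_on k U (\<lambda>q. \<chi> i. Re ((\<lambda>i p. cD (g i) p (rpt v)) i (rpt q)))"
    proof (rule Suc.IH)
      fix i p assume "p \<in> W"
      then have "hol_at (g i) p"
        unfolding hol_at_def eventually_nhds using assms(1) Suc.prems by blast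
      from hol_at_cdiff[OF hol_at_cD[OF this]] show "cdiff (\<lambda>p. cD (g i) p (rpt v)) p" .
    qed
    show "(\<chi> i. Re (cD (g i) (rpt q) (rpt v))) = frechet_derivative (\<lambda>q. \<chi> i. Re (g i (rpt q))) (at q) v"
      if "q \<in> U" for q
      using frechet_derivative_at[OF d[OF that]] by metis
  qed
  then show ?case using differentiableI[OF d] by simp
qed

context symmetric_conjugate
begin

lemma R_smooth: "smooth_integrator R"
  unfolding smooth_integrator_def
proof
  fix x0
  have "eventually (\<lambda>p. \<forall>i. cdiff (Rc i) p) (nhds (rpt (0, x0)))"
    by (rule eventually_all_finite) (rule hol_at_Rc[unfolded hol_at_def])
  then obtain W where W: "open W" "rpt (0, x0) \<in> W" "\<And>p i. p \<in> W \<Longrightarrow> cdiff (Rc i) p"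
    unfolding eventually_nhds by blast
  obtain V where V: "open V" "(0, x0) \<in> V" "\<And>q i. q \<in> V \<Longrightarrow> Rc i (rpt q) = of_real (R (fst q) (snd q) $ i)"
    using Rc_real[of x0] unfolding eventually_nhds by blast
  define U where "U = rpt -` W \<inter> V"
  have U: "open U" "(0, x0) \<in> U"
    unfolding U_def using W V
    by (auto intro!: open_Int open_vimage linear_continuous_on bounded_linear_rpt)
  have "Ck_on k U (\<lambda>(h, x). R h x)" for k
  proof (rule Ck_on_cong[OF U(1)])
    show "Ck_on k U (\<lambda>q. \<chi> i. Re (Rc i (rpt q)))"
      by (rule Ck_on_Re_cdiff[OF W(1) U(1) _ W(3)]) (simp add: U_def)
    show "(\<chi> i. Re (Rc i (rpt q))) = (case q of (h, x) \<Rightarrow> R h x)" if "q \<in> U" for q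
      using V(3)[of q] that by (simp add: U_def split_beta vec_eq_iff)
  qed
  then show "\<exists>U. open U \<and> (0, x0) \<in> U \<and> smooth_on U (\<lambda>(h, x). R h x)"
    unfolding smooth_on_def using U by blast
qed

text \<open>Serves both parities, with \<open>k = 2n\<close> and \<open>m = 2n\<close> or
  \<open>m = 2n + 2\<close>; \<open>q + 1\<close> is the exponent in the two definitions of
  pseudo-order.\<close>

lemma R_properties:
  assumes order: "\<And>x0. bigO_step x0 (k + 1) (\<lambda>h x. R h x - \<phi> h x)" and "1 \<le> k"
    and Im: "\<And>x0 i. bigO_step x0 m (\<lambda>h x. Ic i (rpt (h, x)))" and q: "q + 1 = 2 * m"
  shows "has_order \<phi> k R" "pseudo_symmetric \<phi> q R"
    "symplectic_integrator J S \<Longrightarrow> pseudo_symplectic J \<phi> q R"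
proof -
  show "has_order \<phi> k R" using order by (simp add: has_order_def)
  have 1: "has_order \<phi> 1 R"
    unfolding has_order_def using bigO_step_mono[OF order] assms(2) by simp
  show "pseudo_symmetric \<phi> q R"
    unfolding pseudo_symmetric_def q using R_smooth 1 R_pseudo_symmetric[OF Im] by blast
  assume "symplectic_integrator J S"
  then show "pseudo_symplectic J \<phi> q R"
    unfolding pseudo_symplectic_def q using R_smooth 1 R_pseudo_symplectic[OF _ Im] by blast
qed

end

text \<open>Orders do not see step size zero. But \<open>S h x\<close> tends to \<open>S 0 x\<close>
  by continuity of \<open>Sc\<close>, and to \<open>x\<close> because it is within
  \<open>O(h^3)\<close> of the flow.\<close>

lemma basic_method_at_0:
  assumes flow: "exact_flow f \<phi>" and order: "has_order \<phi> 2 S" and ext: "complex_extension S Sc"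
  shows "S 0 x = x"
proof -
  obtain W where W: "open W" "(0, cvec x) \<in> W" "holomorphic_map W (\<lambda>(h, z). Sc h z)"
    "\<And>h x. (complex_of_real h, cvec x) \<in> W \<Longrightarrow> Sc (complex_of_real h) (cvec x) = cvec (S h x)"
    using ext unfolding complex_extension_def by blast
  obtain D where "((\<lambda>(h, z). Sc h z) has_derivative D) (at (0, cvec x))"
    using W(2,3) unfolding holomorphic_map_def by blast
  then have "isCont (\<lambda>(h, z). Sc h z) (rpt (0, x))"
    unfolding rpt_0 by (rule has_derivative_continuous)
  then have c: "((\<lambda>p. Sc (fst p) (snd p)) \<longlongrightarrow> Sc 0 (cvec x)) (nhds (rpt (0, x)))"
    by (simp add: isCont_def tendsto_nhds_iff case_prod_unfold rpt_0)
  have t0: "((\<lambda>h::real. (h, x)) \<longlongrightarrow> (0, x)) (nhds 0)"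
    by (intro tendsto_Pair filterlim_ident tendsto_const)
  have t: "((\<lambda>h. rpt (h, x)) \<longlongrightarrow> rpt (0, x)) (at 0)"
    using filterlim_compose[OF tendsto_rpt t0] by (simp add: tendsto_nhds_iff)
  have lim: "((\<lambda>h. vec_Re (Sc (fst (rpt (h, x))) (snd (rpt (h, x))))) \<longlongrightarrow> vec_Re (Sc 0 (cvec x))) (at 0)"
    by (rule tendsto_vec_Re[OF filterlim_compose[OF c t]])
  have at_0: "vec_Re (Sc 0 (cvec x)) = S 0 x"
    using W(4)[of 0 x] W(2) by simp
  have near: "eventually (\<lambda>h. vec_Re (Sc (fst (rpt (h, x))) (snd (rpt (h, x)))) = S h x) (at 0)"
  proof -
    have "eventually (\<lambda>p. p \<in> W) (nhds (rpt (0, x)))"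
      using W by (intro eventually_nhds_in_open) (auto simp: rpt_0)
    from eventually_compose_filterlim[OF this t] show ?thesis
      by eventually_elim (simp add: rpt_def W(4))
  qed
  have S: "((\<lambda>h. S h x) \<longlongrightarrow> S 0 x) (at 0)"
    using Lim_transform_eventually[OF lim near] by (simp only: at_0)
  have \<phi>0: "\<phi> 0 x = x" using flow unfolding exact_flow_def by blast
  have "eventually (\<lambda>q. ((\<lambda>s. \<phi> s (snd q)) has_vector_derivative f (\<phi> (fst q) (snd q))) (at (fst q))) (nhds (0, x))"
    using flow[unfolded exact_flow_def, THEN conjunct2, THEN spec, of x]
    by (simp add: nhds_prod case_prod_unfold)
  from eventually_nhds_x_imp_x[OF this] have "isCont (\<lambda>s. \<phi> s x) 0"
    unfolding has_vector_derivative_def by (simp add: has_derivative_continuous)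
  then have \<phi>: "((\<lambda>h. \<phi> h x) \<longlongrightarrow> x) (at 0)"
    by (simp add: isCont_def \<phi>0)
  obtain C where ev: "eventually (\<lambda>h. norm (S h x - \<phi> h x) \<le> C * \<bar>h\<bar> ^ 3) (at 0)"
    using bigO_step_at_point[of x 3 "\<lambda>h x. S h x - \<phi> h x"] order by (auto simp: has_order_def)
  have "((\<lambda>h. S h x - \<phi> h x) \<longlongrightarrow> 0) (at 0)"
  proof (rule Lim_null_comparison[OF ev])
    have "((\<lambda>h. C * \<bar>h\<bar> ^ 3) \<longlongrightarrow> C * \<bar>0::real\<bar> ^ 3) (at 0)" by (intro tendsto_intros)
    then show "((\<lambda>h::real. C * \<bar>h\<bar> ^ 3) \<longlongrightarrow> 0) (at 0)" by simp
  qed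
  from tendsto_add[OF this \<phi>] have "((\<lambda>h. S h x) \<longlongrightarrow> x) (at 0)" by simp
  from tendsto_unique[OF at_neq_bot S this] show ?thesis .
qed

theorem proposition2:
  fixes f :: "real^'d \<Rightarrow> real^'d"
    and \<phi> S :: "real \<Rightarrow> real^'d \<Rightarrow> real^'d"
    and Sc :: "complex \<Rightarrow> complex^'d \<Rightarrow> complex^'d"
    and \<alpha> :: "nat \<Rightarrow> complex"
    and s r n :: nat
  assumes "smooth_on UNIV f"
    and "exact_flow f \<phi>"
    and "has_order \<phi> 2 S"
    and "time_symmetric S"
    and "complex_extension S Sc"
    and "\<And>j. j \<in> {1..s} \<Longrightarrow> \<alpha> (s + 1 - j) = cnj (\<alpha> j)"
    and "has_order (\<lambda>h x. cvec (\<phi> h x)) r (\<lambda>h x. composition Sc \<alpha> s h (cvec x))"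
    and "r \<ge> 3"
    and "n \<ge> 2"
  shows
    "(r = 2 * n - 1 \<longrightarrow>
        has_order \<phi> (2 * n) (real_part_method Sc \<alpha> s) \<and> pseudo_symmetric \<phi> (4 * n - 1) (real_part_method Sc \<alpha> s) \<and>
        (\<forall>m e. bij_betw e {..<2 * m} (UNIV :: 'd set) \<longrightarrow>
           hamiltonian_field (canonical_J m e) f \<longrightarrow>
           symplectic_integrator (canonical_J m e) S \<longrightarrow>
           pseudo_symplectic (canonical_J m e) \<phi> (4 * n - 1) (real_part_method Sc \<alpha> s))) \<and>
     (r = 2 * n \<longrightarrow>
        has_order \<phi> (2 * n) (real_part_method Sc \<alpha> s) \<and> pseudo_symmetric \<phi> (4 * n + 3) (real_part_method Sc \<alpha> s) \<and>
        (\<forall>m e. bij_betw e {..<2 * m} (UNIV :: 'd set) \<longrightarrow>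
           hamiltonian_field (canonical_J m e) f \<longrightarrow>
           symplectic_integrator (canonical_J m e) S \<longrightarrow>
           pseudo_symplectic (canonical_J m e) \<phi> (4 * n + 3) (real_part_method Sc \<alpha> s)))"
proof -
  interpret symmetric_conjugate S Sc f \<phi> \<alpha> s r
    by standard (use assms basic_method_at_0[OF assms(2,3,5)] in auto)
  show ?thesis
  proof (intro conjI impI)
    assume r: "r = 2 * n - 1"
    have o: "bigO_step x0 (2 * n + 1) (\<lambda>h x. R h x - \<phi> h x)" for x0
    proof -
      have "odd r" "r + 2 = 2 * n + 1" using r assms(9) by (auto simp: even_diff_nat)
      then show ?thesis using R_order_odd[of x0] by simp
    qed
    \<comment> \<open>Here the leading error term may be imaginary, so \<open>Ic\<close> has just
      the order \<open>r + 1 = 2n\<close> of the whole error.\<close>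
    have I: "bigO_step x0 (2 * n) (\<lambda>h x. Ic i (rpt (h, x)))" for x0 i
      using Ic_order_r[of x0 i] r assms(9) by simp
    have n: "1 \<le> 2 * n" "4 * n - 1 + 1 = 2 * (2 * n)" using assms(9) by auto
    note R_properties[OF o n(1) I n(2)]
    then show "has_order \<phi> (2 * n) R" "pseudo_symmetric \<phi> (4 * n - 1) R"
      "\<forall>m e. bij_betw e {..<2 * m} (UNIV :: 'd set) \<longrightarrow>
           hamiltonian_field (canonical_J m e) f \<longrightarrow>
           symplectic_integrator (canonical_J m e) S \<longrightarrow>
           pseudo_symplectic (canonical_J m e) \<phi> (4 * n - 1) R"
      by blast+
  next
    assume r: "r = 2 * n"
    have o: "bigO_step x0 (2 * n + 1) (\<lambda>h x. R h x - \<phi> h x)" for x0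
      using R_order_r[of x0] r by simp
    \<comment> \<open>Here the leading error term is real, so \<open>Ic\<close> gains one order over
      \<open>r + 1 = 2n + 1\<close>.\<close>
    have I: "bigO_step x0 (2 * n + 2) (\<lambda>h x. Ic i (rpt (h, x)))" for x0 i
      using Ic_order_even[of x0 i] r by simp
    have n: "1 \<le> 2 * n" "4 * n + 3 + 1 = 2 * (2 * n + 2)" using assms(9) by auto
    note R_properties[OF o n(1) I n(2)]
    then show "has_order \<phi> (2 * n) R" "pseudo_symmetric \<phi> (4 * n + 3) R"
      "\<forall>m e. bij_betw e {..<2 * m} (UNIV :: 'd set) \<longrightarrow>
           hamiltonian_field (canonical_J m e) f \<longrightarrow>
           symplectic_integrator (canonical_J m e) S \<longrightarrow>
           pseudo_symplectic (canonical_J m e) \<phi> (4 * n + 3) R"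
      by blast+
  qed
qed

end
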